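(* Let $k$ be a field. For an integer $n \ge 0$, the following are equivalent: (1) $n \le 3$. (2) $\mathfrak{B}_{n,k}^1$ is smooth (over $k$). (3) $\mathfrak{B}_{n,k}$ is smooth (over $k$).
   Context: All rings and algebras are commutative, associative, and with $1$. $\mathfrak{B}_n$ is the affine finite-type $\mathbb{Z}$-scheme representing the functor that sends a scheme $S$ to the set of isomorphism classes of pairs $(\mathcal{A},\phi)$ with $\mathcal{A}$ an $\mathcal{O}_S$-algebra and $\phi\colon \mathcal{A} \to \mathcal{O}_S^{\oplus n}$ an $\mathcal{O}_S$-module isomorphism (two pairs $(\mathcal{A},\phi)$, $(\mathcal{A}',\phi')$ are identified if there is an $\mathcal{O}_S$-algebra isomorphism $\alpha\colon\mathcal{A}\to\mathcal{A}'$ with $\phi'\circ\alpha=\phi$), and sends a morphism to pullback along it. For $n\ge1$, $\mathfrak{B}_n^1$ is the closed subscheme of $\mathfrak{B}_n$ parameterizing based algebras whose first basis vector equals $1$, i.e. those $(\mathcal{A},\phi)$ with $\phi(1)=(1,0,\dots,0)$; by convention $\mathfrak{B}_0^1:=\mathfrak{B}_0$. For a $\mathbb{Z}$-scheme $V$, $V_k=V\times_{\mathrm{Spec}\,\mathbb{Z}}\mathrm{Spec}\,k$; $\mathfrak{B}_{n,k}$ and $\mathfrak{B}_{n,k}^1$ denote these base changes. *)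

theory Defs
  imports
    "HOL-Algebra.Algebra"
    "HOL-Algebra.Algebraic_Closure_Type"
    "HOL-Library.Poly_Mapping"
begin

section \<open>Algebras over a commutative base ring\<close>

text \<open>
  The base ring is a type \<open>'k\<close>; it enters locale-based algebra as \<^const>\<open>ring_of_type_algebra\<close>.
  An algebra over it is a commutative ring with a structure map.
\<close>

definition algebra_over :: "('k::comm_ring_1 \<Rightarrow> 'b) \<Rightarrow> 'b ring \<Rightarrow> bool" where
  "algebra_over t B \<longleftrightarrow> cring B \<and> t \<in> ring_hom ring_of_type_algebra B"

definition alg_hom ::
  "('k::comm_ring_1 \<Rightarrow> 'b) \<Rightarrow> 'b ring \<Rightarrow> ('k \<Rightarrow> 'r) \<Rightarrow> 'r ring \<Rightarrow> ('b \<Rightarrow> 'r) set" where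
  "alg_hom t B s R = {h \<in> ring_hom B R. \<forall>a. h (t a) = s a}"

definition finite_type_algebra :: "('k::comm_ring_1 \<Rightarrow> 'b) \<Rightarrow> 'b ring \<Rightarrow> bool" where
  "finite_type_algebra t B \<longleftrightarrow> algebra_over t B \<and>
     (\<exists>S. finite S \<and> S \<subseteq> carrier B \<and> generate_ring B (range t \<union> S) = carrier B)"


section \<open>Smoothness\<close>

text \<open>
  Infinitesimal lifting: for every algebra \<open>R\<close> and every ideal \<open>J\<close> of \<open>R\<close> of square zero, every
  algebra homomorphism \<open>B \<rightarrow> R/J\<close> lifts to \<open>B \<rightarrow> R\<close>.
  HOL cannot quantify over types inside a formula, so the carriers of the test algebras \<open>R\<close> lie in
  the type \<open>'r\<close> given by the first argument.
\<close>

definition formally_smooth :: "'r itself \<Rightarrow> ('k::comm_ring_1 \<Rightarrow> 'b) \<Rightarrow> 'b ring \<Rightarrow> bool" where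
  "formally_smooth _ t B \<longleftrightarrow>
     (\<forall>(R :: 'r ring) s J.
        algebra_over s R \<longrightarrow> ideal J R \<longrightarrow> (\<forall>x\<in>J. \<forall>y\<in>J. x \<otimes>\<^bsub>R\<^esub> y = \<zero>\<^bsub>R\<^esub>) \<longrightarrow>
        (\<forall>g \<in> alg_hom t B (\<lambda>a. J +>\<^bsub>R\<^esub> s a) (R Quot J).
           \<exists>h \<in> alg_hom t B s R. \<forall>b \<in> carrier B. J +>\<^bsub>R\<^esub> h b = g b))"

text \<open>
  \<open>Spec B\<close> is smooth over the field \<open>'k\<close> if it is locally of finite presentation (over a field: \<open>B\<close> is
  of finite type) and formally smooth.  The test algebras have carriers in the type of sets of
  polynomials in countably many variables.  This is no restriction: by \<open>smooth_imp_formally_smooth\<close>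
  below, lifting then holds for test algebras with carrier in an arbitrary type.
\<close>

definition smooth_algebra :: "('k::field \<Rightarrow> 'b) \<Rightarrow> 'b ring \<Rightarrow> bool" where
  "smooth_algebra t B \<longleftrightarrow>
     finite_type_algebra t B \<and> formally_smooth TYPE(((nat \<Rightarrow>\<^sub>0 nat) \<Rightarrow>\<^sub>0 'k) set) t B"


section \<open>Polynomial rings\<close>

definition mpoly_ring :: "'v set \<Rightarrow> (('v \<Rightarrow>\<^sub>0 nat) \<Rightarrow>\<^sub>0 'k::comm_ring_1) ring" where
  "mpoly_ring V = ring_of_type_algebra
     \<lparr>carrier := {p. \<forall>m \<in> Poly_Mapping.keys p. Poly_Mapping.keys m \<subseteq> V}\<rparr>"

definition Const :: "'k::comm_ring_1 \<Rightarrow> ('v \<Rightarrow>\<^sub>0 nat) \<Rightarrow>\<^sub>0 'k" where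
  "Const a = Poly_Mapping.single 0 a"

definition Var :: "'v \<Rightarrow> ('v \<Rightarrow>\<^sub>0 nat) \<Rightarrow>\<^sub>0 'k::comm_ring_1" where
  "Var v = Poly_Mapping.single (Poly_Mapping.single v 1) 1"


text \<open>The algebra \<open>'k[V]/(F)\<close>, its structure map and the classes of the variables.\<close>

definition pres_ring ::
  "'v set \<Rightarrow> (('v \<Rightarrow>\<^sub>0 nat) \<Rightarrow>\<^sub>0 'k::comm_ring_1) set \<Rightarrow> (('v \<Rightarrow>\<^sub>0 nat) \<Rightarrow>\<^sub>0 'k) set ring" where
  "pres_ring V F = mpoly_ring V Quot genideal (mpoly_ring V) F"

definition pres_const ::
  "'v set \<Rightarrow> (('v \<Rightarrow>\<^sub>0 nat) \<Rightarrow>\<^sub>0 'k::comm_ring_1) set \<Rightarrow> 'k \<Rightarrow> (('v \<Rightarrow>\<^sub>0 nat) \<Rightarrow>\<^sub>0 'k) set" where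
  "pres_const V F a = genideal (mpoly_ring V) F +>\<^bsub>mpoly_ring V\<^esub> Const a"

definition pres_var ::
  "'v set \<Rightarrow> (('v \<Rightarrow>\<^sub>0 nat) \<Rightarrow>\<^sub>0 'k::comm_ring_1) set \<Rightarrow> 'v \<Rightarrow> (('v \<Rightarrow>\<^sub>0 nat) \<Rightarrow>\<^sub>0 'k) set" where
  "pres_var V F v = genideal (mpoly_ring V) F +>\<^bsub>mpoly_ring V\<^esub> Var v"


section \<open>The schemes of based algebras\<close>

text \<open>
  A based algebra of rank \<open>n\<close> over \<open>R\<close>: an \<open>R\<close>-algebra \<open>A\<close> with structure map \<open>s\<close> and an
  \<open>R\<close>-linear bijection \<open>\<phi>\<close> from \<open>A\<close> onto \<open>R\<^sup>n\<close>.
\<close>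

definition based_algebra ::
  "nat \<Rightarrow> 'r ring \<Rightarrow> 'a ring \<Rightarrow> ('r \<Rightarrow> 'a) \<Rightarrow> ('a \<Rightarrow> nat \<Rightarrow> 'r) \<Rightarrow> bool" where
  "based_algebra n R A s \<phi> \<longleftrightarrow> cring A \<and> s \<in> ring_hom R A \<and>
     bij_betw \<phi> (carrier A) ({..<n} \<rightarrow>\<^sub>E carrier R) \<and>
     (\<forall>x \<in> carrier A. \<forall>y \<in> carrier A. \<forall>i<n. \<phi> (x \<oplus>\<^bsub>A\<^esub> y) i = \<phi> x i \<oplus>\<^bsub>R\<^esub> \<phi> y i) \<and>
     (\<forall>r \<in> carrier R. \<forall>x \<in> carrier A. \<forall>i<n. \<phi> (s r \<otimes>\<^bsub>A\<^esub> x) i = r \<otimes>\<^bsub>R\<^esub> \<phi> x i)"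

definition std_basis :: "nat \<Rightarrow> 'r ring \<Rightarrow> nat \<Rightarrow> nat \<Rightarrow> 'r" where
  "std_basis n R i = (\<lambda>j\<in>{..<n}. if j = i then \<one>\<^bsub>R\<^esub> else \<zero>\<^bsub>R\<^esub>)"

definition basis_vec :: "nat \<Rightarrow> 'r ring \<Rightarrow> 'a ring \<Rightarrow> ('a \<Rightarrow> nat \<Rightarrow> 'r) \<Rightarrow> nat \<Rightarrow> 'a" where
  "basis_vec n R A \<phi> i = inv_into (carrier A) \<phi> (std_basis n R i)"

text \<open>
  Coordinates: \<open>Str i j l\<close> is the coefficient of the \<open>l\<close>-th basis vector in the product of the
  \<open>i\<close>-th and the \<open>j\<close>-th one, and \<open>Unt i\<close> is the \<open>i\<close>-th coefficient of the unit element.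
  Basis vectors are numbered from 0.
\<close>

datatype coord = Str nat nat nat | Unt nat

definition coords :: "nat \<Rightarrow> coord set" where
  "coords n = {Str i j l | i j l. i < n \<and> j < n \<and> l < n} \<union> {Unt i | i. i < n}"

definition relations :: "nat \<Rightarrow> ((coord \<Rightarrow>\<^sub>0 nat) \<Rightarrow>\<^sub>0 'k::comm_ring_1) set" where
  "relations n =
     {Var (Str i j l) - Var (Str j i l) | i j l. i < n \<and> j < n \<and> l < n} \<union>
     {(\<Sum>r<n. Var (Str i j r) * Var (Str r l m)) - (\<Sum>r<n. Var (Str j l r) * Var (Str i r m))
       | i j l m. i < n \<and> j < n \<and> l < n \<and> m < n} \<union>
     {(\<Sum>r<n. Var (Unt r) * Var (Str r i m)) - (if i = m then 1 else 0) | i m. i < n \<and> m < n}"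

text \<open>
  The coordinate rings of \<open>\<BB>\<^sub>n\<close> and \<open>\<BB>\<^sub>n\<^sup>1\<close>, base changed from \<open>\<int>\<close> to \<open>'k\<close>: the relations have integer
  coefficients, so the base change is the same presentation over \<open>'k\<close>; \<open>'k = int\<close> gives the schemes
  themselves.
  For \<open>n = 0\<close> there are no variables and no relations, and both rings coincide.
  The theorems \<open>based_coord_ring_point\<close>, \<open>based_coord_ring_based_algebra\<close>, \<open>classifies_iso\<close>,
  \<open>classifies_imp_iso\<close> and \<open>classifies_base_change\<close> below (and the two first with \<open>based1\<close>) show
  that, over every base ring \<open>'k\<close>, they represent the functors of based algebras up to isomorphism.
\<close>

definition based_coord_ring :: "nat \<Rightarrow> ((coord \<Rightarrow>\<^sub>0 nat) \<Rightarrow>\<^sub>0 'k::comm_ring_1) set ring" where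
  "based_coord_ring n = pres_ring (coords n) (relations n)"

definition based_const :: "nat \<Rightarrow> 'k::comm_ring_1 \<Rightarrow> ((coord \<Rightarrow>\<^sub>0 nat) \<Rightarrow>\<^sub>0 'k) set" where
  "based_const n = pres_const (coords n) (relations n)"

definition based_var :: "nat \<Rightarrow> coord \<Rightarrow> ((coord \<Rightarrow>\<^sub>0 nat) \<Rightarrow>\<^sub>0 'k::comm_ring_1) set" where
  "based_var n = pres_var (coords n) (relations n)"

definition relations1 :: "nat \<Rightarrow> ((coord \<Rightarrow>\<^sub>0 nat) \<Rightarrow>\<^sub>0 'k::comm_ring_1) set" where
  "relations1 n = relations n \<union> {Var (Unt i) - (if i = 0 then 1 else 0) | i. i < n}"

definition based1_coord_ring :: "nat \<Rightarrow> ((coord \<Rightarrow>\<^sub>0 nat) \<Rightarrow>\<^sub>0 'k::comm_ring_1) set ring" where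
  "based1_coord_ring n = pres_ring (coords n) (relations1 n)"

definition based1_const :: "nat \<Rightarrow> 'k::comm_ring_1 \<Rightarrow> ((coord \<Rightarrow>\<^sub>0 nat) \<Rightarrow>\<^sub>0 'k) set" where
  "based1_const n = pres_const (coords n) (relations1 n)"

definition based1_var :: "nat \<Rightarrow> coord \<Rightarrow> ((coord \<Rightarrow>\<^sub>0 nat) \<Rightarrow>\<^sub>0 'k::comm_ring_1) set" where
  "based1_var n = pres_var (coords n) (relations1 n)"

text \<open>The coordinates \<open>c\<close> of the \<open>R\<close>-valued point given by a based algebra \<open>(A, \<phi>)\<close>.\<close>

definition classifies ::
  "nat \<Rightarrow> 'r ring \<Rightarrow> 'a ring \<Rightarrow> ('a \<Rightarrow> nat \<Rightarrow> 'r) \<Rightarrow> (coord \<Rightarrow> 'r) \<Rightarrow> bool" where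
  "classifies n R A \<phi> c \<longleftrightarrow>
     (\<forall>i<n. \<forall>j<n. \<forall>l<n.
        c (Str i j l) = \<phi> (basis_vec n R A \<phi> i \<otimes>\<^bsub>A\<^esub> basis_vec n R A \<phi> j) l) \<and>
     (\<forall>i<n. c (Unt i) = \<phi> \<one>\<^bsub>A\<^esub> i)"


section \<open>Polynomial rings: basic facts\<close>

lemma rota_simps [simp]:
  "carrier (ring_of_type_algebra :: 'a::comm_ring_1 ring) = UNIV"
  "x \<otimes>\<^bsub>(ring_of_type_algebra :: 'a::comm_ring_1 ring)\<^esub> y = x * y"
  "x \<oplus>\<^bsub>(ring_of_type_algebra :: 'a::comm_ring_1 ring)\<^esub> y = x + y"
  "\<one>\<^bsub>(ring_of_type_algebra :: 'a::comm_ring_1 ring)\<^esub> = 1"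
  "\<zero>\<^bsub>(ring_of_type_algebra :: 'a::comm_ring_1 ring)\<^esub> = 0"
  by (simp_all add: ring_of_type_algebra_def)

lemma mpoly_simps [simp]:
  "x \<otimes>\<^bsub>mpoly_ring V\<^esub> y = x * y" "x \<oplus>\<^bsub>mpoly_ring V\<^esub> y = x + y"
  "\<one>\<^bsub>mpoly_ring V\<^esub> = 1" "\<zero>\<^bsub>mpoly_ring V\<^esub> = 0"
  by (simp_all add: mpoly_ring_def)

lemma mpoly_carrier:
  "p \<in> carrier (mpoly_ring V) \<longleftrightarrow> (\<forall>m\<in>Poly_Mapping.keys p. Poly_Mapping.keys m \<subseteq> V)"
  by (simp add: mpoly_ring_def)

lemma mpoly_add: "p \<in> carrier (mpoly_ring V) \<Longrightarrow> q \<in> carrier (mpoly_ring V) \<Longrightarrow> p + q \<in> carrier (mpoly_ring V)"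
  using Poly_Mapping.keys_add[of p q] by (auto simp: mpoly_carrier)

lemma mpoly_uminus: "p \<in> carrier (mpoly_ring V) \<Longrightarrow> - p \<in> carrier (mpoly_ring V)"
  by (auto simp: mpoly_carrier in_keys_iff)

lemma mpoly_minus: "p \<in> carrier (mpoly_ring V) \<Longrightarrow> q \<in> carrier (mpoly_ring V) \<Longrightarrow> p - q \<in> carrier (mpoly_ring V)"
  using mpoly_add[OF _ mpoly_uminus] by force

lemma mpoly_mult: "p \<in> carrier (mpoly_ring V) \<Longrightarrow> q \<in> carrier (mpoly_ring V) \<Longrightarrow> p * q \<in> carrier (mpoly_ring V)"
  unfolding mpoly_carrier
proof
  fix m assume p: "\<forall>m\<in>Poly_Mapping.keys p. Poly_Mapping.keys m \<subseteq> V"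
    and q: "\<forall>m\<in>Poly_Mapping.keys q. Poly_Mapping.keys m \<subseteq> V" and m: "m \<in> Poly_Mapping.keys (p * q)"
  then obtain a b where "m = a + b" "a \<in> Poly_Mapping.keys p" "b \<in> Poly_Mapping.keys q"
    using keys_mult[of p q] by blast
  then show "Poly_Mapping.keys m \<subseteq> V"
    using p q Poly_Mapping.keys_add[of a b] by blast
qed

lemma mpoly_Const: "Const a \<in> carrier (mpoly_ring V)"
  by (simp add: mpoly_carrier Const_def)

lemma mpoly_Var: "v \<in> V \<Longrightarrow> Var v \<in> carrier (mpoly_ring V)"
  by (simp add: mpoly_carrier Var_def)

lemma mpoly_01: "0 \<in> carrier (mpoly_ring V)" "1 \<in> carrier (mpoly_ring V)"
  by (simp_all add: mpoly_carrier)

lemma mpoly_cring: "cring (mpoly_ring V)"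
proof (rule cringI)
  show "abelian_group (mpoly_ring V)"
    by (rule abelian_groupI)
      (auto simp: mpoly_add mpoly_01 algebra_simps intro!: bexI[OF _ mpoly_uminus])
  show "comm_monoid (mpoly_ring V)"
    by (rule comm_monoidI) (auto simp: mpoly_mult mpoly_01 algebra_simps)
qed (auto simp: algebra_simps)

lemma Const_hom: "Const \<in> ring_hom ring_of_type_algebra (mpoly_ring V)"
  by (rule ring_hom_memI)
    (auto simp: mpoly_Const, auto simp: Const_def mult_single single_add)

lemma mpoly_algebra: "algebra_over Const (mpoly_ring V)"
  by (simp add: algebra_over_def mpoly_cring Const_hom)

lemma mpoly_a_inv: "p \<in> carrier (mpoly_ring V) \<Longrightarrow> \<ominus>\<^bsub>mpoly_ring V\<^esub> p = - p"
proof -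
  interpret cring "mpoly_ring V" by (rule mpoly_cring)
  assume "p \<in> carrier (mpoly_ring V)"
  then show ?thesis by (intro minus_equality) (auto simp: mpoly_uminus)
qed

lemma mpoly_a_minus: "p \<in> carrier (mpoly_ring V) \<Longrightarrow> q \<in> carrier (mpoly_ring V) \<Longrightarrow> p \<ominus>\<^bsub>mpoly_ring V\<^esub> q = p - q"
  by (simp add: a_minus_def mpoly_a_inv)

lemma mpoly_sum: "(\<And>i. i \<in> I \<Longrightarrow> f i \<in> carrier (mpoly_ring V)) \<Longrightarrow> sum f I \<in> carrier (mpoly_ring V)"
  by (induction I rule: infinite_finite_induct) (auto simp: mpoly_add mpoly_01)

lemma poly_mapping_sum_single: "p = (\<Sum>m\<in>Poly_Mapping.keys p. Poly_Mapping.single m (Poly_Mapping.lookup p m))"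
proof (rule poly_mapping_eqI)
  fix k
  have "(\<Sum>m\<in>Poly_Mapping.keys p. Poly_Mapping.lookup (Poly_Mapping.single m (Poly_Mapping.lookup p m)) k)
    = (\<Sum>m\<in>Poly_Mapping.keys p. if m = k then Poly_Mapping.lookup p m else 0)"
    by (intro sum.cong) (simp_all add: lookup_single when_def)
  then show "Poly_Mapping.lookup p k = Poly_Mapping.lookup
      (\<Sum>m\<in>Poly_Mapping.keys p. Poly_Mapping.single m (Poly_Mapping.lookup p m)) k"
    by (simp add: lookup_sum in_keys_iff)
qed

lemma Var_pow: "Var v ^ k = Poly_Mapping.single (Poly_Mapping.single v k) 1"
  by (induction k) (simp_all add: Var_def mult_single single_add[symmetric])

lemma mpoly_induct [consumes 1, case_names Const Var add mult]:
  assumes p: "p \<in> carrier (mpoly_ring V)"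
    and C: "\<And>a. P (Const a)" and X: "\<And>v. v \<in> V \<Longrightarrow> P (Var v)"
    and add: "\<And>p q. p \<in> carrier (mpoly_ring V) \<Longrightarrow> q \<in> carrier (mpoly_ring V) \<Longrightarrow> P p \<Longrightarrow> P q \<Longrightarrow> P (p + q)"
    and mult: "\<And>p q. p \<in> carrier (mpoly_ring V) \<Longrightarrow> q \<in> carrier (mpoly_ring V) \<Longrightarrow> P p \<Longrightarrow> P q \<Longrightarrow> P (p * q)"
  shows "P p"
proof -
  define Q where "Q p \<longleftrightarrow> p \<in> carrier (mpoly_ring V) \<and> P p" for p
  have QC: "Q (Const a)" for a by (simp add: Q_def C mpoly_Const)
  have Qadd: "Q p \<Longrightarrow> Q q \<Longrightarrow> Q (p + q)" for p q by (auto simp: Q_def mpoly_add add)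
  have Qmult: "Q p \<Longrightarrow> Q q \<Longrightarrow> Q (p * q)" for p q by (auto simp: Q_def mpoly_mult mult)
  have Q0: "Q 0" and Q1: "Q 1" using QC[of 0] QC[of 1] by (simp_all add: Const_def)
  have QX: "Q (Var v)" if "v \<in> V" for v using that by (simp add: Q_def X mpoly_Var)
  have Qpow: "Q (Var v ^ k)" if "v \<in> V" for v k
    by (induction k) (simp_all add: Q1 Qmult QX that)
  have Qsum: "Q (sum f I)" if "\<And>i. i \<in> I \<Longrightarrow> Q (f i)" for f and I :: "('a \<Rightarrow>\<^sub>0 nat) set"
    using that by (induction I rule: infinite_finite_induct) (auto simp: Q0 Qadd)
  have mon: "finite I \<Longrightarrow> I \<subseteq> V \<Longrightarrow> Q (Poly_Mapping.single (\<Sum>v\<in>I. Poly_Mapping.single v (f v)) 1)" for I f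
  proof (induction I rule: finite_induct)
    case empty
    then show ?case using Q1 by simp
  next
    case (insert v I)
    have "Q (Var v ^ f v * Poly_Mapping.single (\<Sum>v\<in>I. Poly_Mapping.single v (f v)) 1)"
      using insert by (intro Qmult Qpow) auto
    moreover have "Var v ^ f v * Poly_Mapping.single (\<Sum>v\<in>I. Poly_Mapping.single v (f v)) 1
      = Poly_Mapping.single (\<Sum>v\<in>insert v I. Poly_Mapping.single v (f v)) (1::'b)"
      using insert by (simp add: Var_pow mult_single)
    ultimately show ?case by simp
  qed
  have "Q (Poly_Mapping.single m a)" if "Poly_Mapping.keys m \<subseteq> V" for m a
  proof -
    have "Q (Poly_Mapping.single m 1)"
      by (subst poly_mapping_sum_single[of m]) (rule mon[OF _ that], simp)
    then have "Q (Const a * Poly_Mapping.single m 1)"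
      by (intro Qmult QC)
    then show ?thesis by (simp add: Const_def mult_single)
  qed
  then have "Q (\<Sum>m\<in>Poly_Mapping.keys p. Poly_Mapping.single m (Poly_Mapping.lookup p m))"
    using p by (intro Qsum) (auto simp: mpoly_carrier)
  then have "Q p" by (subst poly_mapping_sum_single[of p])
  then show ?thesis by (simp add: Q_def)
qed


section \<open>Algebra homomorphisms and presentations\<close>

lemma alg_homD:
  assumes "h \<in> alg_hom t B s R"
  shows "h \<in> ring_hom B R" "h (t a) = s a"
    "x \<in> carrier B \<Longrightarrow> h x \<in> carrier R"
    "x \<in> carrier B \<Longrightarrow> y \<in> carrier B \<Longrightarrow> h (x \<oplus>\<^bsub>B\<^esub> y) = h x \<oplus>\<^bsub>R\<^esub> h y"
    "x \<in> carrier B \<Longrightarrow> y \<in> carrier B \<Longrightarrow> h (x \<otimes>\<^bsub>B\<^esub> y) = h x \<otimes>\<^bsub>R\<^esub> h y"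
    "h \<one>\<^bsub>B\<^esub> = \<one>\<^bsub>R\<^esub>"
  using assms by (auto simp: alg_hom_def ring_hom_def)

lemma algebra_overD:
  assumes "algebra_over s R"
  shows "cring R" "s a \<in> carrier R" "s (a + b) = s a \<oplus>\<^bsub>R\<^esub> s b" "s (a * b) = s a \<otimes>\<^bsub>R\<^esub> s b"
    "s 1 = \<one>\<^bsub>R\<^esub>" "s 0 = \<zero>\<^bsub>R\<^esub>"
proof -
  show 1: "cring R" "s a \<in> carrier R" "s (a + b) = s a \<oplus>\<^bsub>R\<^esub> s b" "s (a * b) = s a \<otimes>\<^bsub>R\<^esub> s b"
    "s 1 = \<one>\<^bsub>R\<^esub>" using assms by (auto simp: algebra_over_def ring_hom_def)
  have "s \<in> ring_hom ring_of_type_algebra R" using assms by (simp add: algebra_over_def)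
  from ring_hom_zero[OF this] show "s 0 = \<zero>\<^bsub>R\<^esub>"
    using ring_from_type_algebra cring.axioms(1)[OF 1(1)] by simp
qed

lemma alg_hom_zero:
  "h \<in> alg_hom t B s R \<Longrightarrow> cring B \<Longrightarrow> cring R \<Longrightarrow> h \<zero>\<^bsub>B\<^esub> = \<zero>\<^bsub>R\<^esub>"
  using ring_hom_zero[of h B R] by (auto simp: alg_hom_def cring.axioms(1))

lemma alg_hom_a_inv:
  assumes h: "h \<in> alg_hom t B s R" "cring B" "cring R" "x \<in> carrier B"
  shows "h (\<ominus>\<^bsub>B\<^esub> x) = \<ominus>\<^bsub>R\<^esub> h x"
proof -
  interpret B: cring B by fact
  interpret R: cring R by fact
  have "h (\<ominus>\<^bsub>B\<^esub> x) \<oplus>\<^bsub>R\<^esub> h x = h (\<ominus>\<^bsub>B\<^esub> x \<oplus>\<^bsub>B\<^esub> x)"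
    using alg_homD(4)[OF h(1)] h(4) by simp
  also have "\<dots> = \<zero>\<^bsub>R\<^esub>" using alg_hom_zero[OF h(1-3)] h(4) by (simp add: B.l_neg)
  finally show ?thesis
    using alg_homD(3)[OF h(1)] h(4) R.minus_equality by (metis B.a_inv_closed)
qed

lemma alg_hom_comp:
  assumes "h \<in> alg_hom t B s R" "f \<in> alg_hom s R u T"
  shows "(\<lambda>x. f (h x)) \<in> alg_hom t B u T"
  using alg_homD[OF assms(1)] alg_homD[OF assms(2)]
  by (simp add: alg_hom_def ring_hom_memI)

lemma algebra_over_quot:
  assumes "algebra_over s R" "ideal J R"
  shows "algebra_over (\<lambda>a. J +>\<^bsub>R\<^esub> s a) (R Quot J)" "(\<lambda>x. J +>\<^bsub>R\<^esub> x) \<in> alg_hom s R (\<lambda>a. J +>\<^bsub>R\<^esub> s a) (R Quot J)"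
proof -
  have q: "(\<lambda>x. J +>\<^bsub>R\<^esub> x) \<in> ring_hom R (R Quot J)" using ideal.rcos_ring_hom[OF assms(2)] .
  show "(\<lambda>x. J +>\<^bsub>R\<^esub> x) \<in> alg_hom s R (\<lambda>a. J +>\<^bsub>R\<^esub> s a) (R Quot J)"
    using q by (simp add: alg_hom_def)
  show "algebra_over (\<lambda>a. J +>\<^bsub>R\<^esub> s a) (R Quot J)"
    unfolding algebra_over_def
  proof
    show "cring (R Quot J)" using ideal.quotient_is_cring[OF assms(2)] assms(1) by (simp add: algebra_over_def)
    show "(\<lambda>a. J +>\<^bsub>R\<^esub> s a) \<in> ring_hom ring_of_type_algebra (R Quot J)"
      by (intro ring_hom_memI; unfold rota_simps algebra_overD[OF assms(1)])
        (simp_all add: ring_hom_closed[OF q] ring_hom_mult[OF q] ring_hom_add[OF q] ring_hom_one[OF q]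
          algebra_overD[OF assms(1)])
  qed
qed

lemma quot_carrier: "x \<in> carrier (R Quot J) \<longleftrightarrow> (\<exists>r\<in>carrier R. x = J +>\<^bsub>R\<^esub> r)"
  by (auto simp: FactRing_def A_RCOSETS_def')

lemma quot_eq_iff:
  assumes "ideal J R" "x \<in> carrier R" "y \<in> carrier R"
  shows "J +>\<^bsub>R\<^esub> x = J +>\<^bsub>R\<^esub> y \<longleftrightarrow> x \<ominus>\<^bsub>R\<^esub> y \<in> J"
  using ring.quotient_eq_iff_same_a_r_cos[OF ideal.axioms(2)[OF assms(1)] assms] by blast

lemma quot_eq_zero_iff:
  assumes "ideal J R" "x \<in> carrier R"
  shows "J +>\<^bsub>R\<^esub> x = \<zero>\<^bsub>R Quot J\<^esub> \<longleftrightarrow> x \<in> J"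
proof -
  interpret ideal J R by fact
  show ?thesis using assms(2) a_rcos_const a_rcos_self by (auto simp: FactRing_def)
qed

lemma hom_factor:
  assumes P: "cring P" and Q: "cring Q" and T: "cring T"
    and q: "q \<in> alg_hom t P u Q" and surj: "q ` carrier P = carrier Q"
    and f: "f \<in> alg_hom t P s T" and t: "\<And>a. t a \<in> carrier P"
    and ker: "\<And>p. p \<in> carrier P \<Longrightarrow> q p = \<zero>\<^bsub>Q\<^esub> \<Longrightarrow> f p = \<zero>\<^bsub>T\<^esub>"
  shows "\<exists>g\<in>alg_hom u Q s T. \<forall>p\<in>carrier P. g (q p) = f p"
proof -
  interpret P: cring P by fact
  interpret Q: cring Q by fact
  interpret T: cring T by fact
  have eq: "f x = f y" if xy: "x \<in> carrier P" "y \<in> carrier P" "q x = q y" for x y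
  proof -
    have "q (x \<oplus>\<^bsub>P\<^esub> \<ominus>\<^bsub>P\<^esub> y) = \<zero>\<^bsub>Q\<^esub>"
      using xy alg_homD[OF q] alg_hom_a_inv[OF q P Q] by (simp add: Q.r_neg)
    then have "f (x \<oplus>\<^bsub>P\<^esub> \<ominus>\<^bsub>P\<^esub> y) = \<zero>\<^bsub>T\<^esub>" using ker xy by simp
    then have "f x \<oplus>\<^bsub>T\<^esub> \<ominus>\<^bsub>T\<^esub> f y = \<zero>\<^bsub>T\<^esub>"
      using xy alg_homD[OF f] alg_hom_a_inv[OF f P T] by simp
    then show ?thesis using xy alg_homD(3)[OF f]
      by (metis T.a_inv_closed T.minus_equality T.minus_minus)
  qed
  define g where "g z = f (inv_into (carrier P) q z)" for z
  have g: "g (q p) = f p" if "p \<in> carrier P" for p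
    unfolding g_def using that
    by (intro eq) (auto intro: inv_into_into f_inv_into_f)
  have "g \<in> ring_hom Q T"
  proof (rule ring_hom_memI)
    fix x y assume "x \<in> carrier Q" "y \<in> carrier Q"
    then obtain a b where ab: "a \<in> carrier P" "b \<in> carrier P" "x = q a" "y = q b"
      using surj by (metis imageE)
    show "g x \<in> carrier T" using ab g alg_homD[OF f] by simp
    show "g (x \<otimes>\<^bsub>Q\<^esub> y) = g x \<otimes>\<^bsub>T\<^esub> g y"
      using ab g[of "a \<otimes>\<^bsub>P\<^esub> b"] g alg_homD[OF f] alg_homD[OF q] by simp
    show "g (x \<oplus>\<^bsub>Q\<^esub> y) = g x \<oplus>\<^bsub>T\<^esub> g y"
      using ab g[of "a \<oplus>\<^bsub>P\<^esub> b"] g alg_homD[OF f] alg_homD[OF q] by simp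
  next
    show "g \<one>\<^bsub>Q\<^esub> = \<one>\<^bsub>T\<^esub>" using g[of "\<one>\<^bsub>P\<^esub>"] alg_homD(6)[OF f] alg_homD(6)[OF q] by simp
  qed
  moreover have "g (u a) = s a" for a
    using g[OF t[of a]] alg_homD(2)[OF f, of a] alg_homD(2)[OF q, of a] by simp
  ultimately show ?thesis using g by (auto simp: alg_hom_def)
qed

lemma mpoly_hom_unique:
  assumes "h \<in> alg_hom Const (mpoly_ring V) s R" "h' \<in> alg_hom Const (mpoly_ring V) s R"
    and "\<And>v. v \<in> V \<Longrightarrow> h (Var v) = h' (Var v)" "p \<in> carrier (mpoly_ring V)"
  shows "h p = h' p"
  using assms(4)
proof (induction p rule: mpoly_induct)
  case (Const a)
  then show ?case using alg_homD(2)[OF assms(1)] alg_homD(2)[OF assms(2)] by simp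
next
  case (add p q)
  then show ?case using alg_homD(4)[OF assms(1), of p q] alg_homD(4)[OF assms(2), of p q] by simp
next
  case (mult p q)
  then show ?case using alg_homD(5)[OF assms(1), of p q] alg_homD(5)[OF assms(2), of p q] by simp
qed (use assms in auto)

lemma mpoly_eval_total:
  assumes A: "algebra_over s R" and x: "\<And>v. x v \<in> carrier R"
  shows "\<exists>e\<in>alg_hom Const (mpoly_ring (UNIV::'v set)) s R. \<forall>v. e (Var v) = x v"
proof -
  interpret R: cring R using algebra_overD[OF A] by simp
  note s = algebra_overD[OF A]
  define mon :: "('v \<Rightarrow>\<^sub>0 nat) \<Rightarrow> _" where
    "mon m = finprod R (\<lambda>v. x v [^]\<^bsub>R\<^esub> Poly_Mapping.lookup m v) (Poly_Mapping.keys m)" for m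
  have mon_sup: "mon m = finprod R (\<lambda>v. x v [^]\<^bsub>R\<^esub> Poly_Mapping.lookup m v) K"
    if "finite K" "Poly_Mapping.keys m \<subseteq> K" for m K
    unfolding mon_def using that x
    by (intro R.finprod_mono_neutral_cong_left) (auto simp: in_keys_iff)
  have monc: "mon m \<in> carrier R" for m unfolding mon_def by (intro R.finprod_closed) (auto simp: x)
  have mon0: "mon 0 = \<one>\<^bsub>R\<^esub>" by (simp add: mon_def)
  have mon_add: "mon (m + m') = mon m \<otimes>\<^bsub>R\<^esub> mon m'" for m m'
  proof -
    define K where "K = Poly_Mapping.keys m \<union> Poly_Mapping.keys m'"
    have K: "finite K" by (simp add: K_def)
    have "mon (m + m') = finprod R (\<lambda>v. x v [^]\<^bsub>R\<^esub> Poly_Mapping.lookup (m + m') v) K"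
      using Poly_Mapping.keys_add[of m m'] K by (intro mon_sup) (auto simp: K_def)
    also have "\<dots> = finprod R (\<lambda>v. x v [^]\<^bsub>R\<^esub> Poly_Mapping.lookup m v \<otimes>\<^bsub>R\<^esub> x v [^]\<^bsub>R\<^esub> Poly_Mapping.lookup m' v) K"
      by (intro R.finprod_cong') (auto simp: x lookup_add R.nat_pow_mult)
    also have "\<dots> = finprod R (\<lambda>v. x v [^]\<^bsub>R\<^esub> Poly_Mapping.lookup m v) K \<otimes>\<^bsub>R\<^esub>
        finprod R (\<lambda>v. x v [^]\<^bsub>R\<^esub> Poly_Mapping.lookup m' v) K"
      by (intro R.finprod_multf) (auto simp: x)
    also have "\<dots> = mon m \<otimes>\<^bsub>R\<^esub> mon m'"
      using K by (simp add: mon_sup[of K] K_def)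
    finally show ?thesis .
  qed
  have monV: "mon (Poly_Mapping.single v 1) = x v" for v
    unfolding mon_def using x by (simp add: R.finprod_insert)
  define tm where "tm p m = s (Poly_Mapping.lookup p m) \<otimes>\<^bsub>R\<^esub> mon m" for p m
  define e where "e p = finsum R (tm p) (Poly_Mapping.keys p)" for p
  have tmc: "tm p m \<in> carrier R" for p m by (simp add: tm_def s monc)
  have e_sup: "e p = finsum R (tm p) K" if "finite K" "Poly_Mapping.keys p \<subseteq> K" for p K
    unfolding e_def using that
    by (intro R.add.finprod_mono_neutral_cong_left) (auto simp: tmc, auto simp: tm_def in_keys_iff s monc)
  have ec: "e p \<in> carrier R" for p unfolding e_def by (intro R.finsum_closed) (auto simp: tmc)
  have e_add: "e (p + q) = e p \<oplus>\<^bsub>R\<^esub> e q" for p q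
  proof -
    define K where "K = Poly_Mapping.keys p \<union> Poly_Mapping.keys q"
    have K: "finite K" by (simp add: K_def)
    have "e (p + q) = finsum R (tm (p + q)) K"
      using Poly_Mapping.keys_add[of p q] K by (intro e_sup) (auto simp: K_def)
    also have "\<dots> = finsum R (\<lambda>m. tm p m \<oplus>\<^bsub>R\<^esub> tm q m) K"
      by (intro R.finsum_cong') (auto simp: tmc, auto simp: tm_def lookup_add s monc R.l_distr)
    also have "\<dots> = finsum R (tm p) K \<oplus>\<^bsub>R\<^esub> finsum R (tm q) K"
      by (intro R.finsum_addf) (auto simp: tmc)
    also have "\<dots> = e p \<oplus>\<^bsub>R\<^esub> e q" using K by (simp add: e_sup[of K] K_def)
    finally show ?thesis .
  qed
  have e0: "e 0 = \<zero>\<^bsub>R\<^esub>" by (simp add: e_def)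
  have e_single: "e (Poly_Mapping.single m a) = s a \<otimes>\<^bsub>R\<^esub> mon m" for m a
  proof -
    have "e (Poly_Mapping.single m a) = finsum R (tm (Poly_Mapping.single m a)) {m}"
      by (intro e_sup) auto
    then show ?thesis using tmc[of _ m] by (simp add: R.finsum_insert tm_def s monc)
  qed
  have ind: "Q p" if "Q 0" "\<And>m a. Q (Poly_Mapping.single m a)" "\<And>p q. Q p \<Longrightarrow> Q q \<Longrightarrow> Q (p + q)"
    for Q and p :: "('v \<Rightarrow>\<^sub>0 nat) \<Rightarrow>\<^sub>0 'a"
  proof -
    have S: "Q (sum f I)" if "\<And>i. Q (f i)" for f and I :: "('v \<Rightarrow>\<^sub>0 nat) set"
      by (induction I rule: infinite_finite_induct) (use \<open>Q 0\<close> \<open>\<And>p q. Q p \<Longrightarrow> Q q \<Longrightarrow> Q (p + q)\<close> that in auto)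
    show ?thesis by (subst poly_mapping_sum_single[of p]) (rule S, rule that(2))
  qed
  have e_mult: "e (p * q) = e p \<otimes>\<^bsub>R\<^esub> e q" for p q
  proof (rule ind[of "\<lambda>p. e (p * q) = e p \<otimes>\<^bsub>R\<^esub> e q"])
    show "e (0 * q) = e 0 \<otimes>\<^bsub>R\<^esub> e q" by (simp add: e0 ec)
    show "e ((p + p') * q) = e (p + p') \<otimes>\<^bsub>R\<^esub> e q"
      if "e (p * q) = e p \<otimes>\<^bsub>R\<^esub> e q" "e (p' * q) = e p' \<otimes>\<^bsub>R\<^esub> e q" for p p'
      using that by (simp add: distrib_right e_add R.l_distr ec)
    fix m a
    show "e (Poly_Mapping.single m a * q) = e (Poly_Mapping.single m a) \<otimes>\<^bsub>R\<^esub> e q"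
    proof (rule ind[of "\<lambda>q. e (Poly_Mapping.single m a * q) = e (Poly_Mapping.single m a) \<otimes>\<^bsub>R\<^esub> e q"])
      show "e (Poly_Mapping.single m a * 0) = e (Poly_Mapping.single m a) \<otimes>\<^bsub>R\<^esub> e 0" by (simp add: e0 ec)
      show "e (Poly_Mapping.single m a * (p + p')) = e (Poly_Mapping.single m a) \<otimes>\<^bsub>R\<^esub> e (p + p')"
        if "e (Poly_Mapping.single m a * p) = e (Poly_Mapping.single m a) \<otimes>\<^bsub>R\<^esub> e p"
           "e (Poly_Mapping.single m a * p') = e (Poly_Mapping.single m a) \<otimes>\<^bsub>R\<^esub> e p'" for p p'
        using that by (simp add: distrib_left e_add R.r_distr ec)
      show "e (Poly_Mapping.single m a * Poly_Mapping.single m' a') =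
          e (Poly_Mapping.single m a) \<otimes>\<^bsub>R\<^esub> e (Poly_Mapping.single m' a')" for m' a'
        by (simp add: mult_single e_single s mon_add monc R.m_ac)
    qed
  qed
  have "e \<in> alg_hom Const (mpoly_ring UNIV) s R"
    unfolding alg_hom_def
  proof (intro CollectI conjI allI ring_hom_memI)
    show "e (Const a) = s a" for a by (simp add: Const_def e_single mon0 s)
    then have "e (Const 1) = \<one>\<^bsub>R\<^esub>" by (simp add: s)
    then show "e \<one>\<^bsub>mpoly_ring UNIV\<^esub> = \<one>\<^bsub>R\<^esub>" by (simp add: Const_def)
  qed (simp_all add: ec e_add e_mult)
  moreover have "e (Var v) = x v" for v by (simp add: Var_def e_single s x monV[simplified])
  ultimately show ?thesis by blast
qed

lemma mpoly_eval:
  assumes A: "algebra_over s R" and x: "\<And>v. v \<in> V \<Longrightarrow> x v \<in> carrier R"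
  shows "\<exists>e\<in>alg_hom Const (mpoly_ring V) s R. \<forall>v\<in>V. e (Var v) = x v"
proof -
  interpret R: cring R using algebra_overD[OF A] by simp
  obtain e where e: "e \<in> alg_hom Const (mpoly_ring UNIV) s R"
    "\<And>v. e (Var v) = (if v \<in> V then x v else \<zero>\<^bsub>R\<^esub>)"
    using mpoly_eval_total[OF A, of "\<lambda>v. if v \<in> V then x v else \<zero>\<^bsub>R\<^esub>"] x
    by (metis (mono_tags, lifting) R.zero_closed)
  have "e \<in> alg_hom Const (mpoly_ring V) s R"
    using e(1) by (auto simp: alg_hom_def ring_hom_def mpoly_carrier)
  then show ?thesis using e(2) by (metis (full_types))
qed

lemma pres_ideal:
  assumes "F \<subseteq> carrier (mpoly_ring V)"
  shows "ideal (genideal (mpoly_ring V) F) (mpoly_ring V)"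
  using ring.genideal_ideal[OF cring.axioms(1)[OF mpoly_cring] assms] .

lemma pres_algebra:
  assumes "F \<subseteq> carrier (mpoly_ring V)"
  shows "algebra_over (pres_const V F) (pres_ring V F)"
    "(\<lambda>p. genideal (mpoly_ring V) F +>\<^bsub>mpoly_ring V\<^esub> p) \<in> alg_hom Const (mpoly_ring V) (pres_const V F) (pres_ring V F)"
  using algebra_over_quot[OF mpoly_algebra pres_ideal[OF assms]]
  by (simp_all add: pres_const_def[abs_def] pres_ring_def)

lemma pres_eval:
  fixes V :: "'v set" and s :: "'k::comm_ring_1 \<Rightarrow> 'r"
  assumes A: "algebra_over s R" and F: "F \<subseteq> carrier (mpoly_ring V)"
    and e: "e \<in> alg_hom Const (mpoly_ring V) s R" and eF: "\<And>f. f \<in> F \<Longrightarrow> e f = \<zero>\<^bsub>R\<^esub>"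
  shows "\<exists>u\<in>alg_hom (pres_const V F) (pres_ring V F) s R. \<forall>v\<in>V. u (pres_var V F v) = e (Var v)"
proof -
  let ?P = "mpoly_ring V :: (('v \<Rightarrow>\<^sub>0 nat) \<Rightarrow>\<^sub>0 'k::comm_ring_1) ring"
  let ?I = "genideal ?P F"
  interpret P: cring ?P by (rule mpoly_cring)
  interpret R: cring R using algebra_overD[OF A] by simp
  have "ring_hom_ring ?P R e"
    using alg_homD(1)[OF e] by (intro ring_hom_ringI2) (auto intro: P.ring_axioms R.ring_axioms)
  then have "ideal (a_kernel ?P R e) ?P" by (rule ring_hom_ring.kernel_is_ideal)
  then have I: "?I \<subseteq> a_kernel ?P R e"
    using F eF by (intro P.genideal_minimal) (auto simp: a_kernel_def')
  have "\<exists>u\<in>alg_hom (pres_const V F) (pres_ring V F) s R. \<forall>p\<in>carrier ?P. u (?I +>\<^bsub>?P\<^esub> p) = e p"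
  proof (rule hom_factor[OF mpoly_cring _ algebra_overD(1)[OF A] pres_algebra(2)[OF F] _ e mpoly_Const])
    show "cring (pres_ring V F)" using algebra_overD(1)[OF pres_algebra(1)[OF F]] .
    show "(+>\<^bsub>?P\<^esub>) ?I ` carrier ?P = carrier (pres_ring V F)"
      by (auto simp: pres_ring_def quot_carrier)
    show "e p = \<zero>\<^bsub>R\<^esub>" if "p \<in> carrier ?P" "?I +>\<^bsub>?P\<^esub> p = \<zero>\<^bsub>pres_ring V F\<^esub>" for p
      using that quot_eq_zero_iff[OF pres_ideal[OF F], of p] I
      by (auto simp: pres_ring_def a_kernel_def')
  qed
  then obtain u where "u \<in> alg_hom (pres_const V F) (pres_ring V F) s R"
    "\<And>p. p \<in> carrier ?P \<Longrightarrow> u (?I +>\<^bsub>?P\<^esub> p) = e p" by blast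
  then show ?thesis by (intro bexI[of _ u]) (simp_all add: pres_var_def mpoly_Var)
qed

lemma pres_relations:
  assumes F: "F \<subseteq> carrier (mpoly_ring V)" and A: "algebra_over s R"
    and u: "u \<in> alg_hom (pres_const V F) (pres_ring V F) s R"
  shows "\<exists>e\<in>alg_hom Const (mpoly_ring V) s R.
     (\<forall>v. e (Var v) = u (pres_var V F v)) \<and> (\<forall>f\<in>F. e f = \<zero>\<^bsub>R\<^esub>)"
proof (rule bexI[of _ "\<lambda>p. u (genideal (mpoly_ring V) F +>\<^bsub>mpoly_ring V\<^esub> p)"])
  show "(\<lambda>p. u (genideal (mpoly_ring V) F +>\<^bsub>mpoly_ring V\<^esub> p)) \<in> alg_hom Const (mpoly_ring V) s R"
    using alg_hom_comp[OF pres_algebra(2)[OF F] u] .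
  have "u (genideal (mpoly_ring V) F +>\<^bsub>mpoly_ring V\<^esub> f) = \<zero>\<^bsub>R\<^esub>" if "f \<in> F" for f
  proof -
    have "f \<in> genideal (mpoly_ring V) F" "f \<in> carrier (mpoly_ring V)"
      using that F by (auto simp: genideal_def)
    then have "genideal (mpoly_ring V) F +>\<^bsub>mpoly_ring V\<^esub> f = \<zero>\<^bsub>pres_ring V F\<^esub>"
      using quot_eq_zero_iff[OF pres_ideal[OF F]] by (simp add: pres_ring_def)
    then show ?thesis
      using alg_hom_zero[OF u] algebra_overD(1)[OF A] algebra_overD(1)[OF pres_algebra(1)[OF F]] by simp
  qed
  then show "(\<forall>v. u (genideal (mpoly_ring V) F +>\<^bsub>mpoly_ring V\<^esub> Var v) = u (pres_var V F v)) \<and>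
     (\<forall>f\<in>F. u (genideal (mpoly_ring V) F +>\<^bsub>mpoly_ring V\<^esub> f) = \<zero>\<^bsub>R\<^esub>)"
    by (simp add: pres_var_def)
qed

lemma pres_hom_unique:
  assumes F: "F \<subseteq> carrier (mpoly_ring V)"
    and u: "u \<in> alg_hom (pres_const V F) (pres_ring V F) s R"
    and u': "u' \<in> alg_hom (pres_const V F) (pres_ring V F) s R"
    and eq: "\<And>v. v \<in> V \<Longrightarrow> u (pres_var V F v) = u' (pres_var V F v)"
    and b: "b \<in> carrier (pres_ring V F)"
  shows "u b = u' b"
proof -
  obtain p where p: "p \<in> carrier (mpoly_ring V)" "b = genideal (mpoly_ring V) F +>\<^bsub>mpoly_ring V\<^esub> p"
    using b by (auto simp: pres_ring_def quot_carrier)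
  show ?thesis
    unfolding p(2)
    by (rule mpoly_hom_unique[OF alg_hom_comp[OF pres_algebra(2)[OF F] u] alg_hom_comp[OF pres_algebra(2)[OF F] u'] _ p(1)])
      (use eq in \<open>simp add: pres_var_def\<close>)
qed


section \<open>Formal smoothness does not depend on the type of the test algebras\<close>

text \<open>
  Any \<open>B\<close> of finite type is a quotient \<open>P/I\<close> of \<open>P = 'k[x\<^sub>0, x\<^sub>1, \<dots>]\<close>.  Lifting along
  \<open>P/I\<^sup>2 \<rightarrow> P/I\<close>, whose carrier lies in the type used in \<^const>\<open>smooth_algebra\<close>, yields lifting
  along all quotients by ideals of square zero.
\<close>

theorem smooth_imp_formally_smooth:
  fixes t :: "'k::field \<Rightarrow> 'b" and B :: "'b ring"
  assumes "smooth_algebra t B"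
  shows "formally_smooth TYPE('r) t B"
proof -
  let ?P = "mpoly_ring (UNIV :: nat set) :: ((nat \<Rightarrow>\<^sub>0 nat) \<Rightarrow>\<^sub>0 'k) ring"
  have fs: "formally_smooth TYPE(((nat \<Rightarrow>\<^sub>0 nat) \<Rightarrow>\<^sub>0 'k) set) t B" and tB: "algebra_over t B"
    using assms by (auto simp: smooth_algebra_def finite_type_algebra_def)
  obtain S where S: "finite S" "S \<subseteq> carrier B" "generate_ring B (range t \<union> S) = carrier B"
    using assms by (auto simp: smooth_algebra_def finite_type_algebra_def)
  have B: "cring B" using algebra_overD[OF tB] by simp
  have P: "cring ?P" by (rule mpoly_cring)
  interpret B: cring B by fact
  interpret P: cring ?P by fact
  obtain xs where xs: "set xs = S" using finite_list[OF S(1)] by blast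
  define x where "x i = (if i < length xs then xs ! i else \<zero>\<^bsub>B\<^esub>)" for i
  have "x i \<in> carrier B" for i using S(2) xs by (auto simp: x_def)
  then obtain e where e: "e \<in> alg_hom Const ?P t B" "\<And>v. e (Var v) = x v"
    using mpoly_eval[OF tB, of UNIV x] by auto
  have "z \<in> e ` carrier ?P" if "z \<in> generate_ring B (range t \<union> S)" for z
    using that
  proof (induction rule: generate_ring.induct)
    case one
    then show ?case using alg_homD(6)[OF e(1)] by (metis P.one_closed image_eqI)
  next
    case (incl h)
    then consider a where "h = t a" | i where "h = x i"
      using xs by (auto simp: x_def in_set_conv_nth) (metis)
    then show ?case
    proof cases
      case 1
      then show ?thesis using alg_homD(2)[OF e(1)] mpoly_Const[of _ UNIV] by (metis image_eqI)
    next
      case 2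
      then show ?thesis using e(2) mpoly_Var[of _ UNIV] by (metis UNIV_I image_eqI)
    qed
  next
    case (a_inv h)
    then obtain p where "p \<in> carrier ?P" "h = e p" by blast
    then show ?case using alg_hom_a_inv[OF e(1) P B] by (metis P.a_inv_closed image_eqI)
  next
    case (eng_add h1 h2)
    then obtain p q where "p \<in> carrier ?P" "h1 = e p" "q \<in> carrier ?P" "h2 = e q" by blast
    then show ?case using alg_homD(4)[OF e(1)] by (metis P.add.m_closed image_eqI)
  next
    case (eng_mult h1 h2)
    then obtain p q where "p \<in> carrier ?P" "h1 = e p" "q \<in> carrier ?P" "h2 = e q" by blast
    then show ?case using alg_homD(5)[OF e(1)] by (metis P.m_closed image_eqI)
  qed
  then have esurj: "e ` carrier ?P = carrier B" using S(3) alg_homD(3)[OF e(1)] by auto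
  define I where "I = a_kernel ?P B e"
  have memI: "p \<in> I \<longleftrightarrow> p \<in> carrier ?P \<and> e p = \<zero>\<^bsub>B\<^esub>" for p by (simp add: I_def a_kernel_def')
  have "ring_hom_ring ?P B e"
    using alg_homD(1)[OF e(1)] by (intro ring_hom_ringI2) (auto intro: P.ring_axioms B.ring_axioms)
  then have I: "ideal I ?P" unfolding I_def by (rule ring_hom_ring.kernel_is_ideal)
  define K where "K = ideal_prod ?P I I"
  have K: "ideal K ?P" unfolding K_def by (rule P.ideal_prod_is_ideal[OF I I])
  have KI: "K \<subseteq> I" unfolding K_def using P.ideal_prod_inter[OF I I] by simp
  define R0 where "R0 = ?P Quot K"
  define q where "q p = K +>\<^bsub>?P\<^esub> p" for p
  have q: "q \<in> alg_hom Const ?P (\<lambda>a. q (Const a)) R0" and R0: "algebra_over (\<lambda>a. q (Const a)) R0"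
    using algebra_over_quot[OF mpoly_algebra K] by (simp_all add: q_def[abs_def] R0_def)
  have R0c: "cring R0" using algebra_overD[OF R0] by simp
  have qsurj: "q ` carrier ?P = carrier R0" by (auto simp: q_def R0_def quot_carrier)
  define J0 where "J0 = q ` I"
  have J0: "ideal J0 R0"
    using P.ring_ideal_imp_quot_ideal[OF K I] by (simp add: J0_def q_def[abs_def] R0_def)
  have sq0: "\<forall>x\<in>J0. \<forall>y\<in>J0. x \<otimes>\<^bsub>R0\<^esub> y = \<zero>\<^bsub>R0\<^esub>"
  proof (intro ballI)
    fix x y assume "x \<in> J0" "y \<in> J0"
    then obtain a b where ab: "a \<in> I" "b \<in> I" "x = q a" "y = q b" by (auto simp: J0_def)
    then have "a \<otimes>\<^bsub>?P\<^esub> b \<in> K" unfolding K_def by (intro ideal_prod.prod)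
    then have "q (a \<otimes>\<^bsub>?P\<^esub> b) = \<zero>\<^bsub>R0\<^esub>"
      using quot_eq_zero_iff[OF K] ideal.Icarr[OF K] by (simp add: q_def R0_def)
    then show "x \<otimes>\<^bsub>R0\<^esub> y = \<zero>\<^bsub>R0\<^esub>" using ab alg_homD(5)[OF q, of a b] memI by simp
  qed
  define q0 where "q0 x = J0 +>\<^bsub>R0\<^esub> x" for x
  have q0: "q0 \<in> alg_hom (\<lambda>a. q (Const a)) R0 (\<lambda>a. q0 (q (Const a))) (R0 Quot J0)"
    and RJ0: "algebra_over (\<lambda>a. q0 (q (Const a))) (R0 Quot J0)"
    using algebra_over_quot[OF R0 J0] by (simp_all add: q0_def[abs_def])
  have qq: "(\<lambda>p. q0 (q p)) \<in> alg_hom Const ?P (\<lambda>a. q0 (q (Const a))) (R0 Quot J0)"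
    using alg_hom_comp[OF q q0] .
  obtain g0 where g0: "g0 \<in> alg_hom t B (\<lambda>a. q0 (q (Const a))) (R0 Quot J0)"
    "\<And>p. p \<in> carrier ?P \<Longrightarrow> g0 (e p) = q0 (q p)"
  proof -
    have "q0 (q p) = \<zero>\<^bsub>R0 Quot J0\<^esub>" if "p \<in> carrier ?P" "e p = \<zero>\<^bsub>B\<^esub>" for p
      using that quot_eq_zero_iff[OF J0] alg_homD(3)[OF q] memI by (auto simp: q0_def J0_def)
    then show ?thesis
      using hom_factor[OF P B algebra_overD(1)[OF RJ0] e(1) esurj qq mpoly_Const] that by blast
  qed
  obtain h0 where h0: "h0 \<in> alg_hom t B (\<lambda>a. q (Const a)) R0" "\<And>b. b \<in> carrier B \<Longrightarrow> q0 (h0 b) = g0 b"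
    using fs[unfolded formally_smooth_def, rule_format, OF R0 J0 _ g0(1)[unfolded q0_def]] sq0
    unfolding q0_def by blast
  show ?thesis
    unfolding formally_smooth_def
  proof (intro allI impI ballI)
    fix R :: "'r ring" and s J g
    assume R: "algebra_over s R" and J: "ideal J R"
      and sq: "\<forall>x\<in>J. \<forall>y\<in>J. x \<otimes>\<^bsub>R\<^esub> y = \<zero>\<^bsub>R\<^esub>"
      and g: "g \<in> alg_hom t B (\<lambda>a. J +>\<^bsub>R\<^esub> s a) (R Quot J)"
    have Rc: "cring R" using algebra_overD[OF R] by simp
    interpret R: cring R by fact
    note RJ = algebra_over_quot[OF R J]
    have "\<exists>r\<in>carrier R. J +>\<^bsub>R\<^esub> r = g (x v)" for v
    proof -
      have "g (x v) \<in> carrier (R Quot J)"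
        using \<open>\<And>i. x i \<in> carrier B\<close> alg_homD(3)[OF g] by blast
      then show ?thesis unfolding quot_carrier by metis
    qed
    then obtain y where y: "\<And>v. y v \<in> carrier R" "\<And>v. J +>\<^bsub>R\<^esub> y v = g (x v)" by metis
    obtain f where f: "f \<in> alg_hom Const ?P s R" "\<And>v. f (Var v) = y v"
      using mpoly_eval[OF R, of UNIV y] y by auto
    have fg: "J +>\<^bsub>R\<^esub> f p = g (e p)" if "p \<in> carrier ?P" for p
      by (rule mpoly_hom_unique[OF alg_hom_comp[OF f(1) RJ(2)] alg_hom_comp[OF e(1) g] _ that])
        (simp add: f e y)
    have fI: "f p \<in> J" if "p \<in> I" for p
      using that fg[of p] memI alg_hom_zero[OF g B algebra_overD(1)[OF RJ(1)]]
        quot_eq_zero_iff[OF J] alg_homD(3)[OF f(1)] by auto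
    have fK: "f p = \<zero>\<^bsub>R\<^esub>" if "p \<in> K" for p
      using that unfolding K_def
    proof (induction rule: ideal_prod.induct)
      case (prod i j)
      then show ?case using alg_homD(5)[OF f(1), of i j] fI sq memI by auto
    next
      case (sum s1 s2)
      then have "s1 \<in> carrier ?P" "s2 \<in> carrier ?P" using ideal.Icarr[OF K] by (auto simp: K_def)
      then show ?case using alg_homD(4)[OF f(1), of s1 s2] sum by simp
    qed
    have "f p = \<zero>\<^bsub>R\<^esub>" if "p \<in> carrier ?P" "q p = \<zero>\<^bsub>R0\<^esub>" for p
      using that quot_eq_zero_iff[OF K] by (intro fK) (simp add: q_def R0_def)
    then obtain f0 where f0: "f0 \<in> alg_hom (\<lambda>a. q (Const a)) R0 s R" "\<And>p. p \<in> carrier ?P \<Longrightarrow> f0 (q p) = f p"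
      using hom_factor[OF P R0c Rc q qsurj f(1) mpoly_Const] by blast
    show "\<exists>h\<in>alg_hom t B s R. \<forall>b\<in>carrier B. J +>\<^bsub>R\<^esub> h b = g b"
    proof (intro bexI[of _ "\<lambda>b. f0 (h0 b)"] ballI)
      show "(\<lambda>b. f0 (h0 b)) \<in> alg_hom t B s R" using alg_hom_comp[OF h0(1) f0(1)] .
      fix b assume b: "b \<in> carrier B"
      obtain p where p: "p \<in> carrier ?P" "b = e p" using b esurj by blast
      have "h0 b \<in> carrier R0" using alg_homD(3)[OF h0(1)] b by simp
      then obtain p' where p': "p' \<in> carrier ?P" "h0 b = q p'" using qsurj by auto
      have "q0 (q p') = q0 (q p)" using h0(2)[OF b] g0(2)[OF p(1)] p p' by simp
      then have "q p' \<ominus>\<^bsub>R0\<^esub> q p \<in> J0"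
        using quot_eq_iff[OF J0] alg_homD(3)[OF q] p p' by (simp add: q0_def)
      then have "q (p' \<ominus>\<^bsub>?P\<^esub> p) \<in> J0"
        using alg_homD(4)[OF q, of p' "\<ominus>\<^bsub>?P\<^esub> p"] alg_hom_a_inv[OF q P R0c p(1)] p p'
        by (simp add: a_minus_def)
      then obtain i where i: "i \<in> I" "q (p' \<ominus>\<^bsub>?P\<^esub> p) = q i" by (auto simp: J0_def)
      then have "(p' \<ominus>\<^bsub>?P\<^esub> p) \<ominus>\<^bsub>?P\<^esub> i \<in> I"
        using quot_eq_iff[OF K, of "p' \<ominus>\<^bsub>?P\<^esub> p" i] p p' memI KI by (auto simp: q_def)
      then have "((p' \<ominus>\<^bsub>?P\<^esub> p) \<ominus>\<^bsub>?P\<^esub> i) \<oplus>\<^bsub>?P\<^esub> i \<in> I"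
        using i additive_subgroup.a_closed[OF ideal.axioms(1)[OF I]] by blast
      moreover have "((p' \<ominus>\<^bsub>?P\<^esub> p) \<ominus>\<^bsub>?P\<^esub> i) \<oplus>\<^bsub>?P\<^esub> i = p' \<ominus>\<^bsub>?P\<^esub> p"
        using p p' i memI by (simp add: mpoly_a_minus mpoly_minus del: P.minus_closed)
      ultimately have "e (p' \<ominus>\<^bsub>?P\<^esub> p) = \<zero>\<^bsub>B\<^esub>" by (simp add: memI)
      then have "e p' \<oplus>\<^bsub>B\<^esub> \<ominus>\<^bsub>B\<^esub> e p = \<zero>\<^bsub>B\<^esub>"
        using alg_homD(4)[OF e(1), of p' "\<ominus>\<^bsub>?P\<^esub> p"] alg_hom_a_inv[OF e(1) P B p(1)] p p'
        by (simp add: a_minus_def)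
      then have "e p' = b"
        using p p' alg_homD(3)[OF e(1)]
        by (metis B.a_inv_closed B.minus_equality B.minus_minus)
      then show "J +>\<^bsub>R\<^esub> f0 (h0 b) = g b" using p' f0(2) fg by simp
    qed
  qed
qed


section \<open>Points of the coordinate rings\<close>

definition is_point :: "nat \<Rightarrow> 'r ring \<Rightarrow> (coord \<Rightarrow> 'r) \<Rightarrow> bool" where
  "is_point n R c \<longleftrightarrow>
     (\<forall>i<n. \<forall>j<n. \<forall>l<n. c (Str i j l) \<in> carrier R) \<and> (\<forall>i<n. c (Unt i) \<in> carrier R) \<and>
     (\<forall>i<n. \<forall>j<n. \<forall>l<n. c (Str i j l) = c (Str j i l)) \<and>
     (\<forall>i<n. \<forall>j<n. \<forall>l<n. \<forall>m<n.
        finsum R (\<lambda>r. c (Str i j r) \<otimes>\<^bsub>R\<^esub> c (Str r l m)) {..<n} =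
        finsum R (\<lambda>r. c (Str j l r) \<otimes>\<^bsub>R\<^esub> c (Str i r m)) {..<n}) \<and>
     (\<forall>i<n. \<forall>m<n. finsum R (\<lambda>r. c (Unt r) \<otimes>\<^bsub>R\<^esub> c (Str r i m)) {..<n} =
        (if i = m then \<one>\<^bsub>R\<^esub> else \<zero>\<^bsub>R\<^esub>))"

lemma coords_iff [simp]: "Str i j l \<in> coords n \<longleftrightarrow> i < n \<and> j < n \<and> l < n" "Unt i \<in> coords n \<longleftrightarrow> i < n"
  by (auto simp: coords_def)

lemma relations_carrier: "relations n \<subseteq> carrier (mpoly_ring (coords n))"
  unfolding relations_def
  by (auto intro!: mpoly_minus mpoly_sum mpoly_mult mpoly_Var mpoly_01)

lemma relations1_carrier: "relations1 n \<subseteq> carrier (mpoly_ring (coords n))"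
  unfolding relations1_def using relations_carrier
  by (auto intro!: mpoly_minus mpoly_Var mpoly_01)

lemma mpoly_hom_sum:
  assumes e: "e \<in> alg_hom Const (mpoly_ring V) s R" and R: "cring R" and fin: "finite I"
    and f: "\<And>i. i \<in> I \<Longrightarrow> f i \<in> carrier (mpoly_ring V)"
  shows "e (sum f I) = finsum R (\<lambda>i. e (f i)) I"
proof -
  interpret R: cring R by fact
  show ?thesis using fin f
  proof (induction I rule: finite_induct)
    case empty
    then show ?case using alg_hom_zero[OF e mpoly_cring R] by simp
  next
    case (insert i I)
    then show ?case using alg_homD(4)[OF e, of "f i" "sum f I"] alg_homD(3)[OF e]
      by (simp add: R.finsum_insert mpoly_sum)
  qed
qed

lemma mpoly_hom_minus_zero:
  assumes e: "e \<in> alg_hom Const (mpoly_ring V) s R" and R: "cring R"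
    and p: "p \<in> carrier (mpoly_ring V)" "q \<in> carrier (mpoly_ring V)"
  shows "e (p - q) = \<zero>\<^bsub>R\<^esub> \<longleftrightarrow> e p = e q"
proof -
  interpret R: cring R by fact
  have "e p = e (p - q) \<oplus>\<^bsub>R\<^esub> e q"
    using alg_homD(4)[OF e mpoly_minus[OF p] p(2)] by simp
  then show ?thesis using alg_homD(3)[OF e] p mpoly_minus[OF p]
    by (metis R.add.l_cancel_one' R.add.m_comm R.l_zero)
qed

lemma ball_setcompr:
  "(\<forall>x\<in>{f1 i | i. i < n}. Q x) \<longleftrightarrow> (\<forall>i<n. Q (f1 i))"
  "(\<forall>x\<in>{f2 i j | i j. i < n \<and> j < n}. Q x) \<longleftrightarrow> (\<forall>i<n. \<forall>j<n. Q (f2 i j))"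
  "(\<forall>x\<in>{f3 i j l | i j l. i < n \<and> j < n \<and> l < n}. Q x) \<longleftrightarrow> (\<forall>i<n. \<forall>j<n. \<forall>l<n. Q (f3 i j l))"
  "(\<forall>x\<in>{f4 i j l m | i j l m. i < n \<and> j < n \<and> l < n \<and> m < n}. Q x) \<longleftrightarrow>
     (\<forall>i<n. \<forall>j<n. \<forall>l<n. \<forall>m<(n::nat). Q (f4 i j l m))"
  by blast+

lemma mpoly_hom_relations:
  assumes e: "e \<in> alg_hom Const (mpoly_ring (coords n)) s R" and R: "cring R"
  shows "(\<forall>f\<in>relations n. e f = \<zero>\<^bsub>R\<^esub>) \<longleftrightarrow> is_point n R (\<lambda>v. e (Var v))"
    "(\<forall>f\<in>relations1 n. e f = \<zero>\<^bsub>R\<^esub>) \<longleftrightarrow> is_point n R (\<lambda>v. e (Var v)) \<and>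
       (\<forall>i<n. e (Var (Unt i)) = (if i = 0 then \<one>\<^bsub>R\<^esub> else \<zero>\<^bsub>R\<^esub>))"
proof -
  have V: "v \<in> coords n \<Longrightarrow> e (Var v) \<in> carrier R" for v
    by (rule alg_homD(3)[OF e mpoly_Var])
  have z: "e 0 = \<zero>\<^bsub>R\<^esub>" using alg_hom_zero[OF e mpoly_cring R] by simp
  have e1: "e 1 = \<one>\<^bsub>R\<^esub>" using alg_homD(6)[OF e] by simp
  have S: "e (\<Sum>r<n. Var (v r) * Var (w r)) = finsum R (\<lambda>r. e (Var (v r)) \<otimes>\<^bsub>R\<^esub> e (Var (w r))) {..<n}"
    if "\<And>r. r < n \<Longrightarrow> v r \<in> coords n" "\<And>r. r < n \<Longrightarrow> w r \<in> coords n" for v w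
  proof -
    interpret R: cring R by fact
    have "e (\<Sum>r<n. Var (v r) * Var (w r)) = finsum R (\<lambda>r. e (Var (v r) * Var (w r))) {..<n}"
      using that by (intro mpoly_hom_sum[OF e R]) (auto intro!: mpoly_mult mpoly_Var)
    also have "\<dots> = finsum R (\<lambda>r. e (Var (v r)) \<otimes>\<^bsub>R\<^esub> e (Var (w r))) {..<n}"
    proof (rule R.finsum_cong')
      show "(\<lambda>r. e (Var (v r)) \<otimes>\<^bsub>R\<^esub> e (Var (w r))) \<in> {..<n} \<rightarrow> carrier R"
        using that V by auto
      fix r assume "r \<in> {..<n}"
      then show "e (Var (v r) * Var (w r)) = e (Var (v r)) \<otimes>\<^bsub>R\<^esub> e (Var (w r))"
        using alg_homD(5)[OF e mpoly_Var mpoly_Var] that by simp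
    qed simp
    finally show ?thesis .
  qed
  show 1: "(\<forall>f\<in>relations n. e f = \<zero>\<^bsub>R\<^esub>) \<longleftrightarrow> is_point n R (\<lambda>v. e (Var v))"
  proof -
    have "(\<forall>f\<in>relations n. e f = \<zero>\<^bsub>R\<^esub>) \<longleftrightarrow>
      (\<forall>i<n. \<forall>j<n. \<forall>l<n. e (Var (Str i j l) - Var (Str j i l)) = \<zero>\<^bsub>R\<^esub>) \<and>
      (\<forall>i<n. \<forall>j<n. \<forall>l<n. \<forall>m<n. e ((\<Sum>r<n. Var (Str i j r) * Var (Str r l m)) -
          (\<Sum>r<n. Var (Str j l r) * Var (Str i r m))) = \<zero>\<^bsub>R\<^esub>) \<and>
      (\<forall>i<n. \<forall>m<n. e ((\<Sum>r<n. Var (Unt r) * Var (Str r i m)) - (if i = m then 1 else 0)) = \<zero>\<^bsub>R\<^esub>)"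
      unfolding relations_def ball_Un ball_setcompr by (rule conj_assoc)
    also have "\<dots> \<longleftrightarrow> is_point n R (\<lambda>v. e (Var v))"
    proof -
      have "e (Var (Str i j l) - Var (Str j i l)) = \<zero>\<^bsub>R\<^esub> \<longleftrightarrow> e (Var (Str i j l)) = e (Var (Str j i l))"
        if "i < n" "j < n" "l < n" for i j l
        using that by (intro mpoly_hom_minus_zero[OF e R] mpoly_Var) auto
      moreover have "e ((\<Sum>r<n. Var (Str i j r) * Var (Str r l m)) - (\<Sum>r<n. Var (Str j l r) * Var (Str i r m))) = \<zero>\<^bsub>R\<^esub>
          \<longleftrightarrow> finsum R (\<lambda>r. e (Var (Str i j r)) \<otimes>\<^bsub>R\<^esub> e (Var (Str r l m))) {..<n} =
             finsum R (\<lambda>r. e (Var (Str j l r)) \<otimes>\<^bsub>R\<^esub> e (Var (Str i r m))) {..<n}"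
        if "i < n" "j < n" "l < n" "m < n" for i j l m
        using that
        by (subst mpoly_hom_minus_zero[OF e R])
          (auto intro!: mpoly_sum mpoly_mult mpoly_Var simp: S)
      moreover have "e ((\<Sum>r<n. Var (Unt r) * Var (Str r i m)) - (if i = m then 1 else 0)) = \<zero>\<^bsub>R\<^esub>
          \<longleftrightarrow> finsum R (\<lambda>r. e (Var (Unt r)) \<otimes>\<^bsub>R\<^esub> e (Var (Str r i m))) {..<n} =
             (if i = m then \<one>\<^bsub>R\<^esub> else \<zero>\<^bsub>R\<^esub>)" if "i < n" "m < n" for i m
        using that
        by (subst mpoly_hom_minus_zero[OF e R])
          (auto intro!: mpoly_sum mpoly_mult mpoly_Var mpoly_01 simp: S z e1)
      ultimately show ?thesis
        unfolding is_point_def by (simp add: V del: mult_eq_0_iff cong: conj_cong)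
    qed
    finally show ?thesis .
  qed
  have "(\<forall>f\<in>relations1 n. e f = \<zero>\<^bsub>R\<^esub>) \<longleftrightarrow> (\<forall>f\<in>relations n. e f = \<zero>\<^bsub>R\<^esub>) \<and>
      (\<forall>i<n. e (Var (Unt i) - (if i = 0 then 1 else 0)) = \<zero>\<^bsub>R\<^esub>)"
    unfolding relations1_def ball_Un ball_setcompr ..
  also have "\<dots> \<longleftrightarrow> is_point n R (\<lambda>v. e (Var v)) \<and>
       (\<forall>i<n. e (Var (Unt i)) = (if i = 0 then \<one>\<^bsub>R\<^esub> else \<zero>\<^bsub>R\<^esub>))"
  proof -
    have "e (Var (Unt i) - (if i = 0 then 1 else 0)) = \<zero>\<^bsub>R\<^esub> \<longleftrightarrow>
        e (Var (Unt i)) = (if i = 0 then \<one>\<^bsub>R\<^esub> else \<zero>\<^bsub>R\<^esub>)" if "i < n" for i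
      using that by (subst mpoly_hom_minus_zero[OF e R]) (auto intro!: mpoly_Var mpoly_01 simp: z e1)
    then show ?thesis unfolding 1 by simp
  qed
  finally show "(\<forall>f\<in>relations1 n. e f = \<zero>\<^bsub>R\<^esub>) \<longleftrightarrow> is_point n R (\<lambda>v. e (Var v)) \<and>
       (\<forall>i<n. e (Var (Unt i)) = (if i = 0 then \<one>\<^bsub>R\<^esub> else \<zero>\<^bsub>R\<^esub>))" .
qed

lemma is_point_cong:
  assumes "\<And>v. v \<in> coords n \<Longrightarrow> c v = c' v" "cring R" and c: "is_point n R c"
  shows "is_point n R c'"
proof -
  interpret cring R by fact
  have S: "i < n \<Longrightarrow> j < n \<Longrightarrow> l < n \<Longrightarrow> c' (Str i j l) = c (Str i j l)"
    and U: "i < n \<Longrightarrow> c' (Unt i) = c (Unt i)" for i j l using assms(1) by simp_all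
  have "finsum R (\<lambda>r. c' (Str i j r) \<otimes>\<^bsub>R\<^esub> c' (Str r l m)) {..<n} =
        finsum R (\<lambda>r. c (Str i j r) \<otimes>\<^bsub>R\<^esub> c (Str r l m)) {..<n}"
       "finsum R (\<lambda>r. c' (Str j l r) \<otimes>\<^bsub>R\<^esub> c' (Str i r m)) {..<n} =
        finsum R (\<lambda>r. c (Str j l r) \<otimes>\<^bsub>R\<^esub> c (Str i r m)) {..<n}"
       "finsum R (\<lambda>r. c' (Unt r) \<otimes>\<^bsub>R\<^esub> c' (Str r i m)) {..<n} =
        finsum R (\<lambda>r. c (Unt r) \<otimes>\<^bsub>R\<^esub> c (Str r i m)) {..<n}"
    if "i < n" "j < n" "l < n" "m < n" for i j l m
    using that c by (intro finsum_cong'; simp add: S U is_point_def)+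
  then show ?thesis using c unfolding is_point_def by (simp add: S U)
qed

lemma based_coord_ring_hom_iff:
  fixes s :: "'k::comm_ring_1 \<Rightarrow> 'r"
  assumes R: "algebra_over s R"
  shows "(\<exists>u\<in>alg_hom (based_const n) (based_coord_ring n) s R. \<forall>v\<in>coords n. u (based_var n v) = c v)
    \<longleftrightarrow> is_point n R c"
    "(\<exists>u\<in>alg_hom (based1_const n) (based1_coord_ring n) s R. \<forall>v\<in>coords n. u (based1_var n v) = c v)
    \<longleftrightarrow> is_point n R c \<and> (\<forall>i<n. c (Unt i) = (if i = 0 then \<one>\<^bsub>R\<^esub> else \<zero>\<^bsub>R\<^esub>))"
proof -
  note Rc = algebra_overD(1)[OF R]
  have A: "(\<exists>u\<in>alg_hom (pres_const (coords n) F) (pres_ring (coords n) F) s R.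
       \<forall>v\<in>coords n. u (pres_var (coords n) F v) = c v) \<longleftrightarrow>
     (\<exists>e\<in>alg_hom Const (mpoly_ring (coords n)) s R. (\<forall>v\<in>coords n. e (Var v) = c v) \<and> (\<forall>f\<in>F. e f = \<zero>\<^bsub>R\<^esub>))"
    (is "?l \<longleftrightarrow> ?r") if F: "F \<subseteq> carrier (mpoly_ring (coords n))" for F
  proof
    assume ?l
    then obtain u where u: "u \<in> alg_hom (pres_const (coords n) F) (pres_ring (coords n) F) s R"
      "\<forall>v\<in>coords n. u (pres_var (coords n) F v) = c v" by blast
    obtain e where "e \<in> alg_hom Const (mpoly_ring (coords n)) s R"
      "\<forall>v. e (Var v) = u (pres_var (coords n) F v)" "\<forall>f\<in>F. e f = \<zero>\<^bsub>R\<^esub>"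
      using pres_relations[OF F R u(1)] by blast
    with u(2) show ?r by (intro bexI[of _ e]) simp_all
  next
    assume ?r
    then obtain e where e: "e \<in> alg_hom Const (mpoly_ring (coords n)) s R"
      "\<forall>v\<in>coords n. e (Var v) = c v" "\<forall>f\<in>F. e f = \<zero>\<^bsub>R\<^esub>" by blast
    obtain u where "u \<in> alg_hom (pres_const (coords n) F) (pres_ring (coords n) F) s R"
      "\<forall>v\<in>coords n. u (pres_var (coords n) F v) = e (Var v)"
      using pres_eval[OF R F e(1)] e(3) by blast
    with e(2) show ?l by (intro bexI[of _ u]) simp_all
  qed
  have ex: "\<exists>e\<in>alg_hom Const (mpoly_ring (coords n)) s R. \<forall>v\<in>coords n. e (Var v) = c v" if "is_point n R c"
    using that by (intro mpoly_eval[OF R]) (auto simp: is_point_def coords_def)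
  have pc: "is_point n R (\<lambda>v. e (Var v)) \<longleftrightarrow> is_point n R c" if "\<forall>v\<in>coords n. e (Var v) = c v" for e
    using is_point_cong[OF _ Rc, of n "\<lambda>v. e (Var v)" c] is_point_cong[OF _ Rc, of n c "\<lambda>v. e (Var v)"] that
    by metis
  have B: "(\<exists>e\<in>alg_hom Const (mpoly_ring (coords n)) s R. (\<forall>v\<in>coords n. e (Var v) = c v) \<and> G e) \<longleftrightarrow> D"
    if "\<And>e. e \<in> alg_hom Const (mpoly_ring (coords n)) s R \<Longrightarrow> \<forall>v\<in>coords n. e (Var v) = c v \<Longrightarrow> G e \<longleftrightarrow> D"
      "D \<Longrightarrow> is_point n R c" for G D
    using that ex by blast
  show "(\<exists>u\<in>alg_hom (based_const n) (based_coord_ring n) s R. \<forall>v\<in>coords n. u (based_var n v) = c v)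
    \<longleftrightarrow> is_point n R c"
    unfolding based_const_def based_coord_ring_def based_var_def A[OF relations_carrier]
    by (rule B) (simp_all add: mpoly_hom_relations(1)[OF _ Rc] pc)
  show "(\<exists>u\<in>alg_hom (based1_const n) (based1_coord_ring n) s R. \<forall>v\<in>coords n. u (based1_var n v) = c v)
    \<longleftrightarrow> is_point n R c \<and> (\<forall>i<n. c (Unt i) = (if i = 0 then \<one>\<^bsub>R\<^esub> else \<zero>\<^bsub>R\<^esub>))"
    unfolding based1_const_def based1_coord_ring_def based1_var_def A[OF relations1_carrier]
    by (rule B) (simp_all add: mpoly_hom_relations(2)[OF _ Rc] pc)
qed


section \<open>Coordinates of based algebras\<close>

locale based_alg = R: cring R + A: cring A for R :: "'r ring" and A :: "'a ring" +
  fixes n :: nat and \<sigma> :: "'r \<Rightarrow> 'a" and \<phi> :: "'a \<Rightarrow> nat \<Rightarrow> 'r"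
  assumes based: "based_algebra n R A \<sigma> \<phi>"
begin

abbreviation "bs \<equiv> basis_vec n R A \<phi>"

lemma sigma [simp]: "r \<in> carrier R \<Longrightarrow> \<sigma> r \<in> carrier A"
  using based by (auto simp: based_algebra_def ring_hom_def)

lemma phi_E: "a \<in> carrier A \<Longrightarrow> \<phi> a \<in> {..<n} \<rightarrow>\<^sub>E carrier R"
  using based by (auto simp: based_algebra_def dest: bij_betwE)

lemma phi_closed [simp]: "a \<in> carrier A \<Longrightarrow> i < n \<Longrightarrow> \<phi> a i \<in> carrier R"
  using phi_E by blast

lemma phi_add: "x \<in> carrier A \<Longrightarrow> y \<in> carrier A \<Longrightarrow> i < n \<Longrightarrow> \<phi> (x \<oplus>\<^bsub>A\<^esub> y) i = \<phi> x i \<oplus>\<^bsub>R\<^esub> \<phi> y i"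
  using based by (simp add: based_algebra_def)

lemma phi_scale: "r \<in> carrier R \<Longrightarrow> x \<in> carrier A \<Longrightarrow> i < n \<Longrightarrow> \<phi> (\<sigma> r \<otimes>\<^bsub>A\<^esub> x) i = r \<otimes>\<^bsub>R\<^esub> \<phi> x i"
  using based by (simp add: based_algebra_def)

lemma phi_eqI:
  assumes "x \<in> carrier A" "y \<in> carrier A" "\<And>i. i < n \<Longrightarrow> \<phi> x i = \<phi> y i"
  shows "x = y"
proof -
  have "\<phi> x = \<phi> y" using phi_E[OF assms(1)] phi_E[OF assms(2)] assms(3) by (intro PiE_ext) auto
  moreover have "inj_on \<phi> (carrier A)" using based by (simp add: based_algebra_def bij_betw_def)
  ultimately show ?thesis using assms by (simp add: inj_on_def)
qed

lemma phi_surj: "v \<in> {..<n} \<rightarrow>\<^sub>E carrier R \<Longrightarrow> inv_into (carrier A) \<phi> v \<in> carrier A \<and> \<phi> (inv_into (carrier A) \<phi> v) = v"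
  using based unfolding based_algebra_def bij_betw_def by (metis inv_into_into f_inv_into_f)

lemma std_basis_E: "std_basis n R i \<in> {..<n} \<rightarrow>\<^sub>E carrier R"
  by (auto simp: std_basis_def)

lemma bs_closed [simp]: "bs i \<in> carrier A"
  using phi_surj[OF std_basis_E] by (simp add: basis_vec_def)

lemma phi_bs: "j < n \<Longrightarrow> \<phi> (bs i) j = (if j = i then \<one>\<^bsub>R\<^esub> else \<zero>\<^bsub>R\<^esub>)"
  using phi_surj[OF std_basis_E, of i] by (simp add: basis_vec_def std_basis_def)

lemma phi_zero: "i < n \<Longrightarrow> \<phi> \<zero>\<^bsub>A\<^esub> i = \<zero>\<^bsub>R\<^esub>"
  using phi_add[of "\<zero>\<^bsub>A\<^esub>" "\<zero>\<^bsub>A\<^esub>" i]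
  by (metis A.l_zero A.zero_closed R.add.l_cancel_one phi_closed)

lemma phi_finsum:
  assumes "finite I" "\<And>j. j \<in> I \<Longrightarrow> f j \<in> carrier A" "i < n"
  shows "\<phi> (finsum A f I) i = finsum R (\<lambda>j. \<phi> (f j) i) I"
  using assms
proof (induction I rule: finite_induct)
  case (insert j I)
  have "\<phi> (finsum A f (insert j I)) i = \<phi> (f j \<oplus>\<^bsub>A\<^esub> finsum A f I) i"
    using insert by (subst A.finsum_insert) auto
  also have "\<dots> = \<phi> (f j) i \<oplus>\<^bsub>R\<^esub> finsum R (\<lambda>j. \<phi> (f j) i) I"
    using insert by (subst phi_add) (auto intro!: A.finsum_closed)
  also have "\<dots> = finsum R (\<lambda>j. \<phi> (f j) i) (insert j I)"
    using insert by (subst R.finsum_insert) auto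
  finally show ?case .
qed (simp add: phi_zero)

lemma expand:
  assumes x: "x \<in> carrier A"
  shows "x = finsum A (\<lambda>i. \<sigma> (\<phi> x i) \<otimes>\<^bsub>A\<^esub> bs i) {..<n}"
proof (rule phi_eqI[OF x])
  show "finsum A (\<lambda>i. \<sigma> (\<phi> x i) \<otimes>\<^bsub>A\<^esub> bs i) {..<n} \<in> carrier A"
    using x by (intro A.finsum_closed) auto
  fix j assume j: "j < n"
  have "\<phi> (finsum A (\<lambda>i. \<sigma> (\<phi> x i) \<otimes>\<^bsub>A\<^esub> bs i) {..<n}) j =
      finsum R (\<lambda>i. \<phi> (\<sigma> (\<phi> x i) \<otimes>\<^bsub>A\<^esub> bs i) j) {..<n}"
    using x j by (intro phi_finsum) auto
  also have "\<dots> = finsum R (\<lambda>i. if j = i then \<phi> x i else \<zero>\<^bsub>R\<^esub>) {..<n}"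
    using x j by (intro R.finsum_cong') (auto simp: phi_scale phi_bs)
  also have "\<dots> = \<phi> x j" using x j by (intro R.finsum_singleton) auto
  finally show "\<phi> x j = \<phi> (finsum A (\<lambda>i. \<sigma> (\<phi> x i) \<otimes>\<^bsub>A\<^esub> bs i) {..<n}) j" by simp
qed

lemma phi_mult:
  assumes x: "x \<in> carrier A" and y: "y \<in> carrier A" and l: "l < n"
  shows "\<phi> (x \<otimes>\<^bsub>A\<^esub> y) l = finsum R (\<lambda>i. \<phi> x i \<otimes>\<^bsub>R\<^esub> \<phi> (bs i \<otimes>\<^bsub>A\<^esub> y) l) {..<n}"
proof -
  have "x \<otimes>\<^bsub>A\<^esub> y = finsum A (\<lambda>i. \<sigma> (\<phi> x i) \<otimes>\<^bsub>A\<^esub> bs i) {..<n} \<otimes>\<^bsub>A\<^esub> y"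
    using expand[OF x] by simp
  also have "\<dots> = finsum A (\<lambda>i. (\<sigma> (\<phi> x i) \<otimes>\<^bsub>A\<^esub> bs i) \<otimes>\<^bsub>A\<^esub> y) {..<n}"
    using x y by (intro A.finsum_ldistr) auto
  also have "\<phi> \<dots> l = finsum R (\<lambda>i. \<phi> ((\<sigma> (\<phi> x i) \<otimes>\<^bsub>A\<^esub> bs i) \<otimes>\<^bsub>A\<^esub> y) l) {..<n}"
    using x y l by (intro phi_finsum) auto
  also have "\<dots> = finsum R (\<lambda>i. \<phi> x i \<otimes>\<^bsub>R\<^esub> \<phi> (bs i \<otimes>\<^bsub>A\<^esub> y) l) {..<n}"
    using x y l by (intro R.finsum_cong') (auto simp: A.m_assoc phi_scale)
  finally show ?thesis .
qed

lemma classifies_mult: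
  assumes c: "classifies n R A \<phi> c" and x: "x \<in> carrier A" and y: "y \<in> carrier A" and l: "l < n"
  shows "\<phi> (x \<otimes>\<^bsub>A\<^esub> y) l =
    finsum R (\<lambda>i. \<phi> x i \<otimes>\<^bsub>R\<^esub> finsum R (\<lambda>j. \<phi> y j \<otimes>\<^bsub>R\<^esub> c (Str j i l)) {..<n}) {..<n}"
  unfolding phi_mult[OF x y l]
proof (rule R.finsum_cong')
  have *: "\<phi> (bs i \<otimes>\<^bsub>A\<^esub> y) l = finsum R (\<lambda>j. \<phi> y j \<otimes>\<^bsub>R\<^esub> c (Str j i l)) {..<n}" if "i < n" for i
  proof -
    have "\<phi> (bs i \<otimes>\<^bsub>A\<^esub> y) l = \<phi> (y \<otimes>\<^bsub>A\<^esub> bs i) l" using y by (simp add: A.m_comm)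
    also have "\<dots> = finsum R (\<lambda>j. \<phi> y j \<otimes>\<^bsub>R\<^esub> \<phi> (bs j \<otimes>\<^bsub>A\<^esub> bs i) l) {..<n}"
      using y l by (intro phi_mult) auto
    also have "\<dots> = finsum R (\<lambda>j. \<phi> y j \<otimes>\<^bsub>R\<^esub> c (Str j i l)) {..<n}"
      using c y l that by (intro R.finsum_cong') (auto simp: classifies_def)
    finally show ?thesis .
  qed
  then show "\<phi> x i \<otimes>\<^bsub>R\<^esub> \<phi> (bs i \<otimes>\<^bsub>A\<^esub> y) l = \<phi> x i \<otimes>\<^bsub>R\<^esub> finsum R (\<lambda>j. \<phi> y j \<otimes>\<^bsub>R\<^esub> c (Str j i l)) {..<n}"
    if "i \<in> {..<n}" for i using that by simp
  show "(\<lambda>i. \<phi> x i \<otimes>\<^bsub>R\<^esub> finsum R (\<lambda>j. \<phi> y j \<otimes>\<^bsub>R\<^esub> c (Str j i l)) {..<n}) \<in> {..<n} \<rightarrow> carrier R"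
  proof
    fix i assume "i \<in> {..<n}"
    then show "\<phi> x i \<otimes>\<^bsub>R\<^esub> finsum R (\<lambda>j. \<phi> y j \<otimes>\<^bsub>R\<^esub> c (Str j i l)) {..<n} \<in> carrier R"
      using x y l *[of i, symmetric] by simp
  qed
qed simp

lemma classifies_sigma:
  assumes "classifies n R A \<phi> c" "r \<in> carrier R" "i < n"
  shows "\<phi> (\<sigma> r) i = r \<otimes>\<^bsub>R\<^esub> c (Unt i)"
  using phi_scale[OF assms(2) A.one_closed assms(3)] assms by (simp add: classifies_def)

lemma is_point:
  assumes c: "classifies n R A \<phi> c"
  shows "is_point n R c"
proof -
  have S: "c (Str i j l) = \<phi> (bs i \<otimes>\<^bsub>A\<^esub> bs j) l" if "i < n" "j < n" "l < n" for i j l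
    using that c by (simp add: classifies_def)
  have U: "c (Unt i) = \<phi> \<one>\<^bsub>A\<^esub> i" if "i < n" for i
    using that c by (simp add: classifies_def)
  have M: "\<phi> (x \<otimes>\<^bsub>A\<^esub> bs j) l = finsum R (\<lambda>r. \<phi> x r \<otimes>\<^bsub>R\<^esub> c (Str r j l)) {..<n}"
    if "x \<in> carrier A" "j < n" "l < n" for x j l
    unfolding phi_mult[OF that(1) bs_closed that(3)]
    using that by (intro R.finsum_cong') (auto simp: S)
  have comm: "c (Str i j l) = c (Str j i l)" if "i < n" "j < n" "l < n" for i j l
    using that by (simp add: S A.m_comm)
  have P: "finsum R (\<lambda>r. c (Str i j r) \<otimes>\<^bsub>R\<^esub> c (Str r l m)) {..<n} = \<phi> (bs i \<otimes>\<^bsub>A\<^esub> bs j \<otimes>\<^bsub>A\<^esub> bs l) m"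
    if "i < n" "j < n" "l < n" "m < n" for i j l m
    using that by (subst M) (auto intro!: R.finsum_cong' simp: S)
  have "finsum R (\<lambda>r. c (Str i j r) \<otimes>\<^bsub>R\<^esub> c (Str r l m)) {..<n} =
        finsum R (\<lambda>r. c (Str j l r) \<otimes>\<^bsub>R\<^esub> c (Str i r m)) {..<n}"
    if "i < n" "j < n" "l < n" "m < n" for i j l m
  proof -
    have "finsum R (\<lambda>r. c (Str j l r) \<otimes>\<^bsub>R\<^esub> c (Str i r m)) {..<n} =
        finsum R (\<lambda>r. c (Str j l r) \<otimes>\<^bsub>R\<^esub> c (Str r i m)) {..<n}"
      using that by (intro R.finsum_cong') (auto simp: S A.m_comm)
    also have "\<dots> = \<phi> (bs j \<otimes>\<^bsub>A\<^esub> bs l \<otimes>\<^bsub>A\<^esub> bs i) m" using that by (intro P)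
    also have "bs j \<otimes>\<^bsub>A\<^esub> bs l \<otimes>\<^bsub>A\<^esub> bs i = bs i \<otimes>\<^bsub>A\<^esub> bs j \<otimes>\<^bsub>A\<^esub> bs l"
      by (metis A.m_assoc A.m_comm A.m_closed bs_closed)
    finally show ?thesis using P that by simp
  qed
  moreover have "finsum R (\<lambda>r. c (Unt r) \<otimes>\<^bsub>R\<^esub> c (Str r i m)) {..<n} =
        (if i = m then \<one>\<^bsub>R\<^esub> else \<zero>\<^bsub>R\<^esub>)" if "i < n" "m < n" for i m
  proof -
    have "finsum R (\<lambda>r. c (Unt r) \<otimes>\<^bsub>R\<^esub> c (Str r i m)) {..<n} = \<phi> (\<one>\<^bsub>A\<^esub> \<otimes>\<^bsub>A\<^esub> bs i) m"
      using that by (subst M) (auto intro!: R.finsum_cong' simp: S U)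
    then show ?thesis using that by (simp add: phi_bs)
  qed
  ultimately show ?thesis unfolding is_point_def using comm by (simp add: S U)
qed

end

text \<open>
  A homomorphism \<open>\<alpha>\<close> over \<open>f\<close> that carries coordinate vectors to their images under \<open>f\<close> exhibits \<open>A'\<close>
  as the pullback of \<open>A\<close> along \<open>f\<close>.  Pullback thus applies \<open>f\<close> to the coordinates.
\<close>

theorem classifies_base_change:
  assumes "cring R" "cring R'" and ba: "based_algebra n R A \<sigma> \<phi>" "based_algebra n R' A' \<sigma>' \<phi>'"
    and f: "f \<in> ring_hom R R'" and \<alpha>: "\<alpha> \<in> ring_hom A A'"
    and comp: "\<And>a i. a \<in> carrier A \<Longrightarrow> i < n \<Longrightarrow> \<phi>' (\<alpha> a) i = f (\<phi> a i)"
    and c: "classifies n R A \<phi> c"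
  shows "classifies n R' A' \<phi>' (\<lambda>v. f (c v))"
proof -
  interpret X: based_alg R A n \<sigma> \<phi>
    using assms by (simp add: based_alg_def based_alg_axioms_def based_algebra_def)
  interpret Y: based_alg R' A' n \<sigma>' \<phi>'
    using assms by (simp add: based_alg_def based_alg_axioms_def based_algebra_def)
  have f0: "f \<zero>\<^bsub>R\<^esub> = \<zero>\<^bsub>R'\<^esub>" using ring_hom_zero[OF f] X.R.ring_axioms Y.R.ring_axioms by simp
  have "\<alpha> (X.bs i) = Y.bs i" for i
    using ring_hom_closed[OF \<alpha>] comp ring_hom_one[OF f] f0
    by (intro Y.phi_eqI) (auto simp: X.phi_bs Y.phi_bs)
  then show ?thesis
    using c comp ring_hom_mult[OF \<alpha>] ring_hom_one[OF \<alpha>]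
    unfolding classifies_def by (metis X.A.m_closed X.A.one_closed X.bs_closed)
qed

definition based_iso ::
  "'r ring \<Rightarrow> 'a ring \<Rightarrow> ('r \<Rightarrow> 'a) \<Rightarrow> ('a \<Rightarrow> nat \<Rightarrow> 'r) \<Rightarrow> 'b ring \<Rightarrow> ('r \<Rightarrow> 'b) \<Rightarrow> ('b \<Rightarrow> nat \<Rightarrow> 'r) \<Rightarrow> bool" where
  "based_iso R A \<sigma> \<phi> A' \<sigma>' \<phi>' \<longleftrightarrow>
     (\<exists>\<alpha> \<in> ring_iso A A'. (\<forall>r \<in> carrier R. \<alpha> (\<sigma> r) = \<sigma>' r) \<and> (\<forall>a \<in> carrier A. \<phi>' (\<alpha> a) = \<phi> a))"

theorem classifies_iso:
  assumes "cring R" and ba: "based_algebra n R A \<sigma> \<phi>" "based_algebra n R A' \<sigma>' \<phi>'"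
    and "based_iso R A \<sigma> \<phi> A' \<sigma>' \<phi>'" and c: "classifies n R A \<phi> c"
  shows "classifies n R A' \<phi>' c"
proof -
  obtain \<alpha> where "\<alpha> \<in> ring_hom A A'" "\<And>a. a \<in> carrier A \<Longrightarrow> \<phi>' (\<alpha> a) = \<phi> a"
    using assms(4) by (auto simp: based_iso_def ring_iso_def)
  then show ?thesis
    using classifies_base_change[OF assms(1,1) ba id_ring_hom _ _ c] by simp
qed

theorem classifies_imp_iso:
  assumes "cring R" and ba: "based_algebra n R A \<sigma> \<phi>" "based_algebra n R A' \<sigma>' \<phi>'"
    and c: "classifies n R A \<phi> c" "classifies n R A' \<phi>' c"
  shows "based_iso R A \<sigma> \<phi> A' \<sigma>' \<phi>'"
proof -
  interpret X: based_alg R A n \<sigma> \<phi>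
    using assms by (simp add: based_alg_def based_alg_axioms_def based_algebra_def)
  interpret Y: based_alg R A' n \<sigma>' \<phi>'
    using assms by (simp add: based_alg_def based_alg_axioms_def based_algebra_def)
  define \<alpha> where "\<alpha> a = inv_into (carrier A') \<phi>' (\<phi> a)" for a
  have cl: "\<alpha> a \<in> carrier A'" and ph: "\<phi>' (\<alpha> a) = \<phi> a" if "a \<in> carrier A" for a
    using Y.phi_surj[OF X.phi_E[OF that]] by (auto simp: \<alpha>_def)
  have "\<alpha> \<in> ring_hom A A'"
  proof (rule ring_hom_memI)
    fix x y assume xy: "x \<in> carrier A" "y \<in> carrier A"
    show "\<alpha> x \<in> carrier A'" using cl xy by simp
    show "\<alpha> (x \<otimes>\<^bsub>A\<^esub> y) = \<alpha> x \<otimes>\<^bsub>A'\<^esub> \<alpha> y"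
      using xy cl by (intro Y.phi_eqI) (auto simp: ph X.classifies_mult[OF c(1)] Y.classifies_mult[OF c(2)])
    show "\<alpha> (x \<oplus>\<^bsub>A\<^esub> y) = \<alpha> x \<oplus>\<^bsub>A'\<^esub> \<alpha> y"
      using xy cl by (intro Y.phi_eqI) (auto simp: ph X.phi_add Y.phi_add)
  next
    show "\<alpha> \<one>\<^bsub>A\<^esub> = \<one>\<^bsub>A'\<^esub>"
      using cl c by (intro Y.phi_eqI) (auto simp: ph classifies_def)
  qed
  moreover have "bij_betw \<alpha> (carrier A) (carrier A')"
  proof -
    have "bij_betw (inv_into (carrier A') \<phi>' \<circ> \<phi>) (carrier A) (carrier A')"
      using ba by (intro bij_betw_trans[OF _ bij_betw_inv_into]) (auto simp: based_algebra_def)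
    then show ?thesis by (simp add: \<alpha>_def[abs_def] comp_def)
  qed
  moreover have "\<alpha> (\<sigma> r) = \<sigma>' r" if "r \<in> carrier R" for r
    using that cl
    by (intro Y.phi_eqI) (auto simp: ph X.classifies_sigma[OF c(1)] Y.classifies_sigma[OF c(2)])
  ultimately show ?thesis using ph by (auto simp: based_iso_def ring_iso_def)
qed


section \<open>The coordinate rings represent the functors of based algebras\<close>

lemma (in cring) finsum_swap:
  assumes "finite I" "finite K" "\<And>i k. i \<in> I \<Longrightarrow> k \<in> K \<Longrightarrow> f i k \<in> carrier R"
  shows "(\<Oplus>i\<in>I. \<Oplus>k\<in>K. f i k) = (\<Oplus>k\<in>K. \<Oplus>i\<in>I. f i k)"
  using assms(1,3)
proof (induction I rule: finite_induct)
  case empty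
  then show ?case by simp
next
  case (insert i I)
  have "(\<Oplus>k\<in>K. \<Oplus>i\<in>insert i I. f i k) = (\<Oplus>k\<in>K. f i k \<oplus> (\<Oplus>i\<in>I. f i k))"
    using insert by (intro finsum_cong') (auto intro!: finsum_closed)
  also have "\<dots> = (\<Oplus>k\<in>K. f i k) \<oplus> (\<Oplus>k\<in>K. \<Oplus>i\<in>I. f i k)"
    using insert by (intro finsum_addf) (auto intro!: finsum_closed)
  also have "\<dots> = (\<Oplus>i\<in>insert i I. \<Oplus>k\<in>K. f i k)"
    using insert by (subst finsum_insert) (auto intro!: finsum_closed)
  finally show ?case by simp
qed

lemma (in cring) finsum_swap4:
  assumes "finite N" "\<And>r l i j. r \<in> N \<Longrightarrow> l \<in> N \<Longrightarrow> i \<in> N \<Longrightarrow> j \<in> N \<Longrightarrow> f r l i j \<in> carrier R"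
  shows "(\<Oplus>r\<in>N. \<Oplus>l\<in>N. \<Oplus>i\<in>N. \<Oplus>j\<in>N. f r l i j) = (\<Oplus>i\<in>N. \<Oplus>j\<in>N. \<Oplus>l\<in>N. \<Oplus>r\<in>N. f r l i j)"
proof -
  note [simp] = assms
  have "(\<Oplus>r\<in>N. \<Oplus>l\<in>N. \<Oplus>i\<in>N. \<Oplus>j\<in>N. f r l i j) = (\<Oplus>r\<in>N. \<Oplus>i\<in>N. \<Oplus>l\<in>N. \<Oplus>j\<in>N. f r l i j)"
    by (intro finsum_cong' finsum_swap) (auto intro!: finsum_closed)
  also have "\<dots> = (\<Oplus>i\<in>N. \<Oplus>r\<in>N. \<Oplus>l\<in>N. \<Oplus>j\<in>N. f r l i j)"
    by (intro finsum_swap) (auto intro!: finsum_closed)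
  also have "\<dots> = (\<Oplus>i\<in>N. \<Oplus>r\<in>N. \<Oplus>j\<in>N. \<Oplus>l\<in>N. f r l i j)"
    by (intro finsum_cong' finsum_swap) (auto intro!: finsum_closed)
  also have "\<dots> = (\<Oplus>i\<in>N. \<Oplus>j\<in>N. \<Oplus>r\<in>N. \<Oplus>l\<in>N. f r l i j)"
    by (intro finsum_cong' finsum_swap) (auto intro!: finsum_closed)
  also have "\<dots> = (\<Oplus>i\<in>N. \<Oplus>j\<in>N. \<Oplus>l\<in>N. \<Oplus>r\<in>N. f r l i j)"
    by (intro finsum_cong' finsum_swap) (auto intro!: finsum_closed)
  finally show ?thesis .
qed

definition point_mult :: "nat \<Rightarrow> 'r ring \<Rightarrow> (coord \<Rightarrow> 'r) \<Rightarrow> (nat \<Rightarrow> 'r) \<Rightarrow> (nat \<Rightarrow> 'r) \<Rightarrow> nat \<Rightarrow> 'r" where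
  "point_mult n R c x y =
    (\<lambda>l\<in>{..<n}. \<Oplus>\<^bsub>R\<^esub>i\<in>{..<n}. \<Oplus>\<^bsub>R\<^esub>j\<in>{..<n}. (x i \<otimes>\<^bsub>R\<^esub> y j) \<otimes>\<^bsub>R\<^esub> c (Str i j l))"

definition point_algebra :: "nat \<Rightarrow> 'r ring \<Rightarrow> (coord \<Rightarrow> 'r) \<Rightarrow> (nat \<Rightarrow> 'r) ring" where
  "point_algebra n R c =
     \<lparr>carrier = {..<n} \<rightarrow>\<^sub>E carrier R,
      monoid.mult = point_mult n R c,
      one = (\<lambda>i\<in>{..<n}. c (Unt i)),
      ring.zero = (\<lambda>i\<in>{..<n}. \<zero>\<^bsub>R\<^esub>),
      add = (\<lambda>x y. \<lambda>i\<in>{..<n}. x i \<oplus>\<^bsub>R\<^esub> y i)\<rparr>"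

lemma point_algebra_based:
  assumes "cring R" and c: "is_point n R c"
  shows "\<exists>\<sigma>. based_algebra n R (point_algebra n R c) \<sigma> (\<lambda>x. x) \<and>
    classifies n R (point_algebra n R c) (\<lambda>x. x) c"
proof -
  interpret R: cring R by fact
  let ?N = "{..<n}" and ?A = "point_algebra n R c"
  let ?E = "{..<n} \<rightarrow>\<^sub>E carrier R"
  have S [simp]: "c (Str i j l) \<in> carrier R" if "i < n" "j < n" "l < n" for i j l
    using c that by (simp add: is_point_def)
  have U [simp]: "c (Unt i) \<in> carrier R" if "i < n" for i using c that by (simp add: is_point_def)
  have E [simp]: "x i \<in> carrier R" if "x \<in> ?E" "i < n" for x i using that by blast
  have SE: "\<And>x i. x \<in> ?E \<Longrightarrow> i \<in> ?N \<Longrightarrow> x i \<in> carrier R" by auto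
  have com: "c (Str i j l) = c (Str j i l)" if "i < n" "j < n" "l < n" for i j l
    using c that unfolding is_point_def by blast
  have pmE [simp]: "point_mult n R c x y \<in> ?E" if "x \<in> ?E" "y \<in> ?E" for x y
    using that by (auto simp: point_mult_def intro!: R.finsum_closed)
  have pm: "point_mult n R c x y l = (\<Oplus>\<^bsub>R\<^esub>i\<in>?N. \<Oplus>\<^bsub>R\<^esub>j\<in>?N. (x i \<otimes>\<^bsub>R\<^esub> y j) \<otimes>\<^bsub>R\<^esub> c (Str i j l))"
    if "l < n" for x y l using that by (simp add: point_mult_def)
  have eqE: "x = y" if "x \<in> ?E" "y \<in> ?E" "\<And>l. l < n \<Longrightarrow> x l = y l" for x y :: "nat \<Rightarrow> 'a"
    using that by (intro PiE_ext[of x ?N "\<lambda>_. carrier R" y]) auto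
  have addE [simp]: "(\<lambda>i\<in>?N. x i \<oplus>\<^bsub>R\<^esub> y i) \<in> ?E" if "x \<in> ?E" "y \<in> ?E" for x y
    using that by auto
  have zeroE [simp]: "(\<lambda>i\<in>?N. \<zero>\<^bsub>R\<^esub>) \<in> ?E" by auto
  have oneE [simp]: "(\<lambda>i\<in>?N. c (Unt i)) \<in> ?E" by auto
  have pm_comm: "point_mult n R c x y = point_mult n R c y x" if xy: "x \<in> ?E" "y \<in> ?E" for x y
  proof (rule eqE)
    fix l assume l: "l < n"
    have "point_mult n R c x y l = (\<Oplus>\<^bsub>R\<^esub>j\<in>?N. \<Oplus>\<^bsub>R\<^esub>i\<in>?N. (x i \<otimes>\<^bsub>R\<^esub> y j) \<otimes>\<^bsub>R\<^esub> c (Str i j l))"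
      unfolding pm[OF l] using xy l by (intro R.finsum_swap) auto
    also have "\<dots> = (\<Oplus>\<^bsub>R\<^esub>j\<in>?N. \<Oplus>\<^bsub>R\<^esub>i\<in>?N. (y j \<otimes>\<^bsub>R\<^esub> x i) \<otimes>\<^bsub>R\<^esub> c (Str j i l))"
    proof (intro R.finsum_cong')
      fix i j assume "j \<in> ?N" "i \<in> ?N"
      then show "(x i \<otimes>\<^bsub>R\<^esub> y j) \<otimes>\<^bsub>R\<^esub> c (Str i j l) = (y j \<otimes>\<^bsub>R\<^esub> x i) \<otimes>\<^bsub>R\<^esub> c (Str j i l)"
        using xy l com[of i j l] R.m_comm[of "x i" "y j"] by simp
    qed (use xy l in \<open>auto intro!: R.finsum_closed\<close>)
    also have "\<dots> = point_mult n R c y x l" by (simp add: pm l)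
    finally show "point_mult n R c x y l = point_mult n R c y x l" .
  qed (use xy in auto)
  define T where "T i j l m = (\<Oplus>\<^bsub>R\<^esub>r\<in>?N. c (Str i j r) \<otimes>\<^bsub>R\<^esub> c (Str r l m))" for i j l m
  have Tc [simp]: "T i j l m \<in> carrier R" if "i < n" "j < n" "l < n" "m < n" for i j l m
    using that by (auto simp: T_def intro!: R.finsum_closed)
  have Tsym: "T i j l m = T j l i m" if "i < n" "j < n" "l < n" "m < n" for i j l m
  proof -
    have "T i j l m = (\<Oplus>\<^bsub>R\<^esub>r\<in>?N. c (Str j l r) \<otimes>\<^bsub>R\<^esub> c (Str i r m))"
      using that c unfolding T_def is_point_def by blast
    also have "\<dots> = T j l i m"
      unfolding T_def using that by (intro R.finsum_cong') (auto simp: com[of i])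
    finally show ?thesis .
  qed
  have triple: "point_mult n R c (point_mult n R c x y) z m =
      (\<Oplus>\<^bsub>R\<^esub>i\<in>?N. \<Oplus>\<^bsub>R\<^esub>j\<in>?N. \<Oplus>\<^bsub>R\<^esub>l\<in>?N. ((x i \<otimes>\<^bsub>R\<^esub> y j) \<otimes>\<^bsub>R\<^esub> z l) \<otimes>\<^bsub>R\<^esub> T i j l m)"
    if xyz: "x \<in> ?E" "y \<in> ?E" "z \<in> ?E" and m: "m < n" for x y z m
  proof -
    have 1: "(point_mult n R c x y r \<otimes>\<^bsub>R\<^esub> z l) \<otimes>\<^bsub>R\<^esub> c (Str r l m) =
      (\<Oplus>\<^bsub>R\<^esub>i\<in>?N. \<Oplus>\<^bsub>R\<^esub>j\<in>?N. ((x i \<otimes>\<^bsub>R\<^esub> y j) \<otimes>\<^bsub>R\<^esub> z l) \<otimes>\<^bsub>R\<^esub> (c (Str i j r) \<otimes>\<^bsub>R\<^esub> c (Str r l m)))"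
      if r: "r < n" and l: "l < n" for r l
    proof -
      have "(point_mult n R c x y r \<otimes>\<^bsub>R\<^esub> z l) \<otimes>\<^bsub>R\<^esub> c (Str r l m) =
         point_mult n R c x y r \<otimes>\<^bsub>R\<^esub> (z l \<otimes>\<^bsub>R\<^esub> c (Str r l m))"
        using xyz r l m pmE[of x y] by (intro R.m_assoc) (auto simp del: pmE)
      also have "\<dots> = (\<Oplus>\<^bsub>R\<^esub>i\<in>?N. (\<Oplus>\<^bsub>R\<^esub>j\<in>?N. (x i \<otimes>\<^bsub>R\<^esub> y j) \<otimes>\<^bsub>R\<^esub> c (Str i j r)) \<otimes>\<^bsub>R\<^esub> (z l \<otimes>\<^bsub>R\<^esub> c (Str r l m)))"
        unfolding pm[OF r] using xyz r l m by (intro R.finsum_ldistr) (auto intro!: R.finsum_closed)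
      also have "\<dots> = (\<Oplus>\<^bsub>R\<^esub>i\<in>?N. \<Oplus>\<^bsub>R\<^esub>j\<in>?N. ((x i \<otimes>\<^bsub>R\<^esub> y j) \<otimes>\<^bsub>R\<^esub> z l) \<otimes>\<^bsub>R\<^esub> (c (Str i j r) \<otimes>\<^bsub>R\<^esub> c (Str r l m)))"
      proof (intro R.finsum_cong' refl)
        fix i assume i: "i \<in> ?N"
        have "(\<Oplus>\<^bsub>R\<^esub>j\<in>?N. (x i \<otimes>\<^bsub>R\<^esub> y j) \<otimes>\<^bsub>R\<^esub> c (Str i j r)) \<otimes>\<^bsub>R\<^esub> (z l \<otimes>\<^bsub>R\<^esub> c (Str r l m)) =
          (\<Oplus>\<^bsub>R\<^esub>j\<in>?N. ((x i \<otimes>\<^bsub>R\<^esub> y j) \<otimes>\<^bsub>R\<^esub> c (Str i j r)) \<otimes>\<^bsub>R\<^esub> (z l \<otimes>\<^bsub>R\<^esub> c (Str r l m)))"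
          using xyz r l m i by (intro R.finsum_ldistr) auto
        also have "\<dots> = (\<Oplus>\<^bsub>R\<^esub>j\<in>?N. ((x i \<otimes>\<^bsub>R\<^esub> y j) \<otimes>\<^bsub>R\<^esub> z l) \<otimes>\<^bsub>R\<^esub> (c (Str i j r) \<otimes>\<^bsub>R\<^esub> c (Str r l m)))"
          using xyz r l m i by (intro R.finsum_cong' refl) (auto simp: R.m_ac)
        finally show "(\<Oplus>\<^bsub>R\<^esub>j\<in>?N. (x i \<otimes>\<^bsub>R\<^esub> y j) \<otimes>\<^bsub>R\<^esub> c (Str i j r)) \<otimes>\<^bsub>R\<^esub> (z l \<otimes>\<^bsub>R\<^esub> c (Str r l m)) =
          (\<Oplus>\<^bsub>R\<^esub>j\<in>?N. ((x i \<otimes>\<^bsub>R\<^esub> y j) \<otimes>\<^bsub>R\<^esub> z l) \<otimes>\<^bsub>R\<^esub> (c (Str i j r) \<otimes>\<^bsub>R\<^esub> c (Str r l m)))" .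
      qed (use xyz r l m in \<open>auto intro!: R.finsum_closed\<close>)
      finally show ?thesis .
    qed
    have "point_mult n R c (point_mult n R c x y) z m =
      (\<Oplus>\<^bsub>R\<^esub>r\<in>?N. \<Oplus>\<^bsub>R\<^esub>l\<in>?N. \<Oplus>\<^bsub>R\<^esub>i\<in>?N. \<Oplus>\<^bsub>R\<^esub>j\<in>?N.
         ((x i \<otimes>\<^bsub>R\<^esub> y j) \<otimes>\<^bsub>R\<^esub> z l) \<otimes>\<^bsub>R\<^esub> (c (Str i j r) \<otimes>\<^bsub>R\<^esub> c (Str r l m)))"
      unfolding pm[OF m] using xyz m by (intro R.finsum_cong' refl) (auto simp: 1 intro!: R.finsum_closed)
    also have "\<dots> = (\<Oplus>\<^bsub>R\<^esub>i\<in>?N. \<Oplus>\<^bsub>R\<^esub>j\<in>?N. \<Oplus>\<^bsub>R\<^esub>l\<in>?N. \<Oplus>\<^bsub>R\<^esub>r\<in>?N.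
         ((x i \<otimes>\<^bsub>R\<^esub> y j) \<otimes>\<^bsub>R\<^esub> z l) \<otimes>\<^bsub>R\<^esub> (c (Str i j r) \<otimes>\<^bsub>R\<^esub> c (Str r l m)))"
      using xyz m by (intro R.finsum_swap4) auto
    also have "\<dots> = (\<Oplus>\<^bsub>R\<^esub>i\<in>?N. \<Oplus>\<^bsub>R\<^esub>j\<in>?N. \<Oplus>\<^bsub>R\<^esub>l\<in>?N. ((x i \<otimes>\<^bsub>R\<^esub> y j) \<otimes>\<^bsub>R\<^esub> z l) \<otimes>\<^bsub>R\<^esub> T i j l m)"
    proof (intro R.finsum_cong' refl)
      fix i j l assume "i \<in> ?N" "j \<in> ?N" "l \<in> ?N"
      then show "(\<Oplus>\<^bsub>R\<^esub>r\<in>?N. ((x i \<otimes>\<^bsub>R\<^esub> y j) \<otimes>\<^bsub>R\<^esub> z l) \<otimes>\<^bsub>R\<^esub> (c (Str i j r) \<otimes>\<^bsub>R\<^esub> c (Str r l m))) =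
        ((x i \<otimes>\<^bsub>R\<^esub> y j) \<otimes>\<^bsub>R\<^esub> z l) \<otimes>\<^bsub>R\<^esub> T i j l m"
        unfolding T_def using xyz m by (intro R.finsum_rdistr[symmetric]) auto
    qed (use xyz m in \<open>auto intro!: R.finsum_closed\<close>)
    finally show ?thesis .
  qed
  have pm_assoc: "point_mult n R c (point_mult n R c x y) z = point_mult n R c x (point_mult n R c y z)"
    if xyz: "x \<in> ?E" "y \<in> ?E" "z \<in> ?E" for x y z
  proof (rule eqE)
    fix m assume m: "m < n"
    have "point_mult n R c x (point_mult n R c y z) m = point_mult n R c (point_mult n R c y z) x m"
      using pm_comm[OF xyz(1) pmE[OF xyz(2,3)]] by simp
    also have "\<dots> = (\<Oplus>\<^bsub>R\<^esub>j\<in>?N. \<Oplus>\<^bsub>R\<^esub>l\<in>?N. \<Oplus>\<^bsub>R\<^esub>i\<in>?N. ((y j \<otimes>\<^bsub>R\<^esub> z l) \<otimes>\<^bsub>R\<^esub> x i) \<otimes>\<^bsub>R\<^esub> T j l i m)"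
      using triple[OF xyz(2,3,1) m] .
    also have "\<dots> = (\<Oplus>\<^bsub>R\<^esub>j\<in>?N. \<Oplus>\<^bsub>R\<^esub>l\<in>?N. \<Oplus>\<^bsub>R\<^esub>i\<in>?N. ((x i \<otimes>\<^bsub>R\<^esub> y j) \<otimes>\<^bsub>R\<^esub> z l) \<otimes>\<^bsub>R\<^esub> T i j l m)"
    proof (intro R.finsum_cong' refl)
      fix i j l assume "i \<in> ?N" "j \<in> ?N" "l \<in> ?N"
      then show "((y j \<otimes>\<^bsub>R\<^esub> z l) \<otimes>\<^bsub>R\<^esub> x i) \<otimes>\<^bsub>R\<^esub> T j l i m = ((x i \<otimes>\<^bsub>R\<^esub> y j) \<otimes>\<^bsub>R\<^esub> z l) \<otimes>\<^bsub>R\<^esub> T i j l m"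
        using xyz m Tsym[of i j l m] by (simp add: R.m_ac)
    qed (use xyz m in \<open>auto intro!: R.finsum_closed\<close>)
    also have "\<dots> = (\<Oplus>\<^bsub>R\<^esub>j\<in>?N. \<Oplus>\<^bsub>R\<^esub>i\<in>?N. \<Oplus>\<^bsub>R\<^esub>l\<in>?N. ((x i \<otimes>\<^bsub>R\<^esub> y j) \<otimes>\<^bsub>R\<^esub> z l) \<otimes>\<^bsub>R\<^esub> T i j l m)"
      using xyz m by (intro R.finsum_cong'[OF refl _ R.finsum_swap]) (auto intro!: R.finsum_closed)
    also have "\<dots> = (\<Oplus>\<^bsub>R\<^esub>i\<in>?N. \<Oplus>\<^bsub>R\<^esub>j\<in>?N. \<Oplus>\<^bsub>R\<^esub>l\<in>?N. ((x i \<otimes>\<^bsub>R\<^esub> y j) \<otimes>\<^bsub>R\<^esub> z l) \<otimes>\<^bsub>R\<^esub> T i j l m)"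
      using xyz m by (intro R.finsum_swap) (auto intro!: R.finsum_closed)
    also have "\<dots> = point_mult n R c (point_mult n R c x y) z m"
      using triple[OF xyz m] by simp
    finally show "point_mult n R c (point_mult n R c x y) z m = point_mult n R c x (point_mult n R c y z) m" by simp
  qed (use xyz in auto)
  have pm_distr: "point_mult n R c (\<lambda>i\<in>?N. x i \<oplus>\<^bsub>R\<^esub> y i) z =
      (\<lambda>i\<in>?N. point_mult n R c x z i \<oplus>\<^bsub>R\<^esub> point_mult n R c y z i)"
    if xyz: "x \<in> ?E" "y \<in> ?E" "z \<in> ?E" for x y z
  proof (rule eqE)
    fix m assume m: "m < n"
    have "point_mult n R c (\<lambda>i\<in>?N. x i \<oplus>\<^bsub>R\<^esub> y i) z m =
      (\<Oplus>\<^bsub>R\<^esub>i\<in>?N. (\<Oplus>\<^bsub>R\<^esub>j\<in>?N. (x i \<otimes>\<^bsub>R\<^esub> z j) \<otimes>\<^bsub>R\<^esub> c (Str i j m)) \<oplus>\<^bsub>R\<^esub> (\<Oplus>\<^bsub>R\<^esub>j\<in>?N. (y i \<otimes>\<^bsub>R\<^esub> z j) \<otimes>\<^bsub>R\<^esub> c (Str i j m)))"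
      unfolding pm[OF m]
    proof (intro R.finsum_cong' refl)
      fix i assume i: "i \<in> ?N"
      have "(\<Oplus>\<^bsub>R\<^esub>j\<in>?N. ((\<lambda>i\<in>?N. x i \<oplus>\<^bsub>R\<^esub> y i) i \<otimes>\<^bsub>R\<^esub> z j) \<otimes>\<^bsub>R\<^esub> c (Str i j m)) =
        (\<Oplus>\<^bsub>R\<^esub>j\<in>?N. (x i \<otimes>\<^bsub>R\<^esub> z j) \<otimes>\<^bsub>R\<^esub> c (Str i j m) \<oplus>\<^bsub>R\<^esub> (y i \<otimes>\<^bsub>R\<^esub> z j) \<otimes>\<^bsub>R\<^esub> c (Str i j m))"
        using xyz m i by (intro R.finsum_cong' refl) (auto simp: R.l_distr)
      also have "\<dots> = (\<Oplus>\<^bsub>R\<^esub>j\<in>?N. (x i \<otimes>\<^bsub>R\<^esub> z j) \<otimes>\<^bsub>R\<^esub> c (Str i j m)) \<oplus>\<^bsub>R\<^esub> (\<Oplus>\<^bsub>R\<^esub>j\<in>?N. (y i \<otimes>\<^bsub>R\<^esub> z j) \<otimes>\<^bsub>R\<^esub> c (Str i j m))"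
        using xyz m i by (intro R.finsum_addf) auto
      finally show "(\<Oplus>\<^bsub>R\<^esub>j\<in>?N. ((\<lambda>i\<in>?N. x i \<oplus>\<^bsub>R\<^esub> y i) i \<otimes>\<^bsub>R\<^esub> z j) \<otimes>\<^bsub>R\<^esub> c (Str i j m)) =
        (\<Oplus>\<^bsub>R\<^esub>j\<in>?N. (x i \<otimes>\<^bsub>R\<^esub> z j) \<otimes>\<^bsub>R\<^esub> c (Str i j m)) \<oplus>\<^bsub>R\<^esub> (\<Oplus>\<^bsub>R\<^esub>j\<in>?N. (y i \<otimes>\<^bsub>R\<^esub> z j) \<otimes>\<^bsub>R\<^esub> c (Str i j m))" .
    qed (use xyz m in \<open>auto intro!: R.finsum_closed\<close>)
    also have "\<dots> = point_mult n R c x z m \<oplus>\<^bsub>R\<^esub> point_mult n R c y z m"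
      unfolding pm[OF m] using xyz m by (intro R.finsum_addf) (auto intro!: R.finsum_closed)
    finally show "point_mult n R c (\<lambda>i\<in>?N. x i \<oplus>\<^bsub>R\<^esub> y i) z m =
      (\<lambda>i\<in>?N. point_mult n R c x z i \<oplus>\<^bsub>R\<^esub> point_mult n R c y z i) m" using m by simp
  qed (rule pmE[OF addE[OF xyz(1,2)] xyz(3)], rule addE[OF pmE[OF xyz(1,3)] pmE[OF xyz(2,3)]])
  have pm_scale: "point_mult n R c (\<lambda>i\<in>?N. r \<otimes>\<^bsub>R\<^esub> x i) y l = r \<otimes>\<^bsub>R\<^esub> point_mult n R c x y l"
    if xy: "x \<in> ?E" "y \<in> ?E" and r: "r \<in> carrier R" and l: "l < n" for x y r l
  proof -
    have "r \<otimes>\<^bsub>R\<^esub> point_mult n R c x y l =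
      (\<Oplus>\<^bsub>R\<^esub>i\<in>?N. r \<otimes>\<^bsub>R\<^esub> (\<Oplus>\<^bsub>R\<^esub>j\<in>?N. (x i \<otimes>\<^bsub>R\<^esub> y j) \<otimes>\<^bsub>R\<^esub> c (Str i j l)))"
      unfolding pm[OF l] using xy r l by (intro R.finsum_rdistr) (auto intro!: R.finsum_closed)
    also have "\<dots> = (\<Oplus>\<^bsub>R\<^esub>i\<in>?N. \<Oplus>\<^bsub>R\<^esub>j\<in>?N. ((\<lambda>i\<in>?N. r \<otimes>\<^bsub>R\<^esub> x i) i \<otimes>\<^bsub>R\<^esub> y j) \<otimes>\<^bsub>R\<^esub> c (Str i j l))"
    proof (intro R.finsum_cong' refl)
      fix i assume i: "i \<in> ?N"
      have "r \<otimes>\<^bsub>R\<^esub> (\<Oplus>\<^bsub>R\<^esub>j\<in>?N. (x i \<otimes>\<^bsub>R\<^esub> y j) \<otimes>\<^bsub>R\<^esub> c (Str i j l)) =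
        (\<Oplus>\<^bsub>R\<^esub>j\<in>?N. r \<otimes>\<^bsub>R\<^esub> ((x i \<otimes>\<^bsub>R\<^esub> y j) \<otimes>\<^bsub>R\<^esub> c (Str i j l)))"
        using xy r l i by (intro R.finsum_rdistr) auto
      also have "\<dots> = (\<Oplus>\<^bsub>R\<^esub>j\<in>?N. ((\<lambda>i\<in>?N. r \<otimes>\<^bsub>R\<^esub> x i) i \<otimes>\<^bsub>R\<^esub> y j) \<otimes>\<^bsub>R\<^esub> c (Str i j l))"
        using xy r l i by (intro R.finsum_cong' refl) (auto simp: R.m_assoc)
      finally show "r \<otimes>\<^bsub>R\<^esub> (\<Oplus>\<^bsub>R\<^esub>j\<in>?N. (x i \<otimes>\<^bsub>R\<^esub> y j) \<otimes>\<^bsub>R\<^esub> c (Str i j l)) =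
        (\<Oplus>\<^bsub>R\<^esub>j\<in>?N. ((\<lambda>i\<in>?N. r \<otimes>\<^bsub>R\<^esub> x i) i \<otimes>\<^bsub>R\<^esub> y j) \<otimes>\<^bsub>R\<^esub> c (Str i j l))" .
    qed (use xy r l in \<open>auto intro!: R.finsum_closed\<close>)
    finally show ?thesis by (simp add: pm l)
  qed
  have pm_one: "point_mult n R c (\<lambda>i\<in>?N. c (Unt i)) x = x" if x: "x \<in> ?E" for x
  proof (rule eqE)
    fix l assume l: "l < n"
    have "point_mult n R c (\<lambda>i\<in>?N. c (Unt i)) x l =
      (\<Oplus>\<^bsub>R\<^esub>i\<in>?N. \<Oplus>\<^bsub>R\<^esub>j\<in>?N. x j \<otimes>\<^bsub>R\<^esub> (c (Unt i) \<otimes>\<^bsub>R\<^esub> c (Str i j l)))"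
      unfolding pm[OF l] using x l by (intro R.finsum_cong' refl) (auto intro!: R.finsum_closed simp: R.m_ac)
    also have "\<dots> = (\<Oplus>\<^bsub>R\<^esub>j\<in>?N. \<Oplus>\<^bsub>R\<^esub>i\<in>?N. x j \<otimes>\<^bsub>R\<^esub> (c (Unt i) \<otimes>\<^bsub>R\<^esub> c (Str i j l)))"
      using x l by (intro R.finsum_swap) auto
    also have "\<dots> = (\<Oplus>\<^bsub>R\<^esub>j\<in>?N. if l = j then x j else \<zero>\<^bsub>R\<^esub>)"
    proof (intro R.finsum_cong' refl)
      fix j assume j: "j \<in> ?N"
      have "(\<Oplus>\<^bsub>R\<^esub>i\<in>?N. x j \<otimes>\<^bsub>R\<^esub> (c (Unt i) \<otimes>\<^bsub>R\<^esub> c (Str i j l))) =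
        x j \<otimes>\<^bsub>R\<^esub> (\<Oplus>\<^bsub>R\<^esub>i\<in>?N. c (Unt i) \<otimes>\<^bsub>R\<^esub> c (Str i j l))"
        using x l j by (intro R.finsum_rdistr[symmetric]) auto
      also have "(\<Oplus>\<^bsub>R\<^esub>i\<in>?N. c (Unt i) \<otimes>\<^bsub>R\<^esub> c (Str i j l)) = (if j = l then \<one>\<^bsub>R\<^esub> else \<zero>\<^bsub>R\<^esub>)"
        using c j l unfolding is_point_def by simp
      finally show "(\<Oplus>\<^bsub>R\<^esub>i\<in>?N. x j \<otimes>\<^bsub>R\<^esub> (c (Unt i) \<otimes>\<^bsub>R\<^esub> c (Str i j l))) = (if l = j then x j else \<zero>\<^bsub>R\<^esub>)"
        using x j by auto
    qed (use x in auto)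
    also have "\<dots> = x l" using x l by (intro R.finsum_singleton) auto
    finally show "point_mult n R c (\<lambda>i\<in>?N. c (Unt i)) x l = x l" .
  qed (use x in auto)
  have A_simps [simp]: "carrier ?A = ?E" "x \<otimes>\<^bsub>?A\<^esub> y = point_mult n R c x y"
    "\<one>\<^bsub>?A\<^esub> = (\<lambda>i\<in>?N. c (Unt i))" "\<zero>\<^bsub>?A\<^esub> = (\<lambda>i\<in>?N. \<zero>\<^bsub>R\<^esub>)"
    "x \<oplus>\<^bsub>?A\<^esub> y = (\<lambda>i\<in>?N. x i \<oplus>\<^bsub>R\<^esub> y i)" for x y
    by (simp_all add: point_algebra_def)
  have A: "cring ?A"
  proof (rule cringI)
    show "abelian_group ?A"
    proof (rule abelian_groupI; unfold A_simps)
      fix x y z assume x: "x \<in> ?E" and y: "y \<in> ?E" and z: "z \<in> ?E"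
      show "(\<lambda>i\<in>?N. x i \<oplus>\<^bsub>R\<^esub> y i) \<in> ?E" using x y by (rule addE)
      show "(\<lambda>i\<in>?N. (\<lambda>i\<in>?N. x i \<oplus>\<^bsub>R\<^esub> y i) i \<oplus>\<^bsub>R\<^esub> z i) = (\<lambda>i\<in>?N. x i \<oplus>\<^bsub>R\<^esub> (\<lambda>i\<in>?N. y i \<oplus>\<^bsub>R\<^esub> z i) i)"
        using x y z by (intro restrict_ext) (simp add: R.a_assoc)
      show "(\<lambda>i\<in>?N. x i \<oplus>\<^bsub>R\<^esub> y i) = (\<lambda>i\<in>?N. y i \<oplus>\<^bsub>R\<^esub> x i)"
        using x y by (intro restrict_ext) (simp add: R.a_comm)
    next
      fix x assume x: "x \<in> ?E"
      show "(\<lambda>i\<in>?N. (\<lambda>i\<in>?N. \<zero>\<^bsub>R\<^esub>) i \<oplus>\<^bsub>R\<^esub> x i) = x"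
        using x by (intro eqE) auto
      show "\<exists>y\<in>?E. (\<lambda>i\<in>?N. y i \<oplus>\<^bsub>R\<^esub> x i) = (\<lambda>i\<in>?N. \<zero>\<^bsub>R\<^esub>)"
        using x by (intro bexI[of _ "\<lambda>i\<in>?N. \<ominus>\<^bsub>R\<^esub> x i"] restrict_ext) (auto simp: R.l_neg)
    qed (rule zeroE)
    show "comm_monoid ?A"
      by (rule comm_monoidI; unfold A_simps) (fact pmE oneE pm_assoc pm_one pm_comm)+
  qed (simp only: A_simps pm_distr)
  define \<sigma> where "\<sigma> r = (\<lambda>i\<in>?N. r \<otimes>\<^bsub>R\<^esub> c (Unt i))" for r
  have \<sigma>E [simp]: "\<sigma> r \<in> ?E" if "r \<in> carrier R" for r using that by (auto simp: \<sigma>_def)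
  have \<sigma>_mult: "point_mult n R c (\<sigma> r) x l = r \<otimes>\<^bsub>R\<^esub> x l" if "r \<in> carrier R" "x \<in> ?E" "l < n" for r x l
  proof -
    have "\<sigma> r = (\<lambda>i\<in>?N. r \<otimes>\<^bsub>R\<^esub> (\<lambda>i\<in>?N. c (Unt i)) i)" by (auto simp: \<sigma>_def)
    then show ?thesis using pm_scale[OF oneE that(2,1,3)] pm_one[OF that(2)] by simp
  qed
  have "\<sigma> \<in> ring_hom R ?A"
  proof (rule ring_hom_memI; unfold A_simps)
    fix x y assume xy: "x \<in> carrier R" "y \<in> carrier R"
    show "\<sigma> x \<in> ?E" using xy by simp
    show "\<sigma> (x \<otimes>\<^bsub>R\<^esub> y) = point_mult n R c (\<sigma> x) (\<sigma> y)"
      using xy by (intro eqE) (simp_all add: \<sigma>_mult, simp add: \<sigma>_def R.m_assoc)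
    show "\<sigma> (x \<oplus>\<^bsub>R\<^esub> y) = (\<lambda>i\<in>?N. \<sigma> x i \<oplus>\<^bsub>R\<^esub> \<sigma> y i)"
      unfolding \<sigma>_def using xy by (intro restrict_ext) (simp add: R.l_distr)
  next
    show "\<sigma> \<one>\<^bsub>R\<^esub> = (\<lambda>i\<in>?N. c (Unt i))" unfolding \<sigma>_def by (intro restrict_ext) simp
  qed
  then have ba: "based_algebra n R ?A \<sigma> (\<lambda>x. x)"
    using A unfolding based_algebra_def by (simp add: \<sigma>_mult bij_betw_def)
  interpret B: based_alg R ?A n \<sigma> "\<lambda>x. x"
    using assms A ba by (simp add: based_alg_def based_alg_axioms_def)
  have "c (Str i j l) = point_mult n R c (B.bs i) (B.bs j) l" if "i < n" "j < n" "l < n" for i j l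
  proof -
    have bE: "B.bs i \<in> ?E" for i using B.bs_closed[of i] by simp
    have "point_mult n R c (B.bs i) (B.bs j) l =
       (\<Oplus>\<^bsub>R\<^esub>i'\<in>?N. \<Oplus>\<^bsub>R\<^esub>j'\<in>?N. if j = j' then (if i = i' then c (Str i j l) else \<zero>\<^bsub>R\<^esub>) else \<zero>\<^bsub>R\<^esub>)"
      unfolding pm[OF that(3)] using that
      by (intro R.finsum_cong' refl) (auto simp: B.phi_bs intro!: R.finsum_closed)
    also have "\<dots> = (\<Oplus>\<^bsub>R\<^esub>i'\<in>?N. if i = i' then c (Str i j l) else \<zero>\<^bsub>R\<^esub>)"
      using that by (intro R.finsum_cong' refl R.finsum_singleton) auto
    also have "\<dots> = c (Str i j l)"
      using that by (intro R.finsum_singleton[of _ _ "\<lambda>_. c (Str i j l)"]) auto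
    finally show ?thesis by simp
  qed
  then have "classifies n R ?A (\<lambda>x. x) c" by (simp add: classifies_def)
  with ba show ?thesis by blast
qed

lemma classifies_exists: "\<exists>c. classifies n R A \<phi> c"
  by (rule exI[of _ "\<lambda>v. case v of Str i j l \<Rightarrow> \<phi> (basis_vec n R A \<phi> i \<otimes>\<^bsub>A\<^esub> basis_vec n R A \<phi> j) l
        | Unt i \<Rightarrow> \<phi> \<one>\<^bsub>A\<^esub> i"]) (simp add: classifies_def)

lemma classifies_cong:
  assumes "classifies n R A \<phi> c" "\<forall>v\<in>coords n. c' v = c v"
  shows "classifies n R A \<phi> c'"
  using assms by (simp add: classifies_def)

lemma classifies_unique:
  assumes "classifies n R A \<phi> c" "classifies n R A \<phi> c'" "v \<in> coords n"
  shows "c v = c' v"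
  using assms by (auto simp: classifies_def coords_def)

text \<open>
  Every based algebra over a \<open>'k\<close>-algebra \<open>R\<close> comes from a unique homomorphism from the coordinate
  ring to \<open>R\<close>, and every such homomorphism comes from a based algebra.
\<close>

theorem based_coord_ring_point:
  fixes s :: "'k::comm_ring_1 \<Rightarrow> 'r"
  assumes R: "algebra_over s R" and ba: "based_algebra n R A \<sigma> \<phi>"
  shows "\<exists>u \<in> alg_hom (based_const n) (based_coord_ring n) s R.
     classifies n R A \<phi> (\<lambda>v. u (based_var n v)) \<and>
     (\<forall>u' \<in> alg_hom (based_const n) (based_coord_ring n) s R.
        classifies n R A \<phi> (\<lambda>v. u' (based_var n v)) \<longrightarrow>
        (\<forall>b \<in> carrier (based_coord_ring n). u' b = u b))"
proof -
  interpret based_alg R A n \<sigma> \<phi>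
    using algebra_overD(1)[OF R] ba by (simp add: based_alg_def based_alg_axioms_def based_algebra_def)
  obtain c where c: "classifies n R A \<phi> c" using classifies_exists by blast
  obtain u where u: "u \<in> alg_hom (based_const n) (based_coord_ring n) s R"
      "\<forall>v\<in>coords n. u (based_var n v) = c v"
    using based_coord_ring_hom_iff(1)[OF R, of n c] is_point[OF c] by blast
  have cu: "classifies n R A \<phi> (\<lambda>v. u (based_var n v))"
    using classifies_cong[OF c u(2)] .
  show ?thesis
  proof (intro bexI[OF _ u(1)] conjI ballI impI)
    fix u' b assume "u' \<in> alg_hom (based_const n) (based_coord_ring n) s R"
      "classifies n R A \<phi> (\<lambda>v. u' (based_var n v))" "b \<in> carrier (based_coord_ring n :: ((coord \<Rightarrow>\<^sub>0 nat) \<Rightarrow>\<^sub>0 'k) set ring)"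
    then show "u' b = u b"
      using pres_hom_unique[OF relations_carrier] u(1) classifies_unique[OF _ cu]
      unfolding based_const_def based_coord_ring_def based_var_def by blast
  qed (rule cu)
qed

theorem based_coord_ring_based_algebra:
  fixes s :: "'k::comm_ring_1 \<Rightarrow> 'r"
  assumes R: "algebra_over s R" and u: "u \<in> alg_hom (based_const n) (based_coord_ring n) s R"
  shows "\<exists>(A :: (nat \<Rightarrow> 'r) ring) \<sigma> \<phi>. based_algebra n R A \<sigma> \<phi> \<and>
     classifies n R A \<phi> (\<lambda>v. u (based_var n v))"
proof -
  have "is_point n R (\<lambda>v. u (based_var n v))"
    using based_coord_ring_hom_iff(1)[OF R, of n "\<lambda>v. u (based_var n v)"] u by blast
  then show ?thesis using point_algebra_based[OF algebra_overD(1)[OF R]] by blast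
qed

theorem based1_coord_ring_point:
  fixes s :: "'k::comm_ring_1 \<Rightarrow> 'r"
  assumes R: "algebra_over s R" and ba: "based_algebra n R A \<sigma> \<phi>"
    and one: "\<phi> \<one>\<^bsub>A\<^esub> = std_basis n R 0"
  shows "\<exists>u \<in> alg_hom (based1_const n) (based1_coord_ring n) s R.
     classifies n R A \<phi> (\<lambda>v. u (based1_var n v)) \<and>
     (\<forall>u' \<in> alg_hom (based1_const n) (based1_coord_ring n) s R.
        classifies n R A \<phi> (\<lambda>v. u' (based1_var n v)) \<longrightarrow>
        (\<forall>b \<in> carrier (based1_coord_ring n). u' b = u b))"
proof -
  interpret based_alg R A n \<sigma> \<phi>
    using algebra_overD(1)[OF R] ba by (simp add: based_alg_def based_alg_axioms_def based_algebra_def)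
  obtain c where c: "classifies n R A \<phi> c" using classifies_exists by blast
  have "\<forall>i<n. c (Unt i) = (if i = 0 then \<one>\<^bsub>R\<^esub> else \<zero>\<^bsub>R\<^esub>)"
    using c one by (simp add: classifies_def std_basis_def)
  then obtain u where u: "u \<in> alg_hom (based1_const n) (based1_coord_ring n) s R"
      "\<forall>v\<in>coords n. u (based1_var n v) = c v"
    using based_coord_ring_hom_iff(2)[OF R, of n c] is_point[OF c] by blast
  have cu: "classifies n R A \<phi> (\<lambda>v. u (based1_var n v))"
    using classifies_cong[OF c u(2)] .
  show ?thesis
  proof (intro bexI[OF _ u(1)] conjI ballI impI)
    fix u' b assume "u' \<in> alg_hom (based1_const n) (based1_coord_ring n) s R"
      "classifies n R A \<phi> (\<lambda>v. u' (based1_var n v))" "b \<in> carrier (based1_coord_ring n :: ((coord \<Rightarrow>\<^sub>0 nat) \<Rightarrow>\<^sub>0 'k) set ring)"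
    then show "u' b = u b"
      using pres_hom_unique[OF relations1_carrier] u(1) classifies_unique[OF _ cu]
      unfolding based1_const_def based1_coord_ring_def based1_var_def by blast
  qed (rule cu)
qed

theorem based1_coord_ring_based_algebra:
  fixes s :: "'k::comm_ring_1 \<Rightarrow> 'r"
  assumes R: "algebra_over s R" and u: "u \<in> alg_hom (based1_const n) (based1_coord_ring n) s R"
  shows "\<exists>(A :: (nat \<Rightarrow> 'r) ring) \<sigma> \<phi>. based_algebra n R A \<sigma> \<phi> \<and>
     \<phi> \<one>\<^bsub>A\<^esub> = std_basis n R 0 \<and> classifies n R A \<phi> (\<lambda>v. u (based1_var n v))"
proof -
  let ?c = "\<lambda>v. u (based1_var n v)"
  have c: "is_point n R ?c" "\<forall>i<n. ?c (Unt i) = (if i = 0 then \<one>\<^bsub>R\<^esub> else \<zero>\<^bsub>R\<^esub>)"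
    using based_coord_ring_hom_iff(2)[OF R, of n ?c] u by blast+
  then have "\<one>\<^bsub>point_algebra n R ?c\<^esub> = std_basis n R 0"
    by (auto simp: point_algebra_def std_basis_def intro!: restrict_ext)
  then show ?thesis using point_algebra_based[OF algebra_overD(1)[OF R] c(1)] by blast
qed

end

theory Submission
  imports Defs
begin

text \<open>
  For \<open>n \<le> 3\<close>, a based algebra over \<open>R/J\<close> with unit \<open>u\<close> first lifts to a commutative product over \<open>R\<close>
  with any given lift of \<open>u\<close> as unit.  Its associator \<open>E\<close> has values in \<open>J\<close>.  Adding \<open>\<delta>(v, w) u\<close> to the product
  with \<open>\<delta>(v, w) = - tr (z \<mapsto> E(v, w, z))\<close> makes the associator a multiple of \<open>u\<close>: as \<open>A/Ru\<close> has rank at most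
  two, this can be checked where \<open>u\<close> extends to a basis, and the coordinates of \<open>u\<close> generate the unit ideal.
  The pentagon identity then forces the associator to vanish.

  For \<open>n \<ge> 4\<close>, an explicit first order deformation of the algebra with radical of square zero does not
  extend to second order.
\<close>


section \<open>Ideals of square zero\<close>

text \<open>Ideals live in a type-class ring, which keeps the long computations within reach of
  \<open>algebra_simps\<close>; \<open>point_lift\<close> transfers the result to arbitrary test
  algebras.\<close>

locale ring_ideal =
  fixes I :: "'a::comm_ring_1 set"
  assumes zero: "0 \<in> I"
    and add: "x \<in> I \<Longrightarrow> y \<in> I \<Longrightarrow> x + y \<in> I"
    and mult: "x \<in> I \<Longrightarrow> a * x \<in> I"
begin

lemma mult_right: "x \<in> I \<Longrightarrow> x * a \<in> I"
  using mult[of x a] by (simp add: mult.commute)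

lemma uminus: "x \<in> I \<Longrightarrow> - x \<in> I"
  using mult[of x "-1"] by simp

lemma uminus_iff: "- x \<in> I \<longleftrightarrow> x \<in> I"
  using uminus[of x] uminus[of "- x"] by auto

lemma diff: "x \<in> I \<Longrightarrow> y \<in> I \<Longrightarrow> x - y \<in> I"
  using add[OF _ uminus] by force

lemma sum: "(\<And>i. i \<in> A \<Longrightarrow> f i \<in> I) \<Longrightarrow> sum f A \<in> I"
  by (induction A rule: infinite_finite_induct) (auto simp: zero add)

lemma mem_cong: "x - y \<in> I \<Longrightarrow> x \<in> I \<longleftrightarrow> y \<in> I"
  using add[of "x - y" y] diff[of x "x - y"] by auto

lemma sum_minus: "(\<And>i. i \<in> A \<Longrightarrow> f i - g i \<in> I) \<Longrightarrow> sum f A - sum g A \<in> I"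
  using sum[of A "\<lambda>i. f i - g i"] by (simp add: sum_subtractf)

lemma mult_cong: "a - a' \<in> I \<Longrightarrow> b - b' \<in> I \<Longrightarrow> a * b - a' * b' \<in> I"
  using add[OF mult_right[of "a - a'" b] mult[of "b - b'" a']] by (simp add: algebra_simps)

end

text \<open>For an ideal \<open>I\<close>, these are the elements that lie in \<open>I\<close> once
  \<open>a\<close> is inverted; this replaces an explicit localization.\<close>

definition saturation :: "'a::comm_ring_1 set \<Rightarrow> 'a \<Rightarrow> 'a set" where
  "saturation I a = {y. \<exists>p. a ^ p * y \<in> I}"

lemma (in ring_ideal) mem_saturation: "y \<in> I \<Longrightarrow> y \<in> saturation I a"
  unfolding saturation_def by (auto intro!: exI[of _ 0])

lemma (in ring_ideal) saturation_mult_cancel: "a * y \<in> saturation I a \<Longrightarrow> y \<in> saturation I a"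
proof -
  assume "a * y \<in> saturation I a"
  then obtain p where "a ^ p * (a * y) \<in> I" by (auto simp: saturation_def)
  then have "a ^ Suc p * y \<in> I" by (simp add: ac_simps)
  then show ?thesis unfolding saturation_def by blast
qed

lemma (in ring_ideal) saturation_ideal: "ring_ideal (saturation I a)"
proof
  show "0 \<in> saturation I a" by (rule mem_saturation[OF zero])
next
  fix x y assume "x \<in> saturation I a" "y \<in> saturation I a"
  then obtain p q where "a ^ p * x \<in> I" "a ^ q * y \<in> I" by (auto simp: saturation_def)
  then have "a ^ q * (a ^ p * x) + a ^ p * (a ^ q * y) \<in> I" by (intro add mult[of "a ^ p * x"] mult[of "a ^ q * y"])
  then have "a ^ (p + q) * (x + y) \<in> I" by (simp add: power_add algebra_simps)
  then show "x + y \<in> saturation I a" unfolding saturation_def by blast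
next
  fix x b assume "x \<in> saturation I a"
  then obtain p where "a ^ p * x \<in> I" by (auto simp: saturation_def)
  then have "b * (a ^ p * x) \<in> I" by (rule mult)
  then show "b * x \<in> saturation I a" unfolding saturation_def
    by (auto intro!: exI[of _ p] simp: ac_simps)
qed

text \<open>Every term of the binomial expansion contains \<open>a ^ p\<close> or
  \<open>b ^ q\<close>.\<close>

lemma (in ring_ideal) kill_power_add:
  assumes "a ^ p * y \<in> I" "b ^ q * y \<in> I"
  shows "(a + b) ^ (p + q) * y \<in> I"
proof -
  have "of_nat ((p + q) choose k) * a ^ k * b ^ (p + q - k) * y \<in> I" if "k \<le> p + q" for k
  proof (cases "p \<le> k")
    case True
    then obtain d where "k = p + d" using le_Suc_ex by blast
    then show ?thesis
      using mult[OF assms(1), of "of_nat ((p + q) choose k) * a ^ d * b ^ (p + q - k)"]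
      by (simp add: power_add ac_simps)
  next
    case False
    then obtain d where "p + q - k = q + d"
      by (metis Nat.diff_add_assoc2 add.commute nat_le_linear)
    then show ?thesis
      using mult[OF assms(2), of "of_nat ((p + q) choose k) * a ^ k * b ^ d"]
      by (simp add: power_add ac_simps)
  qed
  then show ?thesis
    by (auto simp: binomial_ring sum_distrib_right intro!: sum)
qed

text \<open>Models the square-zero ideal J/I of the quotient by \<open>I\<close>.\<close>

locale square_zero = I: ring_ideal I + J: ring_ideal J for I J :: "'a::comm_ring_1 set" +
  assumes sub: "I \<subseteq> J" and sqz: "x \<in> J \<Longrightarrow> y \<in> J \<Longrightarrow> x * y \<in> I"
begin

text \<open>By \<open>kill_power_add\<close>, a power of the sum s sends \<open>y\<close> into
  \<open>I\<close>. But s acts as the identity on \<open>J\<close> modulo \<open>I\<close>, since (s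
  - 1) y is a product of two elements of \<open>J\<close>.\<close>

lemma local_global:
  assumes f: "(\<Sum>k<(n::nat). f k * u k) - 1 \<in> J" and y: "y \<in> J"
    and loc: "\<And>k. k < n \<Longrightarrow> y \<in> saturation I (u k)"
  shows "y \<in> I"
proof -
  have "\<exists>N. (\<Sum>k<m. f k * u k) ^ N * y \<in> I" if "m \<le> n" for m
    using that
  proof (induction m)
    case 0
    \<comment> \<open>The empty sum is 0 and its power 0 is 1, so the exponent has to be
      positive.\<close>
    then show ?case using I.zero by (auto intro!: exI[of _ 1])
  next
    case (Suc m)
    then obtain N where N: "(\<Sum>k<m. f k * u k) ^ N * y \<in> I" by auto
    obtain p where "u m ^ p * y \<in> I" using loc[of m] Suc.prems by (auto simp: saturation_def)
    then have "(f m * u m) ^ p * y \<in> I"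
      using I.mult[of "u m ^ p * y" "f m ^ p"] by (simp add: power_mult_distrib ac_simps)
    then show ?case using I.kill_power_add[OF N] by (auto simp: sum.lessThan_Suc)
  qed
  then obtain N where N: "(\<Sum>k<n. f k * u k) ^ N * y \<in> I" by blast
  have "(\<Sum>k<n. f k * u k) ^ N * y - y \<in> I" for N
  proof (induction N)
    case (Suc N)
    let ?s = "\<Sum>k<n. f k * u k"
    have "?s ^ Suc N * y - y = ?s * (?s ^ N * y - y) + (?s - 1) * y"
      by (simp add: algebra_simps)
    then show ?case using Suc I.add[OF I.mult sqz[OF f y]] by simp
  qed (simp add: I.zero)
  then show ?thesis using I.mem_cong N by blast
qed

text \<open>By \<open>local_global\<close> one may invert each \<open>u k\<close> in turn. Then
  \<open>u1\<close>, \<open>u2\<close> and \<open>anti\<close> express entries with an index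
  \<open>k\<close> through the others. At most two other indices exist, so the remaining entries
  repeat an index and are covered by \<open>diag\<close>, \<open>chart\<close> and
  \<open>anti\<close>.\<close>

lemma trilinear_vanishes:
  assumes n: "n \<le> (3::nat)" and f: "(\<Sum>k<n. f k * u k) - 1 \<in> J"
    and ZJ: "\<And>i j l. i < n \<Longrightarrow> j < n \<Longrightarrow> l < n \<Longrightarrow> Z i j l \<in> J"
    and u1: "\<And>j l. j < n \<Longrightarrow> l < n \<Longrightarrow> (\<Sum>i<n. u i * Z i j l) \<in> I"
    and u2: "\<And>i l. i < n \<Longrightarrow> l < n \<Longrightarrow> (\<Sum>j<n. u j * Z i j l) \<in> I"
    and anti: "\<And>i j l. i < n \<Longrightarrow> j < n \<Longrightarrow> l < n \<Longrightarrow> Z i j l + Z l j i \<in> I"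
    and diag: "\<And>i j. i < n \<Longrightarrow> j < n \<Longrightarrow> Z i j i \<in> I"
    and chart: "\<And>k x y. k < n \<Longrightarrow> x < n \<Longrightarrow> y < n \<Longrightarrow> k \<noteq> x \<Longrightarrow> k \<noteq> y \<Longrightarrow> x \<noteq> y \<Longrightarrow> u k * Z x x y \<in> I"
    and ijl: "i < n" "j < n" "l < n"
  shows "Z i j l \<in> I"
proof (rule local_global[OF f ZJ[OF ijl]])
  fix k assume k: "k < n"
  interpret K: ring_ideal "saturation I (u k)" by (rule I.saturation_ideal)
  have sat: "y \<in> I \<Longrightarrow> y \<in> saturation I (u k)" for y by (rule I.mem_saturation)
  \<comment> \<open>The relation is solved for the entry at \<open>k\<close>, and \<open>u k\<close>
    is cancelled.\<close>
  have red: "g k \<in> saturation I (u k)"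
    if "(\<Sum>i<n. u i * g i) \<in> I" "\<And>i. i < n \<Longrightarrow> i \<noteq> k \<Longrightarrow> g i \<in> saturation I (u k)" for g
  proof -
    have "u k * g k = (\<Sum>i<n. u i * g i) - (\<Sum>i\<in>{..<n} - {k}. u i * g i)"
      using k by (simp add: sum.remove[of "{..<n}" k])
    also have "\<dots> \<in> saturation I (u k)"
      by (rule K.diff[OF sat[OF that(1)] K.sum]) (auto intro: K.mult that(2))
    finally show ?thesis by (rule I.saturation_mult_cancel)
  qed
  have Zxxy: "Z x x y \<in> saturation I (u k)" if "x < n" "y < n" "k \<noteq> x" "k \<noteq> y" "x \<noteq> y" for x y
    using chart[OF k that(1,2)] that I.saturation_mult_cancel sat by blast
  have anti': "Z i j l \<in> saturation I (u k)" if "Z l j i \<in> saturation I (u k)" "i < n" "j < n" "l < n" for i j l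
    using that sat[OF anti[of i j l]] K.diff[of "Z i j l + Z l j i" "Z l j i"] by simp
  have 1: "Z i j l \<in> saturation I (u k)" if ijl: "i < n" "j < n" "l < n" "i \<noteq> k" "j \<noteq> k" "l \<noteq> k" for i j l
  proof -
    \<comment> \<open>Pigeonhole: otherwise \<open>i\<close>, \<open>j\<close>, \<open>l\<close>,
      \<open>k\<close> would be four distinct indices below \<open>n\<close>.\<close>
    have "i = l \<or> j = i \<or> j = l" using card_mono[of "{..<n}" "{i, j, l, k}"] ijl k n by auto
    then consider "i = l" | "i \<noteq> l" "j = i" | "i \<noteq> l" "j = l" by blast
    then show ?thesis
    proof cases
      case 1 then show ?thesis using diag ijl sat by simp
    next
      case 2 then show ?thesis using Zxxy ijl by simp
    next
      case 3 then show ?thesis using ijl anti'[of l j i] Zxxy[of l i] by blast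
    qed
  qed
  \<comment> \<open>The restriction to indices other than \<open>k\<close> is now removed for the
    first, the last and the middle index in turn.\<close>
  have 2: "Z i j l \<in> saturation I (u k)" if "i < n" "j < n" "l < n" "j \<noteq> k" "l \<noteq> k" for i j l
    using red[of "\<lambda>i. Z i j l", OF u1] 1 that by (cases "i = k") auto
  have 3: "Z i j l \<in> saturation I (u k)" if "i < n" "j < n" "l < n" "j \<noteq> k" for i j l
  proof (cases "l = k \<and> i = k")
    case True then show ?thesis using diag sat that by simp
  next
    case False
    then show ?thesis using 2[of i j l] 2[of l j i] anti'[of l j i] that by blast
  qed
  show "Z i j l \<in> saturation I (u k)"
    using red[of "\<lambda>j. Z i j l", OF u2] 3 ijl by (cases "j = k") auto
qed

end

section \<open>Structure constants modulo an ideal\<close>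

text \<open>Coefficient at \<open>m\<close> of the associator (e_i e_j) e_l - e_i (e_j e_l) for the
  product with structure constants \<open>S\<close>.\<close>

definition assoc_defect :: "nat \<Rightarrow> (nat \<Rightarrow> nat \<Rightarrow> nat \<Rightarrow> 'a::comm_ring_1) \<Rightarrow> nat \<Rightarrow> nat \<Rightarrow> nat \<Rightarrow> nat \<Rightarrow> 'a" where
  "assoc_defect n S i j l m = (\<Sum>r<n. S i j r * S r l m) - (\<Sum>r<n. S j l r * S i r m)"

text \<open>Coefficient at \<open>m\<close> of u e_i - e_i.\<close>

definition unit_defect :: "nat \<Rightarrow> (nat \<Rightarrow> nat \<Rightarrow> nat \<Rightarrow> 'a::comm_ring_1) \<Rightarrow> (nat \<Rightarrow> 'a) \<Rightarrow> nat \<Rightarrow> nat \<Rightarrow> 'a" where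
  "unit_defect n S u i m = (\<Sum>r<n. u r * S r i m) - (if i = m then 1 else 0)"

text \<open>With the axioms stated as congruences, an algebra and its lift can be compared inside
  one ring, without quotients.\<close>

definition algebra_mod ::
  "nat \<Rightarrow> 'a::comm_ring_1 set \<Rightarrow> (nat \<Rightarrow> nat \<Rightarrow> nat \<Rightarrow> 'a) \<Rightarrow> (nat \<Rightarrow> 'a) \<Rightarrow> bool" where
  "algebra_mod n I S u \<longleftrightarrow>
     (\<forall>i<n. \<forall>j<n. \<forall>l<n. S i j l - S j i l \<in> I) \<and>
     (\<forall>i<n. \<forall>j<n. \<forall>l<n. \<forall>m<n. assoc_defect n S i j l m \<in> I) \<and>
     (\<forall>i<n. \<forall>m<n. unit_defect n S u i m \<in> I)"

lemma (in ring_ideal) assoc_defect_cong: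
  assumes "\<And>i j l. i < n \<Longrightarrow> j < n \<Longrightarrow> l < n \<Longrightarrow> S' i j l - S i j l \<in> I" "i < n" "j < n" "l < n" "m < n"
  shows "assoc_defect n S' i j l m - assoc_defect n S i j l m \<in> I"
proof -
  have "(\<Sum>r<n. S' i j r * S' r l m) - (\<Sum>r<n. S i j r * S r l m) \<in> I"
    "(\<Sum>r<n. S' j l r * S' i r m) - (\<Sum>r<n. S j l r * S i r m) \<in> I"
    using assms by (auto intro!: sum_minus mult_cong)
  from diff[OF this] show ?thesis by (simp add: assoc_defect_def algebra_simps)
qed

lemma (in ring_ideal) unit_defect_cong:
  assumes "\<And>i j l. i < n \<Longrightarrow> j < n \<Longrightarrow> l < n \<Longrightarrow> S' i j l - S i j l \<in> I" "i < n" "m < n"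
  shows "unit_defect n S' u i m - unit_defect n S u i m \<in> I"
proof -
  have "(\<Sum>r<n. u r * S' r i m) - (\<Sum>r<n. u r * S r i m) \<in> I"
    using assms by (auto intro!: sum_minus mult_cong simp: zero)
  then show ?thesis by (simp add: unit_defect_def)
qed

text \<open>For a commutative product, reversing the order of the factors exchanges the two
  bracketings.\<close>

lemma assoc_defect_antisym:
  assumes "\<And>i j l. S i j l = S j i l"
  shows "assoc_defect n S l j i m = - assoc_defect n S i j l m"
  using assms by (simp add: assoc_defect_def)

text \<open>Both sides expand to the same bracketings of a b c d, while (ab)(cd) cancels on the
  right. In terms of associators: a (b,c,d) + (a,b,c) d = (ab,c,d) - (a,bc,d) + (a,b,cd), for any
  product.\<close>

lemma assoc_defect_pentagon:
  "(\<Sum>r<n. assoc_defect n S b c d r * S a r m) + (\<Sum>r<n. assoc_defect n S a b c r * S r d m) =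
   (\<Sum>r<n. S a b r * assoc_defect n S r c d m) - (\<Sum>r<n. S b c r * assoc_defect n S a r d m) +
   (\<Sum>r<n. S c d r * assoc_defect n S a b r m)"
proof -
  have "(\<Sum>r<n. assoc_defect n S b c d r * S a r m) =
      (\<Sum>r<n. \<Sum>s<n. S b c s * S s d r * S a r m) - (\<Sum>r<n. \<Sum>s<n. S c d s * S b s r * S a r m)"
    by (simp add: assoc_defect_def left_diff_distrib sum_distrib_right sum_subtractf)
  moreover have "(\<Sum>r<n. assoc_defect n S a b c r * S r d m) =
      (\<Sum>r<n. \<Sum>s<n. S a b s * S s c r * S r d m) - (\<Sum>r<n. \<Sum>s<n. S b c s * S a s r * S r d m)"
    by (simp add: assoc_defect_def left_diff_distrib sum_distrib_right sum_subtractf)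
  moreover have "(\<Sum>r<n. S a b r * assoc_defect n S r c d m) =
      (\<Sum>r<n. \<Sum>s<n. S a b r * S r c s * S s d m) - (\<Sum>r<n. \<Sum>s<n. S a b r * S c d s * S r s m)"
    by (simp add: assoc_defect_def right_diff_distrib sum_distrib_left sum_subtractf mult.assoc)
  moreover have "(\<Sum>r<n. S b c r * assoc_defect n S a r d m) =
      (\<Sum>r<n. \<Sum>s<n. S b c r * S a r s * S s d m) - (\<Sum>r<n. \<Sum>s<n. S b c r * S r d s * S a s m)"
    by (simp add: assoc_defect_def right_diff_distrib sum_distrib_left sum_subtractf mult.assoc)
  moreover have "(\<Sum>r<n. S c d r * assoc_defect n S a b r m) =
      (\<Sum>r<n. \<Sum>s<n. S c d r * S a b s * S s r m) - (\<Sum>r<n. \<Sum>s<n. S c d r * S b r s * S a s m)"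
    by (simp add: assoc_defect_def right_diff_distrib sum_distrib_left sum_subtractf mult.assoc)
  moreover have "(\<Sum>r<n. \<Sum>s<n. g s r) = (\<Sum>r<n. \<Sum>s<n. g r s)" for g :: "nat \<Rightarrow> nat \<Rightarrow> 'a"
    by (rule sum.swap)
  note sw = this
  moreover have "(\<Sum>r<n. \<Sum>s<n. S b c s * S s d r * S a r m) = (\<Sum>r<n. \<Sum>s<n. S b c r * S r d s * S a s m)"
    by (rule sw)
  moreover have "(\<Sum>r<n. \<Sum>s<n. S c d s * S b s r * S a r m) = (\<Sum>r<n. \<Sum>s<n. S c d r * S b r s * S a s m)"
    by (rule sw)
  moreover have "(\<Sum>r<n. \<Sum>s<n. S a b s * S s c r * S r d m) = (\<Sum>r<n. \<Sum>s<n. S a b r * S r c s * S s d m)"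
    by (rule sw)
  moreover have "(\<Sum>r<n. \<Sum>s<n. S b c s * S a s r * S r d m) = (\<Sum>r<n. \<Sum>s<n. S b c r * S a r s * S s d m)"
    by (rule sw)
  moreover have "(\<Sum>r<n. \<Sum>s<n. S a b r * S c d s * S r s m) = (\<Sum>r<n. \<Sum>s<n. S c d r * S a b s * S s r m)"
    by (subst sum.swap) (simp add: mult.commute)
  ultimately show ?thesis by simp
qed

lemma sum_if_eq:
  fixes g :: "nat \<Rightarrow> 'a::comm_ring_1"
  assumes "j < n"
  shows "(\<Sum>r<n. (if j = r then 1 else 0) * g r) = g j" "(\<Sum>r<n. g r * (if j = r then 1 else 0)) = g j"
    "(\<Sum>r<n. (if r = j then 1 else 0) * g r) = g j" "(\<Sum>r<n. g r * (if r = j then 1 else 0)) = g j"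
  using assms by (auto simp: if_distrib[of "\<lambda>x. _ * x"] if_distrib[of "\<lambda>x. x * _"] cong: if_cong)

context ring_ideal
begin

text \<open>With \<open>u\<close> as first or middle argument, both bracketings reduce to e_j e_l
  modulo \<open>I\<close>.\<close>

lemma unit_assoc_defect:
  assumes sym: "\<And>i j l. S i j l = S j i l"
    and unit: "\<And>i m. i < n \<Longrightarrow> m < n \<Longrightarrow> unit_defect n S u i m \<in> I"
    and jlm: "j < n" "l < n" "m < n"
  shows "(\<Sum>i<n. u i * assoc_defect n S i j l m) \<in> I" "(\<Sum>i<n. u i * assoc_defect n S j i l m) \<in> I"
proof -
  have sw: "(\<Sum>i<n. u i * (\<Sum>r<n. g i r * h r)) = (\<Sum>r<n. (\<Sum>i<n. u i * g i r) * h r)" for g and h :: "nat \<Rightarrow> 'a"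
    by (simp add: sum_distrib_left sum_distrib_right mult.assoc) (rule sum.swap)
  have "(\<Sum>i<n. u i * assoc_defect n S i j l m) =
      (\<Sum>r<n. (\<Sum>i<n. u i * S i j r) * S r l m) - (\<Sum>r<n. (\<Sum>i<n. u i * S i r m) * S j l r)"
    unfolding assoc_defect_def right_diff_distrib sum_subtractf sw[symmetric]
    by (simp add: mult.commute)
  \<comment> \<open>The Kronecker parts both contribute \<open>S j l m\<close> and cancel.\<close>
  also have "\<dots> = (\<Sum>r<n. unit_defect n S u j r * S r l m) - (\<Sum>r<n. unit_defect n S u r m * S j l r)"
    using jlm by (simp add: unit_defect_def left_diff_distrib sum_subtractf sum_if_eq)
  also have "\<dots> \<in> I" using unit jlm by (intro diff sum mult_right) auto
  finally show "(\<Sum>i<n. u i * assoc_defect n S i j l m) \<in> I" .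
  have "(\<Sum>i<n. u i * assoc_defect n S j i l m) =
      (\<Sum>r<n. (\<Sum>i<n. u i * S i j r) * S r l m) - (\<Sum>r<n. (\<Sum>i<n. u i * S i l r) * S j r m)"
    unfolding assoc_defect_def right_diff_distrib sum_subtractf sw[symmetric] sym[of j]
    by (simp add: sym)
  also have "\<dots> = (\<Sum>r<n. unit_defect n S u j r * S r l m) - (\<Sum>r<n. unit_defect n S u l r * S j r m)"
    using jlm by (simp add: unit_defect_def left_diff_distrib sum_subtractf sum_if_eq sym)
  also have "\<dots> \<in> I" using unit jlm by (intro diff sum mult_right) auto
  finally show "(\<Sum>i<n. u i * assoc_defect n S j i l m) \<in> I" .
qed

end

section \<open>Lifting algebras of rank at most three\<close>

context square_zero
begin

text \<open>
  The corrected multiplication is \<open>v w + f(v) (w - u w) + f(w) (v - u v) - f(v) f(w) (u - u u)\<close>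
  for a linear form \<open>f\<close> with \<open>f(u) = 1\<close> modulo \<open>J\<close>.
\<close>

lemma unital_lift:
  fixes S :: "nat \<Rightarrow> nat \<Rightarrow> nat \<Rightarrow> 'a"
  assumes A: "algebra_mod n J S u" and f: "(\<Sum>k<n. f k * u k) - 1 \<in> J"
  shows "\<exists>S'. (\<forall>i<n. \<forall>j<n. \<forall>l<n. S' i j l - S i j l \<in> J) \<and> (\<forall>i j l. S' i j l = S' j i l) \<and>
     (\<forall>i<n. \<forall>m<n. unit_defect n S' u i m \<in> I)"
proof -
  \<comment> \<open>Commutativity comes from reflecting the entries with \<open>i \<le> j\<close>,
    which avoids dividing by 2.\<close>
  define T where "T i j l = (if i \<le> j then S i j l else S j i l)" for i j l
  have T: "T i j l - S i j l \<in> J" if "i < n" "j < n" "l < n" for i j l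
    using A that by (auto simp: T_def algebra_mod_def J.zero)
  have Tsym: "T i j l = T j i l" for i j l by (simp add: T_def)
  \<comment> \<open>For the product \<open>T\<close>, \<open>d j\<close> has the coordinates of u
    e_j - e_j, and \<open>D\<close> those of u u - u.\<close>
  define d where "d j l = unit_defect n T u j l" for j l
  define D where "D l = (\<Sum>r<n. u r * d r l)" for l
  define S' where "S' i j l = T i j l - f i * d j l - f j * d i l + f i * f j * D l" for i j l
  have d: "d j l \<in> J" if "j < n" "l < n" for j l
    using J.mem_cong[OF J.unit_defect_cong[OF T that]] A that by (simp add: d_def algebra_mod_def)
  have D: "D l \<in> J" if "l < n" for l unfolding D_def using d that by (intro J.sum J.mult) auto
  have 1: "S' i j l - S i j l \<in> J" if "i < n" "j < n" "l < n" for i j l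
  proof -
    have "(T i j l - S i j l) - (f i * d j l + f j * d i l - f i * f j * D l) \<in> J"
      by (rule J.diff[OF T]) (use d D that in \<open>simp_all add: J.add J.diff J.mult\<close>)
    then show ?thesis by (simp add: S'_def algebra_simps)
  qed
  have 2: "unit_defect n S' u j l \<in> I" if "j < n" "l < n" for j l
  proof -
    have fD: "(\<Sum>i<n. u i * (f j * d i l)) = f j * D l"
      by (simp add: D_def sum_distrib_left mult.left_commute)
    have "(\<Sum>i<n. u i * S' i j l) = (\<Sum>i<n. u i * T i j l) - (\<Sum>i<n. f i * u i * d j l)
        - (\<Sum>i<n. u i * (f j * d i l)) + (\<Sum>i<n. f i * u i * (f j * D l))"
      by (simp add: S'_def sum.distrib sum_subtractf algebra_simps)
    then have "(\<Sum>i<n. u i * S' i j l) = (\<Sum>i<n. u i * T i j l) - (\<Sum>i<n. f i * u i) * d j l - f j * D l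
        + (\<Sum>i<n. f i * u i) * (f j * D l)"
      by (simp only: fD sum_distrib_right)
    \<comment> \<open>Both factors lie in \<open>J\<close>, so the product lies in
      \<open>I\<close>.\<close>
    then have "unit_defect n S' u j l = ((\<Sum>i<n. f i * u i) - 1) * (f j * D l - d j l)"
      by (simp add: d_def unit_defect_def algebra_simps)
    then show ?thesis using sqz[OF f] d D that by (simp add: J.diff J.mult)
  qed
  have 3: "S' i j l = S' j i l" for i j l
    unfolding S'_def using Tsym[of i j l] by (simp add: ac_simps)
  show ?thesis using 1 2 3 by blast
qed

end

text \<open>The situation that \<open>unital_lift\<close> provides: only associativity still has to
  be improved from \<open>J\<close> to \<open>I\<close>. The form \<open>f\<close> witnesses that
  the coordinates of \<open>u\<close> generate the unit ideal modulo \<open>J\<close>.\<close>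

locale lift_step = square_zero I J for I J :: "'a::comm_ring_1 set" +
  fixes n :: nat and S :: "nat \<Rightarrow> nat \<Rightarrow> nat \<Rightarrow> 'a" and u f :: "nat \<Rightarrow> 'a"
  assumes n: "n \<le> 3"
    and sym: "S i j l = S j i l"
    and unit: "i < n \<Longrightarrow> m < n \<Longrightarrow> unit_defect n S u i m \<in> I"
    and assocJ: "i < n \<Longrightarrow> j < n \<Longrightarrow> l < n \<Longrightarrow> m < n \<Longrightarrow> assoc_defect n S i j l m \<in> J"
    and f: "(\<Sum>k<n. f k * u k) - 1 \<in> J"
begin

abbreviation E :: "nat \<Rightarrow> nat \<Rightarrow> nat \<Rightarrow> nat \<Rightarrow> 'a" where
  "E \<equiv> assoc_defect n S"

lemma antisym: "E l j i m = - E i j l m"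
  using sym by (rule assoc_defect_antisym)

lemma E_diag: "E i j i m = 0"
  by (simp add: assoc_defect_def sym)

lemma E_unit: "j < n \<Longrightarrow> l < n \<Longrightarrow> m < n \<Longrightarrow> (\<Sum>i<n. u i * E i j l m) \<in> I"
  using I.unit_assoc_defect[of S n u] sym unit by blast+

lemma E_unit3: "j < n \<Longrightarrow> l < n \<Longrightarrow> m < n \<Longrightarrow> (\<Sum>i<n. u i * E j l i m) \<in> I"
  using E_unit[of l j m] I.uminus_iff by (simp add: antisym[of _ l j] sum_negf)

text \<open>
  Adding \<open>\<delta>(v, w) u\<close> to the product changes the associator \<open>E(v, w, z)\<close> by
  \<open>\<delta>(v, w) z - \<delta>(w, z) v\<close> modulo \<open>u\<close>.  When this is to cancel \<open>E\<close> on the module of rank two obtained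
  by dividing out \<open>u\<close>, taking the trace over \<open>z\<close> forces the following choice.
\<close>

definition \<delta> :: "nat \<Rightarrow> nat \<Rightarrow> 'a" where
  "\<delta> i j = - (\<Sum>l<n. E i j l l)"

section \<open>The corrected product and its associator\<close>

definition S' :: "nat \<Rightarrow> nat \<Rightarrow> nat \<Rightarrow> 'a" where
  "S' i j m = S i j m + \<delta> i j * u m"

abbreviation "E' \<equiv> assoc_defect n S'"

text \<open>With L_v the multiplication by v, the trace of z -> E(v, w, z) is tr L_{vw} - tr (L_v
  L_w), and both traces are symmetric in v and w.\<close>

lemma \<delta>_sym: "\<delta> i j = \<delta> j i"
proof -
  have "(\<Sum>l<n. \<Sum>r<n. S j l r * S i r l) = (\<Sum>l<n. \<Sum>r<n. S i l r * S j r l)"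
    by (subst sum.swap) (simp add: sym mult.commute)
  then show ?thesis by (simp add: \<delta>_def assoc_defect_def sum_subtractf sym[of i j])
qed

lemma S'_sym: "S' i j l = S' j i l"
  using sym[of i j l] \<delta>_sym[of i j] by (simp add: S'_def)

lemma \<delta>_J: "i < n \<Longrightarrow> j < n \<Longrightarrow> \<delta> i j \<in> J"
  unfolding \<delta>_def by (intro J.uminus J.sum) (auto intro: assocJ)

lemma S'_J: "i < n \<Longrightarrow> j < n \<Longrightarrow> S' i j l - S i j l \<in> J"
  by (simp add: S'_def J.mult_right \<delta>_J)

text \<open>\<open>E\<close> vanishes modulo \<open>I\<close> when its first argument is
  \<open>u\<close>, hence so does the trace. The correction therefore keeps \<open>u\<close> as unit
  element.\<close>

lemma \<delta>_unit: "j < n \<Longrightarrow> (\<Sum>i<n. u i * \<delta> i j) \<in> I"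
proof -
  assume j: "j < n"
  have "(\<Sum>i<n. u i * \<delta> i j) = - (\<Sum>l<n. \<Sum>i<n. u i * E i j l l)"
    by (simp add: \<delta>_def sum_distrib_left sum_negf) (rule sum.swap)
  also have "\<dots> \<in> I" using j by (intro I.uminus I.sum E_unit) auto
  finally show ?thesis .
qed

lemma S'_unit:
  assumes "j < n" "m < n"
  shows "unit_defect n S' u j m \<in> I"
proof -
  have "unit_defect n S' u j m = unit_defect n S u j m + (\<Sum>i<n. u i * \<delta> i j) * u m"
    by (simp add: unit_defect_def S'_def sum.distrib algebra_simps sum_distrib_left)
  then show ?thesis using unit assms \<delta>_unit by (simp add: I.add I.mult_right)
qed

lemma E'_J: "i < n \<Longrightarrow> j < n \<Longrightarrow> l < n \<Longrightarrow> m < n \<Longrightarrow> E' i j l m \<in> J"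
  using J.mem_cong[OF J.assoc_defect_cong[OF S'_J]] assocJ by simp

lemma E'_antisym: "E' l j i m = - E' i j l m"
  using S'_sym by (rule assoc_defect_antisym)

lemma E'_diag: "E' i j i m = 0"
  by (simp add: assoc_defect_def S'_sym)

lemma E'_unit: "j < n \<Longrightarrow> l < n \<Longrightarrow> m < n \<Longrightarrow> (\<Sum>i<n. u i * E' i j l m) \<in> I"
  "j < n \<Longrightarrow> l < n \<Longrightarrow> m < n \<Longrightarrow> (\<Sum>i<n. u i * E' j i l m) \<in> I"
  using I.unit_assoc_defect[of S' n u] S'_sym S'_unit by blast+

text \<open>The associator of the corrected product up to multiples of \<open>u\<close>; see
  \<open>E'_Y\<close>.\<close>

definition Y :: "nat \<Rightarrow> nat \<Rightarrow> nat \<Rightarrow> nat \<Rightarrow> 'a" where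
  "Y i j l m = E i j l m + \<delta> i j * (if l = m then 1 else 0) - \<delta> j l * (if i = m then 1 else 0)"

text \<open>In the expansion, u e_l = e_l and u e_i = e_i modulo \<open>I\<close> produce the
  \<delta>-terms of \<open>Y\<close>. The other terms linear in \<delta> are multiples of
  \<open>u\<close>, and the quadratic ones contain values \<delta>(u, e_r), which lie in
  \<open>I\<close>.\<close>

lemma E'_Y:
  assumes "i < n" "j < n" "l < n"
  shows "\<exists>c. \<forall>m<n. E' i j l m - (Y i j l m + c * u m) \<in> I"
proof (intro exI allI impI)
  fix m assume m: "m < n"
  define c where "c = (\<Sum>r<n. S i j r * \<delta> r l) - (\<Sum>r<n. S j l r * \<delta> i r)"
  have ud: "(\<Sum>r<n. u r * S r l m) = unit_defect n S u l m + (if l = m then 1 else 0)"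
    "(\<Sum>r<n. u r * S i r m) = unit_defect n S u i m + (if i = m then 1 else 0)"
    by (simp_all add: unit_defect_def sym[of i])
  have "E' i j l m = E i j l m + \<delta> i j * (\<Sum>r<n. u r * S r l m) - \<delta> j l * (\<Sum>r<n. u r * S i r m) + c * u m
      + (\<delta> i j * (\<Sum>r<n. u r * \<delta> r l) - \<delta> j l * (\<Sum>r<n. u r * \<delta> r i)) * u m"
    by (simp add: assoc_defect_def S'_def c_def \<delta>_sym[of i] sum.distrib algebra_simps sum_distrib_left)
  then have "E' i j l m - (Y i j l m + c * u m) =
      \<delta> i j * unit_defect n S u l m - \<delta> j l * unit_defect n S u i m
      + (\<delta> i j * (\<Sum>r<n. u r * \<delta> r l) - \<delta> j l * (\<Sum>r<n. u r * \<delta> r i)) * u m"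
    unfolding ud by (simp add: Y_def algebra_simps)
  also have "\<dots> \<in> I"
    using assms m unit \<delta>_unit by (intro I.add I.diff I.mult I.mult_right)
  finally show "E' i j l m - (Y i j l m + ((\<Sum>r<n. S i j r * \<delta> r l) - (\<Sum>r<n. S j l r * \<delta> i r)) * u m) \<in> I"
    unfolding c_def .
qed

text \<open>
  In a chart where \<open>u\<close> and two basis vectors \<open>x, y\<close> generate, \<open>Y(x, x, y)\<close> is a multiple of \<open>u\<close>.
\<close>

lemma chart_Y:
  assumes kxy: "k < n" "x < n" "y < n" "k \<noteq> x" "k \<noteq> y" "x \<noteq> y" and m: "m < n"
  shows "u k * Y x x y m - u m * E x x y k \<in> I"
proof -
  \<comment> \<open>There are at most three indices, so these are all of them.\<close>
  have s: "{..<n} = {k, x, y}"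
    by (rule card_seteq[symmetric]) (use kxy n in auto)
  have sum3: "sum g {..<n} = g k + g x + g y" for g :: "nat \<Rightarrow> 'a"
    unfolding s using kxy by (simp add: add.assoc)
  have yx: "E y x x m = - E x x y m" for m by (rule antisym)
  \<comment> \<open>These expand E(x, x, u) and E(y, x, u), which vanish modulo \<open>I\<close>;
    associators with equal outer arguments drop out.\<close>
  have e1: "u k * E x x k m + u y * E x x y m \<in> I" if "m < n" for m
    using E_unit3[of x x m] kxy that by (simp add: sum3 E_diag)
  have e2: "u k * E y x k m - u x * E x x y m \<in> I" if "m < n" for m
    using E_unit3[of y x m] kxy that by (simp add: sum3 E_diag yx)
  have d1: "\<delta> x x = - E x x k k - E x x y y" by (simp add: \<delta>_def sum3 E_diag)
  \<comment> \<open>Symmetry of \<delta> replaces the trace of E(x, y, z) over z by that of E(y, x,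
    z), which involves E(x, x, y) again.\<close>
  have d2: "\<delta> x y = - E y x k k + E x x y x"
    by (subst \<delta>_sym) (simp add: \<delta>_def sum3 E_diag yx)
  consider "m = k" | "m = x" | "m = y" using m s by auto
  then show ?thesis
  proof cases
    case 1
    then show ?thesis using kxy by (simp add: Y_def I.zero)
  next
    case 2
    then have "u k * Y x x y m - u m * E x x y k = u k * E y x k k - u x * E x x y k"
      using kxy by (simp add: Y_def d2 algebra_simps)
    then show ?thesis using e2[OF kxy(1)] by simp
  next
    case 3
    then have "u k * Y x x y m - u m * E x x y k = - (u k * E x x k k + u y * E x x y k)"
      using kxy by (simp add: Y_def d1 algebra_simps)
    then show ?thesis using e1[OF kxy(1)] by (simp only: I.uminus_iff)
  qed
qed

text \<open>The 2 x 2 minors of \<open>E' i j l\<close> against \<open>u\<close> satisfy the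
  hypotheses of \<open>trilinear_vanishes\<close>. For the chart condition, \<open>E'\<close>
  differs from \<open>Y\<close> by a multiple of \<open>u\<close>, and \<open>chart_Y\<close>
  handles \<open>Y\<close>.\<close>

lemma E'_parallel:
  assumes "i < n" "j < n" "l < n" "m < n" "p < n"
  shows "E' i j l m * u p - E' i j l p * u m \<in> I"
proof (rule trilinear_vanishes[OF n f, where Z = "\<lambda>i j l. E' i j l m * u p - E' i j l p * u m"])
  fix i j l assume ijl: "i < n" "j < n" "l < n"
  show "E' i j l m * u p - E' i j l p * u m \<in> J"
    using E'_J ijl assms by (intro J.diff J.mult_right) auto
  show "E' i j l m * u p - E' i j l p * u m + (E' l j i m * u p - E' l j i p * u m) \<in> I"
    by (simp add: E'_antisym[of l] I.zero)
next
  fix j l assume jl: "j < n" "l < n"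
  have "(\<Sum>i<n. u i * E' i j l m) * u p - (\<Sum>i<n. u i * E' i j l p) * u m \<in> I"
    using jl assms by (intro I.diff I.mult_right E'_unit)
  then show "(\<Sum>i<n. u i * (E' i j l m * u p - E' i j l p * u m)) \<in> I"
    by (simp add: right_diff_distrib sum_subtractf sum_distrib_right mult.assoc)
  have "(\<Sum>i<n. u i * E' j i l m) * u p - (\<Sum>i<n. u i * E' j i l p) * u m \<in> I"
    using jl assms by (intro I.diff I.mult_right E'_unit)
  then show "(\<Sum>i<n. u i * (E' j i l m * u p - E' j i l p * u m)) \<in> I"
    by (simp add: right_diff_distrib sum_subtractf sum_distrib_right mult.assoc)
  show "E' j l j m * u p - E' j l j p * u m \<in> I" by (simp add: E'_diag I.zero)
next
  fix k x y assume kxy: "k < n" "x < n" "y < n" "k \<noteq> x" "k \<noteq> y" "x \<noteq> y"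
  obtain c where c: "\<And>m. m < n \<Longrightarrow> E' x x y m - (Y x x y m + c * u m) \<in> I"
    using E'_Y[OF kxy(2,2,3)] by blast
  \<comment> \<open>In this combination the terms with \<open>c\<close> and with
    \<open>E x x y k\<close> cancel.\<close>
  have "(u k * (E' x x y m - (Y x x y m + c * u m)) + (u k * Y x x y m - u m * E x x y k)) * u p
      - (u k * (E' x x y p - (Y x x y p + c * u p)) + (u k * Y x x y p - u p * E x x y k)) * u m \<in> I"
    using assms kxy by (intro I.diff I.mult_right I.add I.mult c chart_Y)
  then show "u k * (E' x x y m * u p - E' x x y p * u m) \<in> I"
    by (simp add: algebra_simps)
qed (use assms in auto)

section \<open>The remaining component of the associator along the unit element\<close>

definition \<theta> :: "nat \<Rightarrow> nat \<Rightarrow> nat \<Rightarrow> 'a" where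
  "\<theta> i j l = (\<Sum>p<n. f p * E' i j l p)"

text \<open>Contracting the minors with \<open>f\<close> gives f(u) \<open>E'\<close> - \<theta> u,
  and (f(u) - 1) \<open>E'\<close> is a product of two elements of \<open>J\<close>.\<close>

lemma E'_\<theta>:
  assumes "i < n" "j < n" "l < n" "m < n"
  shows "E' i j l m - \<theta> i j l * u m \<in> I"
proof -
  have "(\<Sum>p<n. f p * (E' i j l m * u p - E' i j l p * u m)) - ((\<Sum>k<n. f k * u k) - 1) * E' i j l m \<in> I"
    using assms by (intro I.diff I.sum I.mult E'_parallel sqz[OF f] E'_J) auto
  also have "(\<Sum>p<n. f p * (E' i j l m * u p - E' i j l p * u m)) - ((\<Sum>k<n. f k * u k) - 1) * E' i j l m =
      E' i j l m - \<theta> i j l * u m"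
    by (simp add: \<theta>_def right_diff_distrib left_diff_distrib sum_subtractf sum_distrib_right mult.assoc)
      (simp add: mult.commute)
  finally show ?thesis .
qed

text \<open>Multiplying \<theta> u by e_a gives \<theta> e_a modulo \<open>I\<close>, since
  \<open>u\<close> is the unit element there.\<close>

lemma contract:
  assumes "\<And>r. r < n \<Longrightarrow> E' i j l r - \<theta> i j l * u r \<in> I" "a < n" "m < n"
  shows "(\<Sum>r<n. E' i j l r * S' a r m) - \<theta> i j l * (if a = m then 1 else 0) \<in> I"
proof -
  have "(\<Sum>r<n. (E' i j l r - \<theta> i j l * u r) * S' a r m) + \<theta> i j l * unit_defect n S' u a m \<in> I"
    using assms by (intro I.add I.sum I.mult I.mult_right S'_unit) auto
  also have "(\<Sum>r<n. (E' i j l r - \<theta> i j l * u r) * S' a r m) + \<theta> i j l * unit_defect n S' u a m =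
     (\<Sum>r<n. E' i j l r * S' a r m) - \<theta> i j l * (if a = m then 1 else 0)"
    by (simp add: unit_defect_def algebra_simps sum_subtractf sum_distrib_left S'_sym[of a] del: mult_1_right)
  finally show ?thesis .
qed

text \<open>
  Modulo \<open>u\<close>, the pentagon identity reads \<open>a \<theta>(b, c, d) + \<theta>(a, b, c) d = 0\<close>.
\<close>

lemma \<theta>_pentagon:
  assumes "a < n" "b < n" "c < n" "d < n"
  shows "\<exists>t. \<forall>m<n. \<theta> b c d * (if a = m then 1 else 0) + \<theta> a b c * (if d = m then 1 else 0) - t * u m \<in> I"
proof (intro exI allI impI)
  fix m assume m: "m < n"
  \<comment> \<open>Replacing each \<open>E'\<close> on the right of the pentagon identity by
    \<theta> u leaves \<open>?t\<close> times \<open>u\<close>.\<close>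
  let ?t = "(\<Sum>r<n. S' a b r * \<theta> r c d) - (\<Sum>r<n. S' b c r * \<theta> a r d) + (\<Sum>r<n. S' c d r * \<theta> a b r)"
  have s: "(\<Sum>r<n. g r * E' (h1 r) (h2 r) (h3 r) m) - (\<Sum>r<n. g r * \<theta> (h1 r) (h2 r) (h3 r)) * u m \<in> I"
    if "\<And>r. r < n \<Longrightarrow> h1 r < n \<and> h2 r < n \<and> h3 r < n" for g h1 h2 h3
  proof -
    have "(\<Sum>r<n. g r * (E' (h1 r) (h2 r) (h3 r) m - \<theta> (h1 r) (h2 r) (h3 r) * u m)) \<in> I"
      using that m by (intro I.sum I.mult E'_\<theta>) auto
    then show ?thesis by (simp add: right_diff_distrib sum_subtractf sum_distrib_right mult.assoc)
  qed
  let ?s1 = "\<Sum>r<n. S' a b r * E' r c d m" and ?s2 = "\<Sum>r<n. S' b c r * E' a r d m"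
    and ?s3 = "\<Sum>r<n. S' c d r * E' a b r m"
  define \<alpha> :: 'a where "\<alpha> = (if a = m then 1 else 0)"
  define \<beta> :: 'a where "\<beta> = (if d = m then 1 else 0)"
  have p1: "(?s1 - (\<Sum>r<n. S' a b r * \<theta> r c d) * u m) - (?s2 - (\<Sum>r<n. S' b c r * \<theta> a r d) * u m)
     + (?s3 - (\<Sum>r<n. S' c d r * \<theta> a b r) * u m) \<in> I"
    by (rule I.add[OF I.diff[OF s[of "\<lambda>r. r" "\<lambda>_. c" "\<lambda>_. d"] s[of "\<lambda>_. a" "\<lambda>r. r" "\<lambda>_. d"]]
          s[of "\<lambda>_. a" "\<lambda>_. b" "\<lambda>r. r"]]) (use assms in auto)
  have p2: "((\<Sum>r<n. E' b c d r * S' a r m) - \<theta> b c d * \<alpha>) + ((\<Sum>r<n. E' a b c r * S' d r m) - \<theta> a b c * \<beta>) \<in> I"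
    unfolding \<alpha>_def \<beta>_def by (rule I.add[OF contract contract]) (use assms m E'_\<theta> in auto)
  have "(\<Sum>r<n. E' b c d r * S' a r m) + (\<Sum>r<n. E' a b c r * S' d r m) = ?s1 - ?s2 + ?s3"
    using assoc_defect_pentagon[of n S' b c d a m] by (simp only: S'_sym[of d])
  then have "\<theta> b c d * \<alpha> + \<theta> a b c * \<beta> - ?t * u m =
     ((?s1 - (\<Sum>r<n. S' a b r * \<theta> r c d) * u m) - (?s2 - (\<Sum>r<n. S' b c r * \<theta> a r d) * u m)
     + (?s3 - (\<Sum>r<n. S' c d r * \<theta> a b r) * u m)) -
     (((\<Sum>r<n. E' b c d r * S' a r m) - \<theta> b c d * \<alpha>) + ((\<Sum>r<n. E' a b c r * S' d r m) - \<theta> a b c * \<beta>))"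
    by (simp add: algebra_simps)
  then have "\<theta> b c d * \<alpha> + \<theta> a b c * \<beta> - ?t * u m \<in> I"
    using I.diff[OF p1 p2] by (simp only:)
  then show "\<theta> b c d * (if a = m then 1 else 0) + \<theta> a b c * (if d = m then 1 else 0) - ?t * u m \<in> I"
    unfolding \<alpha>_def \<beta>_def .
qed

text \<open>\<open>trilinear_vanishes\<close> applies once more; its chart condition comes from the
  pentagon for x, x, x, y.\<close>

lemma \<theta>_zero:
  assumes "i < n" "j < n" "l < n"
  shows "\<theta> i j l \<in> I"
proof (rule trilinear_vanishes[OF n f, where Z = \<theta>])
  have sw: "(\<Sum>i<n. u i * (\<Sum>p<n. f p * g i p)) = (\<Sum>p<n. f p * (\<Sum>i<n. u i * g i p))" for g
    by (simp add: sum_distrib_left mult.left_commute) (rule sum.swap)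
  show "\<theta> i j l \<in> J" if "i < n" "j < n" "l < n" for i j l
    unfolding \<theta>_def using that by (intro J.sum J.mult E'_J) auto
  show "(\<Sum>i<n. u i * \<theta> i j l) \<in> I" "(\<Sum>i<n. u i * \<theta> j i l) \<in> I" if "j < n" "l < n" for j l
    unfolding \<theta>_def sw by (rule I.sum, rule I.mult, rule E'_unit; use that in simp)+
  show "\<theta> i j l + \<theta> l j i \<in> I" for i j l
    by (simp add: \<theta>_def E'_antisym[of l] sum_negf I.zero)
  show diag: "\<theta> i j i \<in> I" for i j
    by (simp add: \<theta>_def E'_diag I.zero)
  fix k x y assume kxy: "k < n" "x < n" "y < n" "k \<noteq> x" "k \<noteq> y" "x \<noteq> y"
  \<comment> \<open>The coefficients at e_x and e_k give \<theta>(x, x, y) = t u_x and t u_k = 0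
    modulo \<open>I\<close>; the term \<theta>(x, x, x) e_y contributes to neither. Eliminating
    \<open>t\<close> gives the claim.\<close>
  obtain t where t: "\<And>m. m < n \<Longrightarrow>
      \<theta> x x y * (if x = m then 1 else 0) + \<theta> x x x * (if y = m then 1 else 0) - t * u m \<in> I"
    using \<theta>_pentagon[of x x x y] kxy by blast
  have "u k * (\<theta> x x y - t * u x) - u x * (- (t * u k)) \<in> I"
    by (rule I.diff[OF I.mult I.mult]) (use t[of x] t[of k] kxy in simp_all)
  then show "u k * \<theta> x x y \<in> I" by (simp add: algebra_simps)
qed (use assms in auto)

lemma E'_zero: "i < n \<Longrightarrow> j < n \<Longrightarrow> l < n \<Longrightarrow> m < n \<Longrightarrow> E' i j l m \<in> I"
  using I.mem_cong[OF E'_\<theta>] I.mult_right[OF \<theta>_zero] by simp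

lemma algebra_mod_S': "algebra_mod n I S' u"
  using S'_sym S'_unit E'_zero by (simp add: algebra_mod_def I.zero)

end

theorem (in square_zero) algebra_mod_lift:
  assumes n: "n \<le> 3" and A: "algebra_mod n J S u"
  shows "\<exists>S'. (\<forall>i<n. \<forall>j<n. \<forall>l<n. S' i j l - S i j l \<in> J) \<and> algebra_mod n I S' u"
proof (cases "n = 0")
  case True
  then show ?thesis by (auto simp: algebra_mod_def)
next
  case False
  \<comment> \<open>The coefficient at 0 of the relation u e_0 = e_0 says that this form takes the
    value 1 at \<open>u\<close> modulo \<open>J\<close>.\<close>
  define f where "f r = S r 0 0" for r
  have "unit_defect n S u 0 0 \<in> J" using A False by (simp add: algebra_mod_def)
  then have f: "(\<Sum>k<n. f k * u k) - 1 \<in> J"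
    by (simp add: unit_defect_def f_def mult.commute)
  obtain T where T': "(\<forall>i<n. \<forall>j<n. \<forall>l<n. T i j l - S i j l \<in> J) \<and> (\<forall>i j l. T i j l = T j i l) \<and>
      (\<forall>i<n. \<forall>m<n. unit_defect n T u i m \<in> I)"
    using unital_lift[OF A f] by (rule exE)
  note T = T'[THEN conjunct1, rule_format]
  have Tsym: "T i j l = T j i l" for i j l using T'[THEN conjunct2, THEN conjunct1, rule_format] .
  have "assoc_defect n T i j l m \<in> J" if "i < n" "j < n" "l < n" "m < n" for i j l m
    using J.mem_cong[OF J.assoc_defect_cong[OF T]] that A
    by (simp add: algebra_mod_def)
  then interpret L: lift_step I J n T u f
    using n f Tsym T' by (simp add: lift_step_def lift_step_axioms_def square_zero_axioms)
  have "L.S' i j l - S i j l \<in> J" if "i < n" "j < n" "l < n" for i j l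
    using J.add[OF L.S'_J[of i j l] T[of i j l]] that by simp
  then show ?thesis using L.algebra_mod_S' by blast
qed

section \<open>From coordinate rings to structure constants\<close>

lemma mpoly_ring_UNIV: "mpoly_ring UNIV = ring_of_type_algebra"
  by (simp add: mpoly_ring_def ring_of_type_algebra_def)

lemma rota_cring: "cring (ring_of_type_algebra :: 'a::comm_ring_1 ring)"
proof (rule cringI)
  show "abelian_group (ring_of_type_algebra :: 'a ring)"
    by (rule abelian_groupI) (auto simp: algebra_simps intro: exI[of _ "- x" for x])
  show "comm_monoid (ring_of_type_algebra :: 'a ring)"
    by (rule comm_monoidI) (auto simp: algebra_simps)
qed (simp add: algebra_simps)

text \<open>Links a type-class ring to a ring with a carrier: equations in \<open>R\<close> become
  congruences modulo the kernel of \<open>h\<close>, as in \<open>is_point_iff\<close>.\<close>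

locale rota_hom = R: cring R for R :: "'r ring" +
  fixes h :: "'a::comm_ring_1 \<Rightarrow> 'r"
  assumes hom: "h \<in> ring_hom ring_of_type_algebra R"
begin

lemma closed [simp]: "h x \<in> carrier R"
  and mult: "h (x * y) = h x \<otimes>\<^bsub>R\<^esub> h y" and add: "h (x + y) = h x \<oplus>\<^bsub>R\<^esub> h y" and one: "h 1 = \<one>\<^bsub>R\<^esub>"
  using hom by (auto simp: ring_hom_def)

lemma zero: "h 0 = \<zero>\<^bsub>R\<^esub>"
  using add[of 0 0] by (metis R.add.l_cancel_one R.zero_closed add.right_neutral closed)

lemma diff_zero_iff: "h (x - y) = \<zero>\<^bsub>R\<^esub> \<longleftrightarrow> h x = h y"
proof -
  have "h x = h (x - y) \<oplus>\<^bsub>R\<^esub> h y" using add[of "x - y" y] by simp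
  then show ?thesis by (metis R.add.r_cancel_one closed)
qed

lemma sum_mult: "h (\<Sum>r<n. f r * g r) = finsum R (\<lambda>r. h (f r) \<otimes>\<^bsub>R\<^esub> h (g r)) {..<(n::nat)}"
proof -
  have "h (sum F A) = finsum R (\<lambda>r. h (F r)) A" if "finite A" for F and A :: "nat set"
    using that by (induction A rule: finite_induct) (simp_all add: zero add R.finsum_insert)
  then show ?thesis by (simp add: mult)
qed

lemma preimage_ideal:
  assumes "ideal K R"
  shows "ring_ideal {x. h x \<in> K}"
proof
  interpret K: ideal K R by fact
  show "0 \<in> {x. h x \<in> K}" by (simp add: zero)
  show "x + y \<in> {x. h x \<in> K}" if "x \<in> {x. h x \<in> K}" "y \<in> {x. h x \<in> K}" for x y
    using that by (simp add: add)
  show "a * x \<in> {x. h x \<in> K}" if "x \<in> {x. h x \<in> K}" for a x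
    using that by (simp add: mult K.I_l_closed)
qed

lemma is_point_iff:
  "is_point n R (\<lambda>v. h (c v)) \<longleftrightarrow>
     algebra_mod n {x. h x = \<zero>\<^bsub>R\<^esub>} (\<lambda>i j l. c (Str i j l)) (\<lambda>i. c (Unt i))"
proof -
  have "h (if i = m then 1 else 0) = (if i = m then \<one>\<^bsub>R\<^esub> else \<zero>\<^bsub>R\<^esub>)" for i m :: nat
    by (simp add: zero one)
  then show ?thesis
    by (simp add: is_point_def algebra_mod_def assoc_defect_def unit_defect_def diff_zero_iff sum_mult
        cong: if_cong)
qed

end

text \<open>\<open>R\<close> is the image of a polynomial ring, and pulling back the zero ideal and
  \<open>J\<close> gives the \<open>square_zero\<close> situation. Prescribing the lift
  \<open>w\<close> of the unit element makes the result usable for both coordinate rings.\<close>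

theorem point_lift:
  fixes s :: "'k::comm_ring_1 \<Rightarrow> 'r"
  assumes n: "n \<le> 3" and R: "algebra_over s R" and J: "ideal J R"
    and sq: "\<forall>x\<in>J. \<forall>y\<in>J. x \<otimes>\<^bsub>R\<^esub> y = \<zero>\<^bsub>R\<^esub>" and c: "is_point n (R Quot J) c"
    and w: "\<And>i. i < n \<Longrightarrow> w i \<in> carrier R" "\<And>i. i < n \<Longrightarrow> J +>\<^bsub>R\<^esub> w i = c (Unt i)"
  shows "\<exists>c'. is_point n R c' \<and> (\<forall>v\<in>coords n. J +>\<^bsub>R\<^esub> c' v = c v) \<and> (\<forall>i<n. c' (Unt i) = w i)"
proof -
  note Rc = algebra_overD(1)[OF R]
  interpret R: cring R by (rule Rc)
  \<comment> \<open>There is one variable for each element of \<open>'r\<close>; those outside the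
    carrier are sent to zero.\<close>
  obtain e where e: "e \<in> alg_hom Const (mpoly_ring (UNIV :: 'r set)) s R"
      "\<And>v. e (Var v) = (if v \<in> carrier R then v else \<zero>\<^bsub>R\<^esub>)"
    using mpoly_eval_total[OF R, of "\<lambda>v. if v \<in> carrier R then v else \<zero>\<^bsub>R\<^esub>"] by fastforce
  interpret E: rota_hom R e
    using e(1) Rc by (simp add: rota_hom_def rota_hom_axioms_def alg_hom_def mpoly_ring_UNIV)
  interpret Q: rota_hom "R Quot J" "\<lambda>x. J +>\<^bsub>R\<^esub> e x"
    using alg_hom_comp[OF e(1) algebra_over_quot(2)[OF R J]] algebra_overD(1)[OF algebra_over_quot(1)[OF R J]]
    by (simp add: rota_hom_def rota_hom_axioms_def alg_hom_def mpoly_ring_UNIV)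
  define I' where "I' = {x. e x = \<zero>\<^bsub>R\<^esub>}"
  define J' where "J' = {x. e x \<in> J}"
  interpret square_zero I' J'
  proof -
    have "ring_ideal I'" using E.preimage_ideal[OF R.zeroideal] by (simp add: I'_def)
    moreover have "ring_ideal J'" using E.preimage_ideal[OF J] by (simp add: J'_def)
    moreover have "I' \<subseteq> J'"
      using additive_subgroup.zero_closed[OF ideal.axioms(1)[OF J]] by (auto simp: I'_def J'_def)
    ultimately show "square_zero I' J'"
      using sq by (simp add: square_zero_def square_zero_axioms_def I'_def J'_def E.mult)
  qed
  have J'_eq: "{x. J +>\<^bsub>R\<^esub> e x = \<zero>\<^bsub>R Quot J\<^esub>} = J'"
    using quot_eq_zero_iff[OF J] by (simp add: J'_def)
  have cq: "c v \<in> carrier (R Quot J)" if "v \<in> coords n" for v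
    using c that by (auto simp: is_point_def coords_def)
  \<comment> \<open>Representatives of the coordinates: the variable of the prescribed
    \<open>w i\<close> for the unit, and of an arbitrarily chosen lift otherwise.\<close>
  define b :: "coord \<Rightarrow> ('r \<Rightarrow>\<^sub>0 nat) \<Rightarrow>\<^sub>0 'k" where
    "b v = Var (case v of Unt i \<Rightarrow> w i | _ \<Rightarrow> SOME r. r \<in> carrier R \<and> J +>\<^bsub>R\<^esub> r = c v)" for v
  have b: "J +>\<^bsub>R\<^esub> e (b v) = c v" if "v \<in> coords n" for v
  proof (cases v)
    case (Str i j l)
    then have "\<exists>r. r \<in> carrier R \<and> J +>\<^bsub>R\<^esub> r = c v"
      using cq[OF that] by (auto simp: quot_carrier)
    then have "(SOME r. r \<in> carrier R \<and> J +>\<^bsub>R\<^esub> r = c v) \<in> carrier R \<and>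
        J +>\<^bsub>R\<^esub> (SOME r. r \<in> carrier R \<and> J +>\<^bsub>R\<^esub> r = c v) = c v" by (rule someI_ex)
    then show ?thesis using Str by (simp add: b_def e(2))
  next
    case (Unt i)
    then show ?thesis using that w by (simp add: b_def e(2))
  qed
  have "is_point n (R Quot J) (\<lambda>v. J +>\<^bsub>R\<^esub> e (b v))"
    using is_point_cong[OF _ Q.R.is_cring c] b by simp
  then have "algebra_mod n J' (\<lambda>i j l. b (Str i j l)) (\<lambda>i. b (Unt i))"
    unfolding Q.is_point_iff J'_eq .
  then obtain S' where S': "\<forall>i<n. \<forall>j<n. \<forall>l<n. S' i j l - b (Str i j l) \<in> J'"
      "algebra_mod n I' S' (\<lambda>i. b (Unt i))"
    using algebra_mod_lift[OF n] by blast
  define b' where "b' v = (case v of Str i j l \<Rightarrow> S' i j l | Unt i \<Rightarrow> b v)" for v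
  have "algebra_mod n {x. e x = \<zero>\<^bsub>R\<^esub>} (\<lambda>i j l. b' (Str i j l)) (\<lambda>i. b' (Unt i))"
    using S'(2) by (simp add: b'_def I'_def)
  then have "is_point n R (\<lambda>v. e (b' v))" by (simp add: E.is_point_iff)
  moreover have "J +>\<^bsub>R\<^esub> e (b' v) = c v" if "v \<in> coords n" for v
  proof (cases v)
    case (Str i j l)
    then have "b' v - b v \<in> J'" using S'(1) that by (simp add: b'_def)
    then have "J +>\<^bsub>R\<^esub> e (b' v) = J +>\<^bsub>R\<^esub> e (b v)"
      unfolding J'_eq[symmetric] using Q.diff_zero_iff by simp
    then show ?thesis using b[OF that] by simp
  next
    case (Unt i)
    then show ?thesis using b[OF that] by (simp add: b'_def)
  qed
  moreover have "e (b' (Unt i)) = w i" if "i < n" for i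
    using w(1)[OF that] by (simp add: b'_def b_def e(2))
  ultimately show ?thesis by (intro exI[of _ "\<lambda>v. e (b' v)"]) simp
qed

text \<open>Homomorphisms out of a presentation are determined by the images of the variables, so a
  lift has to be compared with \<open>g\<close> only there.\<close>

lemma formally_smooth_pres_ring:
  fixes F :: "(('v \<Rightarrow>\<^sub>0 nat) \<Rightarrow>\<^sub>0 'k::comm_ring_1) set"
  assumes F: "F \<subseteq> carrier (mpoly_ring V)"
    and lift: "\<And>(R :: 'r ring) s J g. algebra_over s R \<Longrightarrow> ideal J R \<Longrightarrow>
      \<forall>x\<in>J. \<forall>y\<in>J. x \<otimes>\<^bsub>R\<^esub> y = \<zero>\<^bsub>R\<^esub> \<Longrightarrow>
      g \<in> alg_hom (pres_const V F) (pres_ring V F) (\<lambda>a. J +>\<^bsub>R\<^esub> s a) (R Quot J) \<Longrightarrow>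
      \<exists>h\<in>alg_hom (pres_const V F) (pres_ring V F) s R. \<forall>v\<in>V. J +>\<^bsub>R\<^esub> h (pres_var V F v) = g (pres_var V F v)"
  shows "formally_smooth TYPE('r) (pres_const V F) (pres_ring V F)"
  unfolding formally_smooth_def
proof (intro allI impI ballI)
  fix R :: "'r ring" and s J g
  assume R: "algebra_over s R" and J: "ideal J R" and sq: "\<forall>x\<in>J. \<forall>y\<in>J. x \<otimes>\<^bsub>R\<^esub> y = \<zero>\<^bsub>R\<^esub>"
    and g: "g \<in> alg_hom (pres_const V F) (pres_ring V F) (\<lambda>a. J +>\<^bsub>R\<^esub> s a) (R Quot J)"
  obtain h where h: "h \<in> alg_hom (pres_const V F) (pres_ring V F) s R"
      "\<And>v. v \<in> V \<Longrightarrow> J +>\<^bsub>R\<^esub> h (pres_var V F v) = g (pres_var V F v)"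
    using lift[OF R J sq g] by blast
  show "\<exists>h\<in>alg_hom (pres_const V F) (pres_ring V F) s R. \<forall>b\<in>carrier (pres_ring V F). J +>\<^bsub>R\<^esub> h b = g b"
    using pres_hom_unique[OF F alg_hom_comp[OF h(1) algebra_over_quot(2)[OF R J]] g] h
    by (intro bexI[OF _ h(1)]) simp
qed

lemma pres_ring_finite_type:
  fixes F :: "(('v \<Rightarrow>\<^sub>0 nat) \<Rightarrow>\<^sub>0 'k::comm_ring_1) set"
  assumes F: "F \<subseteq> carrier (mpoly_ring V)" and V: "finite V"
  shows "finite_type_algebra (pres_const V F) (pres_ring V F)"
proof -
  let ?B = "pres_ring V F" and ?G = "range (pres_const V F) \<union> pres_var V F ` V"
  let ?q = "\<lambda>p. genideal (mpoly_ring V) F +>\<^bsub>mpoly_ring V\<^esub> p"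
  note q = alg_homD[OF pres_algebra(2)[OF F]]
  have carr: "?G \<subseteq> carrier ?B"
    using algebra_overD(2)[OF pres_algebra(1)[OF F]] q(3)[OF mpoly_Var]
    by (auto simp: pres_var_def)
  have ring: "ring ?B" using algebra_overD(1)[OF pres_algebra(1)[OF F]] by (simp add: cring_def)
  have "?q p \<in> generate_ring ?B ?G" if "p \<in> carrier (mpoly_ring V)" for p
    using that
  proof (induction p rule: mpoly_induct)
    case (Const a)
    then show ?case by (intro generate_ring.incl) (auto simp: pres_const_def)
  next
    case (Var v)
    then show ?case by (intro generate_ring.incl) (auto simp: pres_var_def)
  next
    case (add p r)
    then show ?case using q(4)[of p r] generate_ring.eng_add by (metis mpoly_simps(2))
  next
    case (mult p r)
    then show ?case using q(5)[of p r] generate_ring.eng_mult by (metis mpoly_simps(1))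
  qed
  then have "carrier ?B \<subseteq> generate_ring ?B ?G"
    by (auto simp: pres_ring_def quot_carrier)
  moreover have "generate_ring ?B ?G \<subseteq> carrier ?B"
    using ring.generate_ring_incl[OF ring carr] .
  ultimately show ?thesis
    unfolding finite_type_algebra_def using pres_algebra(1)[OF F] V carr
    by (intro conjI exI[of _ "pres_var V F ` V"]) auto
qed

section \<open>Smoothness in rank at most three\<close>

lemma finite_coords: "finite (coords n)"
proof -
  have "coords n = (\<lambda>(i, j, l). Str i j l) ` ({..<n} \<times> {..<n} \<times> {..<n}) \<union> Unt ` {..<n}"
    by (auto simp: coords_def image_iff)
  then show ?thesis by simp
qed

theorem smooth_based_coord_ring:
  assumes n: "n \<le> 3"
  shows "smooth_algebra (based_const n :: 'k::field \<Rightarrow> _) (based_coord_ring n)"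
  unfolding smooth_algebra_def
proof
  show "finite_type_algebra (based_const n :: 'k \<Rightarrow> _) (based_coord_ring n)"
    unfolding based_const_def based_coord_ring_def
    by (rule pres_ring_finite_type[OF relations_carrier finite_coords])
  show "formally_smooth TYPE(((nat \<Rightarrow>\<^sub>0 nat) \<Rightarrow>\<^sub>0 'k) set) (based_const n :: 'k \<Rightarrow> _) (based_coord_ring n)"
    unfolding based_const_def based_coord_ring_def
  proof (rule formally_smooth_pres_ring[OF relations_carrier], fold based_const_def based_coord_ring_def based_var_def)
    fix R :: "((nat \<Rightarrow>\<^sub>0 nat) \<Rightarrow>\<^sub>0 'k) set ring" and s J g
    assume R: "algebra_over s R" and J: "ideal J R" and sq: "\<forall>x\<in>J. \<forall>y\<in>J. x \<otimes>\<^bsub>R\<^esub> y = \<zero>\<^bsub>R\<^esub>"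
      and g: "g \<in> alg_hom (based_const n :: 'k \<Rightarrow> _) (based_coord_ring n) (\<lambda>a. J +>\<^bsub>R\<^esub> s a) (R Quot J)"
    have c: "is_point n (R Quot J) (\<lambda>v. g (based_var n v))"
      using based_coord_ring_hom_iff(1)[OF algebra_over_quot(1)[OF R J]] g by blast
    \<comment> \<open>Here the unit coordinates may be lifted arbitrarily.\<close>
    then have "\<forall>i. \<exists>r. i < n \<longrightarrow> r \<in> carrier R \<and> J +>\<^bsub>R\<^esub> r = g (based_var n (Unt i))"
      unfolding is_point_def quot_carrier by metis
    then obtain w where w: "\<And>i. i < n \<Longrightarrow> w i \<in> carrier R" "\<And>i. i < n \<Longrightarrow> J +>\<^bsub>R\<^esub> w i = g (based_var n (Unt i))"
      by metis
    obtain c' where c': "is_point n R c'" "\<forall>v\<in>coords n. J +>\<^bsub>R\<^esub> c' v = g (based_var n v)"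
      using point_lift[OF n R J sq c w] by blast
    obtain h where "h \<in> alg_hom (based_const n) (based_coord_ring n) s R"
        "\<forall>v\<in>coords n. h (based_var n v) = c' v"
      using based_coord_ring_hom_iff(1)[OF R, THEN iffD2, OF c'(1)] by (rule bexE)
    with c'(2) show "\<exists>h\<in>alg_hom (based_const n) (based_coord_ring n) s R.
        \<forall>v\<in>coords n. J +>\<^bsub>R\<^esub> h (based_var n v) = g (based_var n v)"
      by (intro bexI[of _ h]) simp_all
  qed
qed

theorem smooth_based1_coord_ring:
  assumes n: "n \<le> 3"
  shows "smooth_algebra (based1_const n :: 'k::field \<Rightarrow> _) (based1_coord_ring n)"
  unfolding smooth_algebra_def
proof
  show "finite_type_algebra (based1_const n :: 'k \<Rightarrow> _) (based1_coord_ring n)"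
    unfolding based1_const_def based1_coord_ring_def
    by (rule pres_ring_finite_type[OF relations1_carrier finite_coords])
  show "formally_smooth TYPE(((nat \<Rightarrow>\<^sub>0 nat) \<Rightarrow>\<^sub>0 'k) set) (based1_const n :: 'k \<Rightarrow> _) (based1_coord_ring n)"
    unfolding based1_const_def based1_coord_ring_def
  proof (rule formally_smooth_pres_ring[OF relations1_carrier], fold based1_const_def based1_coord_ring_def based1_var_def)
    fix R :: "((nat \<Rightarrow>\<^sub>0 nat) \<Rightarrow>\<^sub>0 'k) set ring" and s J g
    assume R: "algebra_over s R" and J: "ideal J R" and sq: "\<forall>x\<in>J. \<forall>y\<in>J. x \<otimes>\<^bsub>R\<^esub> y = \<zero>\<^bsub>R\<^esub>"
      and g: "g \<in> alg_hom (based1_const n :: 'k \<Rightarrow> _) (based1_coord_ring n) (\<lambda>a. J +>\<^bsub>R\<^esub> s a) (R Quot J)"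
    interpret R: cring R by (rule algebra_overD(1)[OF R])
    have "is_point n (R Quot J) (\<lambda>v. g (based1_var n v)) \<and>
        (\<forall>i<n. g (based1_var n (Unt i)) = (if i = 0 then \<one>\<^bsub>R Quot J\<^esub> else \<zero>\<^bsub>R Quot J\<^esub>))"
      by (rule based_coord_ring_hom_iff(2)[OF algebra_over_quot(1)[OF R J], THEN iffD1]) (rule bexI[OF _ g], simp)
    note c = this[THEN conjunct1] this[THEN conjunct2]
    \<comment> \<open>The unit is lifted to the first standard basis vector over \<open>R\<close>,
      so that the additional relations of \<open>relations1\<close> persist.\<close>
    define w where "w i = (if i = 0 then \<one>\<^bsub>R\<^esub> else \<zero>\<^bsub>R\<^esub>)" for i :: nat
    have "J +>\<^bsub>R\<^esub> w i = g (based1_var n (Unt i))" if "i < n" for i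
      using c(2) that alg_homD(6)[OF algebra_over_quot(2)[OF R J]]
        alg_hom_zero[OF algebra_over_quot(2)[OF R J] R.is_cring algebra_overD(1)[OF algebra_over_quot(1)[OF R J]]]
      by (simp add: w_def)
    moreover have "w i \<in> carrier R" for i by (simp add: w_def)
    ultimately have "\<exists>c'. is_point n R c' \<and> (\<forall>v\<in>coords n. J +>\<^bsub>R\<^esub> c' v = g (based1_var n v)) \<and> (\<forall>i<n. c' (Unt i) = w i)"
      by (intro point_lift[OF n R J sq c(1)])
    then obtain c' where c': "is_point n R c'" "\<forall>v\<in>coords n. J +>\<^bsub>R\<^esub> c' v = g (based1_var n v)"
        "\<forall>i<n. c' (Unt i) = w i"
      by blast
    have "\<forall>i<n. c' (Unt i) = (if i = 0 then \<one>\<^bsub>R\<^esub> else \<zero>\<^bsub>R\<^esub>)" using c'(3) by (simp add: w_def)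
    then obtain h where "h \<in> alg_hom (based1_const n) (based1_coord_ring n) s R"
        "\<forall>v\<in>coords n. h (based1_var n v) = c' v"
      using based_coord_ring_hom_iff(2)[OF R, THEN iffD2, OF conjI, OF c'(1)] by blast
    with c'(2) show "\<exists>h\<in>alg_hom (based1_const n) (based1_coord_ring n) s R.
        \<forall>v\<in>coords n. J +>\<^bsub>R\<^esub> h (based1_var n v) = g (based1_var n v)"
      by (intro bexI[of _ h]) simp_all
  qed
qed

section \<open>Obstructed algebras of rank at least four\<close>

text \<open>The ring \<open>'a[t]/(t\<^sup>3)\<close>.\<close>

datatype 'a trunc = Trunc (coef0: 'a) (coef1: 'a) (coef2: 'a)

instantiation trunc :: (comm_ring_1) comm_ring_1
begin

definition "0 = Trunc 0 0 0"
definition "1 = Trunc 1 0 0"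
definition "x + y = Trunc (coef0 x + coef0 y) (coef1 x + coef1 y) (coef2 x + coef2 y)"
definition "- x = Trunc (- coef0 x) (- coef1 x) (- coef2 x)"
definition "x - y = Trunc (coef0 x - coef0 y) (coef1 x - coef1 y) (coef2 x - coef2 y)"
definition "x * y = Trunc (coef0 x * coef0 y) (coef0 x * coef1 y + coef1 x * coef0 y)
  (coef0 x * coef2 y + coef1 x * coef1 y + coef2 x * coef0 y)"

instance
  by standard (simp_all add: zero_trunc_def one_trunc_def plus_trunc_def uminus_trunc_def minus_trunc_def
      times_trunc_def algebra_simps)

end

lemmas trunc_defs = zero_trunc_def one_trunc_def plus_trunc_def uminus_trunc_def minus_trunc_def times_trunc_def

definition trunc_const :: "'a::comm_ring_1 \<Rightarrow> 'a trunc" where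
  "trunc_const a = Trunc a 0 0"

text \<open>The ideal (t^2): its square is zero, and the quotient is the ring of dual
  numbers.\<close>

definition trunc_ideal :: "'a::comm_ring_1 trunc set" where
  "trunc_ideal = {x. coef0 x = 0 \<and> coef1 x = 0}"

lemma trunc_const_algebra: "algebra_over trunc_const ring_of_type_algebra"
  unfolding algebra_over_def
  by (intro conjI rota_cring ring_hom_memI) (simp_all add: trunc_const_def trunc_defs)

interpretation TJ: ring_ideal "trunc_ideal :: 'a::comm_ring_1 trunc set"
  by unfold_locales (simp_all add: trunc_ideal_def trunc_defs)

lemma trunc_ideal: "ideal (trunc_ideal :: 'a::comm_ring_1 trunc set) ring_of_type_algebra"
proof -
  interpret R: cring "ring_of_type_algebra :: 'a trunc ring" by (rule rota_cring)
  have inv: "\<ominus>\<^bsub>ring_of_type_algebra\<^esub> x = - x" for x :: "'a trunc"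
    by (rule R.minus_equality) simp_all
  show ?thesis
  proof (rule idealI[OF R.ring_axioms R.add.subgroupI])
    show "(trunc_ideal :: 'a trunc set) \<noteq> {}" using TJ.zero by blast
    show "\<ominus>\<^bsub>ring_of_type_algebra\<^esub> x \<in> trunc_ideal" if "x \<in> trunc_ideal" for x :: "'a trunc"
      using TJ.uminus[OF that] inv[of x] by simp
  qed (simp_all add: TJ.add TJ.mult TJ.mult_right)
qed

lemma trunc_ideal_square: "x \<in> trunc_ideal \<Longrightarrow> coef0 y = 0 \<Longrightarrow> x * y = 0" "x \<in> trunc_ideal \<Longrightarrow> coef0 y = 0 \<Longrightarrow> y * x = 0"
  by (simp_all add: trunc_ideal_def trunc_defs)

text \<open>
  A first order deformation of \<open>'a[x\<^sub>1, x\<^sub>2, \<dots>]/(x\<^sub>1, x\<^sub>2, \<dots>)\<^sup>2\<close>, with basis \<open>1, x\<^sub>1, x\<^sub>2, \<dots>\<close>, given by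
  \<open>x\<^sub>1\<^sup>2 = t x\<^sub>2\<close> and \<open>x\<^sub>2\<^sup>2 = t x\<^sub>3\<close>.  Modulo \<open>t\<^sup>3\<close>, the product \<open>(x\<^sub>1 x\<^sub>1) x\<^sub>2\<close> has coefficient \<open>t\<^sup>2\<close> at \<open>x\<^sub>3\<close>,
  and \<open>x\<^sub>1 (x\<^sub>1 x\<^sub>2)\<close> has coefficient \<open>0\<close>.
\<close>

definition obstructed :: "nat \<Rightarrow> nat \<Rightarrow> nat \<Rightarrow> 'a::comm_ring_1 trunc" where
  "obstructed i j l = (if i = 0 then (if j = l then 1 else 0) else if j = 0 then (if i = l then 1 else 0)
     else if i = 1 \<and> j = 1 \<and> l = 2 \<or> i = 2 \<and> j = 2 \<and> l = 3 then Trunc 0 1 0 else 0)"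

lemma obstructed_sym: "obstructed i j l = obstructed j i l"
  by (auto simp: obstructed_def)

lemma obstructed_0: "obstructed 0 j l = (if j = l then 1 else 0)" "obstructed j 0 l = (if j = l then 1 else 0)"
  by (auto simp: obstructed_def)

text \<open>Entries whose first two indices are nonzero are 0 or t, and vanish at third index 0. So
  either the first factor is 0 or both factors are multiples of t.\<close>

lemma obstructed_triple:
  assumes "i \<noteq> 0" "j \<noteq> 0" "l \<noteq> 0"
  shows "obstructed i j r * obstructed r l m \<in> trunc_ideal"
  using assms by (auto simp: obstructed_def trunc_ideal_def trunc_defs)

lemma obstructed_algebra_mod:
  assumes n: "0 < n"
  shows "algebra_mod n trunc_ideal obstructed (\<lambda>i. if i = 0 then 1 else (0 :: 'a::comm_ring_1 trunc))"
proof -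
  have "assoc_defect n obstructed i j l m \<in> (trunc_ideal :: 'a trunc set)"
    if "i < n" "j < n" "l < n" "m < n" for i j l m
  proof (cases "i = 0 \<or> j = 0 \<or> l = 0")
    case True
    then have "assoc_defect n obstructed i j l m = (0 :: 'a trunc)"
      using that by (auto simp: assoc_defect_def obstructed_0 sum_if_eq simp del: mult_1_left)
    then show ?thesis by (simp add: TJ.zero)
  next
    case False
    then have "obstructed i j r * obstructed r l m \<in> (trunc_ideal :: 'a trunc set)"
      "obstructed j l r * obstructed i r m \<in> (trunc_ideal :: 'a trunc set)" for r
      using obstructed_triple[of i j l r m] obstructed_triple[of j l i r m] by (simp_all add: obstructed_sym[of i r])
    then show ?thesis unfolding assoc_defect_def by (intro TJ.diff TJ.sum)
  qed
  moreover have "unit_defect n obstructed (\<lambda>i. if i = 0 then 1 else 0) i m = (0 :: 'a trunc)"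
    if "i < n" "m < n" for i m
    using n by (simp add: unit_defect_def sum_if_eq(3) obstructed_0)
  ultimately show ?thesis
    unfolding algebra_mod_def by (simp add: obstructed_sym TJ.zero)
qed

text \<open>Changes by multiples of t^2 leave the product of the entries (1,1,2) and (2,2,3) equal
  to t^2. In every other summand of the two sums both factors lie in (t^2). The index 3 requires
  rank at least four.\<close>

lemma obstructed_no_lift:
  fixes S :: "nat \<Rightarrow> nat \<Rightarrow> nat \<Rightarrow> 'a::comm_ring_1 trunc"
  assumes n: "4 \<le> n" and S: "\<And>i j l. i < n \<Longrightarrow> j < n \<Longrightarrow> l < n \<Longrightarrow> S i j l - obstructed i j l \<in> trunc_ideal"
  shows "assoc_defect n S 1 1 2 3 \<noteq> 0"
proof -
  have J: "S i j l \<in> trunc_ideal" if "i < n" "j < n" "l < n" "obstructed i j l = (0 :: 'a trunc)" for i j l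
    using S[OF that(1-3)] that(4) by simp
  have J0: "coef0 x = 0" if "x \<in> trunc_ideal" for x :: "'a trunc"
    using that by (simp add: trunc_ideal_def)
  have "S 1 1 r * S r 2 3 = 0" if "r < n" "r \<noteq> 2" for r
    using that n by (intro trunc_ideal_square J J0) (auto simp: obstructed_def)
  then have "(\<Sum>r<n. S 1 1 r * S r 2 3) = (\<Sum>r<n. if r = 2 then S 1 1 2 * S 2 2 3 else 0)"
    by (intro sum.cong) auto
  also have "\<dots> = S 1 1 2 * S 2 2 3" using n by simp
  finally have 1: "(\<Sum>r<n. S 1 1 r * S r 2 3) = S 1 1 2 * S 2 2 3" .
  have 2: "(\<Sum>r<n. S 1 2 r * S 1 r 3) = 0"
    using n by (intro sum.neutral ballI trunc_ideal_square J J0) (auto simp: obstructed_def)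
  have "coef0 (S 1 1 2) = 0" "coef1 (S 1 1 2) = 1" "coef0 (S 2 2 3) = 0" "coef1 (S 2 2 3) = 1"
    using S[of 1 1 2] S[of 2 2 3] n by (auto simp: obstructed_def trunc_ideal_def trunc_defs)
  then have "coef2 (S 1 1 2 * S 2 2 3) = 1" by (simp add: times_trunc_def)
  then have "coef2 (assoc_defect n S 1 1 2 3) = 1" unfolding assoc_defect_def 1 2 by simp
  then show ?thesis by (metis trunc.sel(3) zero_neq_one zero_trunc_def)
qed

section \<open>The obstructed point over the dual numbers\<close>

definition obstructed_point :: "coord \<Rightarrow> 'a::comm_ring_1 trunc set" where
  "obstructed_point v = trunc_ideal +>\<^bsub>ring_of_type_algebra\<^esub>
     (case v of Str i j l \<Rightarrow> obstructed i j l | Unt i \<Rightarrow> if i = 0 then 1 else 0)"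

lemma trunc_quot_hom:
  "rota_hom (ring_of_type_algebra Quot trunc_ideal) (\<lambda>x :: 'a::comm_ring_1 trunc. trunc_ideal +>\<^bsub>ring_of_type_algebra\<^esub> x)"
  using algebra_over_quot[OF trunc_const_algebra[where 'a = 'a] trunc_ideal]
  by (simp add: rota_hom_def rota_hom_axioms_def alg_hom_def algebra_over_def)

text \<open>The second part lets the same point serve both coordinate rings.\<close>

lemma obstructed_point:
  assumes "0 < n"
  shows "is_point n (ring_of_type_algebra Quot trunc_ideal) (obstructed_point :: coord \<Rightarrow> 'a::comm_ring_1 trunc set)"
    "obstructed_point (Unt i) = (if i = 0 then \<one>\<^bsub>(ring_of_type_algebra :: 'a trunc ring) Quot trunc_ideal\<^esub>
        else \<zero>\<^bsub>ring_of_type_algebra Quot trunc_ideal\<^esub>)"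
proof -
  interpret Q: rota_hom "ring_of_type_algebra Quot trunc_ideal"
    "\<lambda>x :: 'a trunc. trunc_ideal +>\<^bsub>ring_of_type_algebra\<^esub> x" by (rule trunc_quot_hom)
  have "{x :: 'a trunc. trunc_ideal +>\<^bsub>ring_of_type_algebra\<^esub> x = \<zero>\<^bsub>ring_of_type_algebra Quot trunc_ideal\<^esub>} = trunc_ideal"
    by (simp add: quot_eq_zero_iff[OF trunc_ideal])
  then show "is_point n (ring_of_type_algebra Quot trunc_ideal) (obstructed_point :: coord \<Rightarrow> 'a trunc set)"
    unfolding obstructed_point_def[abs_def] Q.is_point_iff
    using obstructed_algebra_mod[OF assms, where 'a = 'a] by simp
  show "obstructed_point (Unt i) = (if i = 0 then \<one>\<^bsub>(ring_of_type_algebra :: 'a trunc ring) Quot trunc_ideal\<^esub>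
        else \<zero>\<^bsub>ring_of_type_algebra Quot trunc_ideal\<^esub>)"
    using Q.zero Q.one by (simp add: obstructed_point_def)
qed

lemma obstructed_point_no_lift:
  fixes c :: "coord \<Rightarrow> 'a::comm_ring_1 trunc"
  assumes n: "4 \<le> n" and c: "is_point n ring_of_type_algebra c"
    and lift: "\<forall>v\<in>coords n. trunc_ideal +>\<^bsub>ring_of_type_algebra\<^esub> c v = obstructed_point v"
  shows False
proof -
  interpret Q: rota_hom "ring_of_type_algebra Quot trunc_ideal"
    "\<lambda>x :: 'a trunc. trunc_ideal +>\<^bsub>ring_of_type_algebra\<^esub> x" by (rule trunc_quot_hom)
  interpret R: rota_hom "ring_of_type_algebra :: 'a trunc ring" "\<lambda>x. x"
    using rota_cring by (simp add: rota_hom_def rota_hom_axioms_def ring_hom_def)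
  have "c (Str i j l) - obstructed i j l \<in> trunc_ideal" if "i < n" "j < n" "l < n" for i j l
    using lift[rule_format, of "Str i j l"] that
      Q.diff_zero_iff[of "c (Str i j l)" "obstructed i j l"]
    by (simp add: obstructed_point_def quot_eq_zero_iff[OF trunc_ideal])
  then have "assoc_defect n (\<lambda>i j l. c (Str i j l)) 1 1 2 3 \<noteq> 0"
    by (rule obstructed_no_lift[OF n])
  moreover have "algebra_mod n {0} (\<lambda>i j l. c (Str i j l)) (\<lambda>i. c (Unt i))"
    using c R.is_point_iff[of n c] by simp
  ultimately show False using n by (simp add: algebra_mod_def)
qed

text \<open>\<open>smooth_imp_formally_smooth\<close> is what allows a test algebra with carrier in
  \<open>'k trunc\<close>.\<close>

lemma smooth_trunc_lift:
  fixes t :: "'k::field \<Rightarrow> 'b"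
  assumes "smooth_algebra t B" and g: "g \<in> alg_hom t B (\<lambda>a. trunc_ideal +>\<^bsub>ring_of_type_algebra\<^esub> trunc_const a)
      (ring_of_type_algebra Quot trunc_ideal)"
  shows "\<exists>h\<in>alg_hom t B (trunc_const :: 'k \<Rightarrow> 'k trunc) ring_of_type_algebra.
    \<forall>b\<in>carrier B. trunc_ideal +>\<^bsub>ring_of_type_algebra\<^esub> h b = g b"
proof -
  have "\<forall>x\<in>trunc_ideal. \<forall>y\<in>trunc_ideal. x \<otimes>\<^bsub>ring_of_type_algebra\<^esub> y = \<zero>\<^bsub>(ring_of_type_algebra :: 'k trunc ring)\<^esub>"
    by (simp add: trunc_ideal_def trunc_defs)
  then show ?thesis
    using smooth_imp_formally_smooth[OF assms(1), where 'r = "'k trunc"] trunc_const_algebra[where 'a = 'k] trunc_ideal[where 'a = 'k] g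
    unfolding formally_smooth_def by blast
qed

lemma pres_var_closed:
  assumes F: "F \<subseteq> carrier (mpoly_ring V)" and v: "v \<in> V"
  shows "pres_var V F v \<in> carrier (pres_ring V F)"
  using alg_homD(3)[OF pres_algebra(2)[OF F] mpoly_Var[OF v]] by (simp add: pres_var_def)

section \<open>Failure of smoothness in rank at least four\<close>

theorem not_smooth_based_coord_ring:
  assumes n: "4 \<le> n"
  shows "\<not> smooth_algebra (based_const n :: 'k::field \<Rightarrow> _) (based_coord_ring n)"
proof
  assume sm: "smooth_algebra (based_const n :: 'k \<Rightarrow> _) (based_coord_ring n)"
  let ?R = "ring_of_type_algebra :: 'k trunc ring"
  have pt: "is_point n (?R Quot trunc_ideal) obstructed_point" using obstructed_point(1)[of n, where 'a = 'k] n by simp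
  obtain g where g: "g \<in> alg_hom (based_const n) (based_coord_ring n)
      (\<lambda>a :: 'k. trunc_ideal +>\<^bsub>?R\<^esub> trunc_const a) (?R Quot trunc_ideal)"
      "\<forall>v\<in>coords n. g (based_var n v) = obstructed_point v"
    using based_coord_ring_hom_iff(1)[OF algebra_over_quot(1)[OF trunc_const_algebra trunc_ideal], THEN iffD2, OF pt]
    by (rule bexE)
  obtain h where h: "h \<in> alg_hom (based_const n) (based_coord_ring n) trunc_const ?R"
      "\<forall>b\<in>carrier (based_coord_ring n). trunc_ideal +>\<^bsub>?R\<^esub> h b = g b"
    using smooth_trunc_lift[OF sm g(1)] by (rule bexE)
  have "based_var n v \<in> carrier (based_coord_ring n :: ((coord \<Rightarrow>\<^sub>0 nat) \<Rightarrow>\<^sub>0 'k) set ring)" if "v \<in> coords n" for v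
    unfolding based_var_def based_coord_ring_def using that by (rule pres_var_closed[OF relations_carrier])
  then have "\<forall>v\<in>coords n. trunc_ideal +>\<^bsub>?R\<^esub> h (based_var n v) = obstructed_point v" using h(2) g(2) by simp
  moreover have "is_point n ?R (\<lambda>v. h (based_var n v))"
    by (rule based_coord_ring_hom_iff(1)[OF trunc_const_algebra, THEN iffD1]) (rule bexI[OF _ h(1)], simp)
  ultimately show False by (blast intro: obstructed_point_no_lift[OF n])
qed

theorem not_smooth_based1_coord_ring:
  assumes n: "4 \<le> n"
  shows "\<not> smooth_algebra (based1_const n :: 'k::field \<Rightarrow> _) (based1_coord_ring n)"
proof
  assume sm: "smooth_algebra (based1_const n :: 'k \<Rightarrow> _) (based1_coord_ring n)"
  let ?R = "ring_of_type_algebra :: 'k trunc ring"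
  have pt: "is_point n (?R Quot trunc_ideal) obstructed_point \<and> (\<forall>i<n. obstructed_point (Unt i) =
      (if i = 0 then \<one>\<^bsub>?R Quot trunc_ideal\<^esub> else \<zero>\<^bsub>?R Quot trunc_ideal\<^esub>))"
    using obstructed_point[of n, where 'a = 'k] n by simp
  obtain g where g: "g \<in> alg_hom (based1_const n) (based1_coord_ring n)
      (\<lambda>a :: 'k. trunc_ideal +>\<^bsub>?R\<^esub> trunc_const a) (?R Quot trunc_ideal)"
      "\<forall>v\<in>coords n. g (based1_var n v) = obstructed_point v"
    using based_coord_ring_hom_iff(2)[OF algebra_over_quot(1)[OF trunc_const_algebra trunc_ideal], THEN iffD2, OF pt]
    by (rule bexE)
  obtain h where h: "h \<in> alg_hom (based1_const n) (based1_coord_ring n) trunc_const ?R"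
      "\<forall>b\<in>carrier (based1_coord_ring n). trunc_ideal +>\<^bsub>?R\<^esub> h b = g b"
    using smooth_trunc_lift[OF sm g(1)] by (rule bexE)
  have "based1_var n v \<in> carrier (based1_coord_ring n :: ((coord \<Rightarrow>\<^sub>0 nat) \<Rightarrow>\<^sub>0 'k) set ring)" if "v \<in> coords n" for v
    unfolding based1_var_def based1_coord_ring_def using that by (rule pres_var_closed[OF relations1_carrier])
  then have "\<forall>v\<in>coords n. trunc_ideal +>\<^bsub>?R\<^esub> h (based1_var n v) = obstructed_point v" using h(2) g(2) by simp
  moreover have "is_point n ?R (\<lambda>v. h (based1_var n v)) \<and>
      (\<forall>i<n. h (based1_var n (Unt i)) = (if i = 0 then \<one>\<^bsub>?R\<^esub> else \<zero>\<^bsub>?R\<^esub>))"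
    by (rule based_coord_ring_hom_iff(2)[OF trunc_const_algebra, THEN iffD1]) (rule bexI[OF _ h(1)], simp)
  ultimately show False by (blast intro: obstructed_point_no_lift[OF n])
qed

theorem proposition8p4:
  fixes n :: nat
  shows "(n \<le> 3 \<longleftrightarrow>
            smooth_algebra (based1_const n :: 'k::field \<Rightarrow> _) (based1_coord_ring n)) \<and>
         (n \<le> 3 \<longleftrightarrow>
            smooth_algebra (based_const n :: 'k \<Rightarrow> _) (based_coord_ring n))"
  using smooth_based_coord_ring[of n, where 'k = 'k] smooth_based1_coord_ring[of n, where 'k = 'k]
    not_smooth_based_coord_ring[of n, where 'k = 'k] not_smooth_based1_coord_ring[of n, where 'k = 'k]
  by (cases "n \<le> 3") auto

end
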